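(* Let $c_0\in\partial\mathbb{T}$ be a Misiurewicz parameter of the antiholomorphic quadratic family $g_c(z)=\overline{z}^{\,2}+c$. Then there exist an entire function $\phi$ on $\mathbb{C}$, a real linear transformation $h:\mathbb{C}\to\mathbb{C}$, and a sequence $(\rho_k)_{k\in\mathbb{N}}$ of nonzero complex numbers with $\rho_k\to0$ such that, setting $\mathcal{J}^\ast:=\phi^{-1}(J_{c_0}^\ast)\subset\mathbb{C}$, for every sufficiently large constant $r>0$ we have (a) $[\rho_k^{-1}(J_{c_0}^\ast-c_0)]_r\to[\mathcal{J}^\ast]_r$, and (b) $[\rho_k^{-1}h(\mathbb{T}-c_0)]_r\to[\mathcal{J}^\ast]_r$ as $k\to\infty$ in the Hausdorff topology.
   Context: For $c\in\mathbb{C}$ let $g_c(z)=\overline{z}^{\,2}+c$, and let $g_c^n$ denote the $n$-th iterate. The tricorn $\mathbb{T}$ is the set of $c\in\mathbb{C}$ such that $(g_c^n(c))_{n\in\mathbb{N}}$ is bounded. The filled Julia set $K_c^\ast$ is the set of $z\in\mathbb{C}$ such that $(g_c^n(z))_{n\in\mathbb{N}}$ is bounded, and the Julia set is $J_c^\ast=\partial K_c^\ast$. All of $\mathbb{T},K_c^\ast,J_c^\ast$ are non-empty compact sets. A parameter $c_0\in\partial\mathbb{T}$ is a Misiurewicz parameter if the forward orbit of $c_0$ under $g_{c_0}$ eventually lands on a repelling periodic point; that is, there exist (minimal) $l\ge1$ and $p\ge1$ such that $g_{c_0}^l(c_0)=g_{c_0}^{l+p}(c_0)$ and $|Dg_{c_0}^p(g_{c_0}^l(c_0))|>1$,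 where $|Dg_{c_0}^p|$ denotes the modulus of the complex derivative of whichever of $g_{c_0}^p$, $\overline{g_{c_0}^p}$ is holomorphic. Notation: $\mathbb{D}(r)=\{z\in\mathbb{C}:|z|<r\}$. For a closed set $K\subset\mathbb{C}$, $[K]_r:=(K\cap\mathbb{D}(r))\cup\partial\mathbb{D}(r)$. For a set $K\subset\mathbb{C}$, $a\in\mathbb{C}\setminus\{0\}$ and $b\in\mathbb{C}$, $a(K-b):=\{a(z-b):z\in K\}$; similarly $\rho^{-1}h(K-b):=\{\rho^{-1}h(z-b):z\in K\}$. Hausdorff topology: a sequence of non-empty compact sets $K_k\subset\mathbb{C}$ converges to a non-empty compact set $K\subset\mathbb{C}$ if for every $\epsilon>0$ there is $k_0$ such that $K\subset N_\epsilon(K_k)$ and $K_k\subset N_\epsilon(K)$ for all $k\ge k_0$, where $N_\epsilon(\cdot)$ is the open $\epsilon$-neighborhood in $\mathbb{C}$. *)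

theory Defs
  imports "HOL-Complex_Analysis.Complex_Analysis"
begin

definition antiquad :: "complex \<Rightarrow> complex \<Rightarrow> complex" where
  "antiquad c z = (cnj z)\<^sup>2 + c"

definition tricorn :: "complex set" where
  "tricorn = {c. bounded (range (\<lambda>n. (antiquad c ^^ n) c))}"

definition filled_julia :: "complex \<Rightarrow> complex set" where
  "filled_julia c = {z. bounded (range (\<lambda>n. (antiquad c ^^ n) z))}"

definition julia :: "complex \<Rightarrow> complex set" where
  "julia c = frontier (filled_julia c)"

text \<open>The iterates of the antiholomorphic map \<open>antiquad c\<close> are alternately holomorphic and
  antiholomorphic. The value below is the modulus of the complex derivative of the \<open>n\<close>-th iterate
  or of its complex conjugate, whichever is holomorphic (never both, since neither is constant).\<close>

definition deriv_modulus :: "complex \<Rightarrow> nat \<Rightarrow> complex \<Rightarrow> real" where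
  "deriv_modulus c n z =
     (if (antiquad c ^^ n) holomorphic_on UNIV
      then cmod (deriv (antiquad c ^^ n) z)
      else cmod (deriv (\<lambda>w. cnj ((antiquad c ^^ n) w)) z))"

text \<open>The integers \<open>l\<close> and \<open>p\<close> are the minimal ones. They can be minimised simultaneously:
  once an orbit returns, the admissible \<open>l\<close> form an up-set and, for each of them, the
  admissible \<open>p\<close> are the positive multiples of the exact period.\<close>

definition misiurewicz :: "complex \<Rightarrow> bool" where
  "misiurewicz c \<longleftrightarrow> c \<in> frontier tricorn \<and>
     (\<exists>l p. l \<ge> 1 \<and> p \<ge> 1 \<and>
        (antiquad c ^^ l) c = (antiquad c ^^ (l + p)) c \<and>
        (\<forall>l' p'. l' \<ge> 1 \<and> p' \<ge> 1 \<and> (antiquad c ^^ l') c = (antiquad c ^^ (l' + p')) c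
            \<longrightarrow> l \<le> l' \<and> p \<le> p') \<and>
        deriv_modulus c p ((antiquad c ^^ l) c) > 1)"

definition truncate_disk :: "complex set \<Rightarrow> real \<Rightarrow> complex set" where
  "truncate_disk K r = (K \<inter> ball 0 r) \<union> sphere 0 r"

definition nbhd :: "real \<Rightarrow> complex set \<Rightarrow> complex set" where
  "nbhd \<epsilon> K = (\<Union>x\<in>K. ball x \<epsilon>)"

definition hausdorff_tendsto :: "(nat \<Rightarrow> complex set) \<Rightarrow> complex set \<Rightarrow> bool" where
  "hausdorff_tendsto X K \<longleftrightarrow>
     (\<forall>k. compact (X k) \<and> X k \<noteq> {}) \<and> compact K \<and> K \<noteq> {} \<and>
     (\<forall>\<epsilon>>0. \<exists>k0. \<forall>k\<ge>k0. K \<subseteq> nbhd \<epsilon> (X k) \<and> X k \<subseteq> nbhd \<epsilon> K)"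

end

theory Submission
  imports Defs
begin

text \<open>Write \<open>g\<close> for the map with parameter \<open>c\<close> and \<open>x n\<close> for the orbit of the critical value \<open>c\<close>. After
finitely many steps, an even number \<open>M\<close> say, this orbit sits at a point \<open>b\<close> fixed by the
holomorphic iterate \<open>g ^ q\<close>, where \<open>q\<close> is twice the period, with a multiplier \<open>\<mu>\<close> outside the
closed unit disk. Both similarities come from one mechanism: \<open>g ^ (q * k)\<close> magnifies a
neighbourhood of \<open>b\<close> of size \<open>1 / \<mu> ^ k\<close> to unit size, and the magnified picture converges to the
Koenigs (Poincare) function of \<open>b\<close>, an entire function which after a linear change of variable is
\<open>\<phi>\<close>. In the dynamical plane \<open>g ^ M\<close> carries \<open>c\<close> to \<open>b\<close> with nonzero derivative, so
\<open>g ^ (q * k + M)\<close> at \<open>c + w / \<mu> ^ k\<close> tends to \<open>\<phi> w\<close>. In the parameter plane one moves the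
parameter to \<open>c + \<delta>\<close> and follows its own critical value. To first order the displacement from the
moving periodic point is a real linear function of \<open>\<delta>\<close>, in general not complex linear, because the
iterates depend on the parameter and on its conjugate. Choosing \<open>\<delta>\<close> so that this displacement is a
prescribed multiple of \<open>w / \<mu> ^ k\<close>, the magnified orbits tend to the same \<open>\<phi> w\<close>
(\<open>rescaling_limits\<close>). The linear map \<open>h\<close> is this displacement, normalised by the derivative of
\<open>g ^ M\<close> at \<open>c\<close>.

The choice of \<open>\<delta>\<close> needs the displacement to be invertible (\<open>transversality\<close>). The reason is
2-adic. The orbit relation makes \<open>c\<close> and its conjugate integral over the integers, so 2 is not
invertible in the ring that they generate. Half the derivative of the orbit relation has the form
\<open>\<delta> \<mapsto> P \<delta> + Q cnj \<delta>\<close> over that ring, with \<open>P\<close> congruent to 1 modulo 2 and the square of \<open>Q\<close>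
congruent to 0. A kernel would force \<open>P cnj P = Q cnj Q\<close> and hence make 2 invertible.

Convergence of the maps gives convergence of the sets as follows. Limits of points of the rescaled
sets are points where \<open>\<phi>\<close> lies in the filled Julia set, by closedness; this is the Julia set because
the filled Julia set has no interior (\<open>interior_filled_julia_empty\<close>). Conversely, near a point of the
limit set the functions \<open>\<phi> - \<phi> w\<close> (dynamical plane) or \<open>g ^ (2 * n) \<circ> \<phi> - v\<close> with \<open>v\<close> equal to 0 or
\<open>c\<close> (parameter plane) have zeros. The zeros persist for the merely continuous approximating
functions, by a winding number argument (\<open>zeros_persist\<close>). In the parameter plane such a zero is a
parameter whose critical orbit is periodic, hence a point of the tricorn. That the values 0 and \<open>c\<close>
cannot both be avoided follows from normality of families that omit two values
(\<open>hits_critical_or_parameter\<close>).\<close>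

section \<open>Zeros of continuous perturbations of holomorphic functions\<close>

text \<open>A form of Rouche's theorem in which the perturbation \<open>F\<close> is only continuous. If \<open>F\<close> had no zero it
would have a continuous logarithm on the disk; so would \<open>g\<close>, and on the circle so does the ratio
of \<open>F\<close> to \<open>f\<close>, which is close to 1. Then \<open>(z - \<xi>) ^ n\<close> would have a continuous logarithm on the
circle, but it winds \<open>n\<close> times around 0.\<close>
lemma zero_near_zero_of_holomorphic:
  fixes f F :: "complex \<Rightarrow> complex"
  assumes n: "0 < n" and s: "0 < s"
    and g: "continuous_on (cball \<xi> s) g" "\<And>z. z \<in> cball \<xi> s \<Longrightarrow> g z \<noteq> 0"
    and f: "\<And>z. z \<in> sphere \<xi> s \<Longrightarrow> f z = (z - \<xi>) ^ n * g z"
    and F: "continuous_on (cball \<xi> s) F"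
    and close: "\<And>z. z \<in> sphere \<xi> s \<Longrightarrow> cmod (F z - f z) < cmod (f z)"
  shows "\<exists>z\<in>cball \<xi> s. F z = 0"
proof (rule ccontr)
  assume "\<not> ?thesis"
  then obtain \<Phi> where \<Phi>: "continuous_on (cball \<xi> s) \<Phi>" "\<And>z. z \<in> cball \<xi> s \<Longrightarrow> F z = exp (\<Phi> z)"
    using continuous_logarithm_on_cball[OF F] by metis
  obtain \<Gamma> where \<Gamma>: "continuous_on (cball \<xi> s) \<Gamma>" "\<And>z. z \<in> cball \<xi> s \<Longrightarrow> g z = exp (\<Gamma> z)"
    using continuous_logarithm_on_cball[OF g] by metis
  define Q where "Q z = F z / ((z - \<xi>) ^ n * g z)" for z
  have ne: "(z - \<xi>) ^ n * g z \<noteq> 0" if "z \<in> sphere \<xi> s" for z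
    using that g(2)[of z] s by auto
  have Qn: "cmod (Q z - 1) < 1" if "z \<in> sphere \<xi> s" for z
  proof -
    have "Q z - 1 = (F z - f z) / f z"
      using ne[OF that] f[OF that] by (simp add: Q_def diff_divide_distrib)
    moreover have "f z \<noteq> 0" using ne[OF that] f[OF that] by simp
    ultimately show ?thesis
      using close[OF that] by (simp add: norm_divide divide_less_eq)
  qed
  have Qpos: "Q z \<notin> \<real>\<^sub>\<le>\<^sub>0" if "z \<in> sphere \<xi> s" for z
  proof
    assume "Q z \<in> \<real>\<^sub>\<le>\<^sub>0"
    then have "Re (Q z - 1) \<le> -1" by (simp add: complex_nonpos_Reals_iff)
    moreover have "\<bar>Re (Q z - 1)\<bar> \<le> cmod (Q z - 1)" by (rule abs_Re_le_cmod)
    ultimately show False using Qn[OF that] by linarith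
  qed
  have sub: "sphere \<xi> s \<subseteq> cball \<xi> s" by auto
  have Qc: "continuous_on (sphere \<xi> s) Q"
    unfolding Q_def
    by (intro continuous_intros continuous_on_subset[OF F sub] continuous_on_subset[OF g(1) sub])
       (use ne in auto)
  define \<Theta> where "\<Theta> z = \<Phi> z - Ln (Q z) - \<Gamma> z" for z
  have \<Theta>c: "continuous_on (sphere \<xi> s) \<Theta>"
    unfolding \<Theta>_def
    by (intro continuous_intros continuous_on_subset[OF \<Phi>(1) sub] continuous_on_subset[OF \<Gamma>(1) sub] Qc)
       (use Qpos in auto)
  have \<Theta>: "exp (\<Theta> z) = (z - \<xi>) ^ n" if "z \<in> sphere \<xi> s" for z
  proof -
    have z: "z \<in> cball \<xi> s" using that by auto
    have "Q z \<noteq> 0" using Qpos[OF that] by auto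
    then have "exp (\<Theta> z) = F z / Q z / g z"
      using \<Phi>(2)[OF z] \<Gamma>(2)[OF z] by (simp add: \<Theta>_def exp_diff)
    also have "\<dots> = (z - \<xi>) ^ n"
      using \<open>Q z \<noteq> 0\<close> ne[OF that] by (auto simp: Q_def field_simps)
    finally show ?thesis .
  qed
  define p where "p t = of_nat n * (of_real (ln s) + 2 * of_real pi * \<i> * of_real t)" for t :: real
  have pp: "path p" unfolding path_def p_def by (intro continuous_intros)
  have p\<Theta>: "path (\<Theta> \<circ> circlepath \<xi> s)"
    by (rule path_continuous_image) (use s \<Theta>c in auto)
  have eq: "exp \<circ> (\<Theta> \<circ> circlepath \<xi> s) = exp \<circ> p"
  proof
    fix t
    have "circlepath \<xi> s t \<in> sphere \<xi> s"
      using s by (simp add: circlepath dist_norm norm_mult)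
    then have "exp (\<Theta> (circlepath \<xi> s t)) = (of_real s * exp (2 * of_real pi * \<i> * of_real t)) ^ n"
      by (subst \<Theta>) (auto simp: circlepath)
    also have "\<dots> = exp (p t)"
    proof -
      have "complex_of_real s = exp (of_real (ln s))" using s by (simp add: exp_of_real)
      then show ?thesis unfolding p_def by (simp add: exp_of_nat_mult exp_add)
    qed
    finally show "(exp \<circ> (\<Theta> \<circ> circlepath \<xi> s)) t = (exp \<circ> p) t" by simp
  qed
  have "winding_number (exp \<circ> (\<Theta> \<circ> circlepath \<xi> s)) 0 = 0"
    using winding_number_compose_exp[OF p\<Theta>] by (simp add: pathstart_def pathfinish_def circlepath)
  moreover have "winding_number (exp \<circ> p) 0 = of_nat n"
    using winding_number_compose_exp[OF pp] by (simp add: pathstart_def pathfinish_def p_def field_simps)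
  ultimately show False using eq n by simp
qed

text \<open>Hurwitz's theorem for continuous approximating functions. Those of the parameter plane depend on a
complex variable and on its conjugate, so they are not holomorphic.\<close>
lemma zeros_persist:
  fixes f :: "complex \<Rightarrow> complex" and F :: "nat \<Rightarrow> complex \<Rightarrow> complex"
  assumes f: "f holomorphic_on UNIV" "\<not> f constant_on UNIV" "f \<xi> = 0"
    and \<epsilon>: "0 < \<epsilon>"
    and F: "\<And>k. continuous_on (cball \<xi> \<epsilon>) (F k)"
    and lim: "uniform_limit (cball \<xi> \<epsilon>) F f sequentially"
  shows "\<forall>\<^sub>F k in sequentially. \<exists>z\<in>ball \<xi> \<epsilon>. F k z = 0"
proof -
  obtain g r n where gr: "0 < n" "0 < r" "g holomorphic_on ball \<xi> r"
      "\<And>w. w \<in> ball \<xi> r \<Longrightarrow> f w = (w - \<xi>) ^ n * g w"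
      "\<And>w. w \<in> ball \<xi> r \<Longrightarrow> g w \<noteq> 0"
    using holomorphic_factor_zero_nonconstant[OF f(1) open_UNIV connected_UNIV UNIV_I f(3,2)] by metis
  define s where "s = min r \<epsilon> / 2"
  have s: "0 < s" "s < r" "s < \<epsilon>" using gr(2) \<epsilon> by (auto simp: s_def)
  have sub: "cball \<xi> s \<subseteq> ball \<xi> r" "cball \<xi> s \<subseteq> ball \<xi> \<epsilon>" "ball \<xi> \<epsilon> \<subseteq> cball \<xi> \<epsilon>" using s by auto
  have gc: "continuous_on (cball \<xi> s) g"
    using gr(3) sub(1) by (meson continuous_on_subset holomorphic_on_imp_continuous_on)
  have fc: "continuous_on (sphere \<xi> s) f"
    using f(1) by (meson continuous_on_subset holomorphic_on_imp_continuous_on subset_UNIV)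
  have fn: "f z \<noteq> 0" if "z \<in> sphere \<xi> s" for z
  proof -
    have "z \<in> ball \<xi> r" using that s by auto
    then show ?thesis using gr(4,5)[of z] that s by auto
  qed
  obtain z0 where z0: "z0 \<in> sphere \<xi> s" "\<And>z. z \<in> sphere \<xi> s \<Longrightarrow> cmod (f z0) \<le> cmod (f z)"
    using continuous_attains_inf[of "sphere \<xi> s" "\<lambda>z. cmod (f z)"] continuous_on_norm[OF fc] s(1)
    by (metis compact_sphere less_imp_le sphere_eq_empty not_le)
  have "\<forall>\<^sub>F k in sequentially. \<forall>z\<in>cball \<xi> \<epsilon>. dist (F k z) (f z) < cmod (f z0)"
    using uniform_limitD[OF lim] fn[OF z0(1)] by simp
  then show ?thesis
  proof eventually_elim
    case (elim k)
    have "\<exists>z\<in>cball \<xi> s. F k z = 0"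
    proof (rule zero_near_zero_of_holomorphic[OF gr(1) s(1) gc])
      show "continuous_on (cball \<xi> s) (F k)"
        using F sub by (meson continuous_on_subset order_trans)
      show "cmod (F k z - f z) < cmod (f z)" if "z \<in> sphere \<xi> s" for z
      proof -
        have "z \<in> cball \<xi> \<epsilon>" using that s by auto
        with elim have "cmod (F k z - f z) < cmod (f z0)" by (simp add: dist_norm)
        with z0(2)[OF that] show ?thesis by simp
      qed
    qed (use gr sub s in auto)
    then show ?case using sub by auto
  qed
qed

section \<open>Hausdorff convergence of truncated sets\<close>

lemma nbhd_iff: "y \<in> nbhd \<epsilon> K \<longleftrightarrow> (\<exists>x\<in>K. dist x y < \<epsilon>)"
  by (auto simp: nbhd_def)

lemma compact_truncate_disk: "closed K \<Longrightarrow> compact (truncate_disk K r)"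
proof -
  assume K: "closed K"
  have "truncate_disk K r = (K \<inter> cball 0 r) \<union> sphere 0 r"
    by (auto simp: truncate_disk_def)
  then show ?thesis using K by (auto intro!: compact_Un closed_Int_compact)
qed

text \<open>Truncation adds the whole circle, so points that cross the boundary of the disk cause no harm, and
convergence in the sense of sequences is upgraded to Hausdorff convergence by compactness.\<close>
lemma hausdorff_tendsto_truncate_disk:
  assumes r: "0 < r" and Acl: "\<And>k. closed (A k)" "closed B"
    and upper: "\<And>w s z. strict_mono s \<Longrightarrow> (\<And>j. w j \<in> A (s j)) \<Longrightarrow> w \<longlonglongrightarrow> z \<Longrightarrow> z \<in> B"
    and lower: "\<And>w e. w \<in> B \<Longrightarrow> 0 < e \<Longrightarrow> \<forall>\<^sub>F k in sequentially. A k \<inter> ball w e \<noteq> {}"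
  shows "hausdorff_tendsto (\<lambda>k. truncate_disk (A k) r) (truncate_disk B r)"
proof -
  have ne: "truncate_disk K r \<noteq> {}" for K
  proof -
    have "complex_of_real r \<in> truncate_disk K r" using r by (simp add: truncate_disk_def)
    then show ?thesis by blast
  qed
  \<comment> \<open>If the bad points \<open>P\<close> occur for infinitely many indices, some of them converge.\<close>
  have subseq: "\<exists>k0. \<forall>k\<ge>k0. \<forall>w. \<not> P k w"
    if bd: "\<And>k w. P k w \<Longrightarrow> w \<in> cball 0 r"
      and imp: "\<And>s w z. strict_mono s \<Longrightarrow> (\<And>j. P (s j) (w j)) \<Longrightarrow> w \<longlonglongrightarrow> z \<Longrightarrow> False"
    for P :: "nat \<Rightarrow> complex \<Rightarrow> bool"
  proof (rule ccontr)
    assume "\<not> ?thesis"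
    then have inf: "\<forall>m. \<exists>n\<ge>m. \<exists>w. P n w" by blast
    then have "infinite {n. \<exists>w. P n w}" unfolding infinite_nat_iff_unbounded_le by blast
    from infinite_enumerate[OF this] obtain s :: "nat \<Rightarrow> nat" where s: "strict_mono s" "\<And>j. \<exists>w. P (s j) w" by auto
    then obtain w where w: "\<And>j. P (s j) (w j)" by metis
    have "\<forall>j. w j \<in> cball 0 r" using bd w by blast
    then obtain z t where t: "strict_mono t" "(w \<circ> t) \<longlonglongrightarrow> z"
      using compact_cball[of "0::complex" r] unfolding compact_def by metis
    show False
      by (rule imp[of "s \<circ> t" "w \<circ> t" z]) (use s t w in \<open>auto simp: strict_mono_def\<close>)
  qed
  have "\<exists>k0. \<forall>k\<ge>k0. truncate_disk B r \<subseteq> nbhd e (truncate_disk (A k) r)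
                    \<and> truncate_disk (A k) r \<subseteq> nbhd e (truncate_disk B r)" if e: "0 < e" for e
  proof -
    have "\<exists>k0. \<forall>k\<ge>k0. \<forall>w. \<not> (w \<in> truncate_disk B r \<and> w \<notin> nbhd e (truncate_disk (A k) r))"
    proof (rule subseq)
      fix s :: "nat \<Rightarrow> nat" and w z
      assume s: "strict_mono s" and wz: "w \<longlonglongrightarrow> z"
        and w: "\<And>j. w j \<in> truncate_disk B r \<and> w j \<notin> nbhd e (truncate_disk (A (s j)) r)"
      have zB: "z \<in> truncate_disk B r"
        using compact_imp_closed[OF compact_truncate_disk[OF Acl(2)]] wz w
        by (metis closed_sequential_limits)
      have "\<forall>\<^sub>F j in sequentially. dist (w j) z < e / 2" by (rule tendstoD[OF wz]) (use e in simp)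
      moreover have "\<forall>\<^sub>F j in sequentially. \<exists>u\<in>truncate_disk (A (s j)) r. dist u z < e / 2"
      proof (cases "z \<in> sphere 0 r")
        case True
        then have "\<exists>u\<in>truncate_disk (A (s j)) r. dist u z < e / 2" for j
          using e by (intro bexI[of _ z]) (auto simp: truncate_disk_def)
        then show ?thesis by simp
      next
        case False
        then have z: "z \<in> B" "norm z < r" using zB by (auto simp: truncate_disk_def)
        have "\<forall>\<^sub>F k in sequentially. A k \<inter> ball z (min (e / 2) (r - norm z)) \<noteq> {}"
          using z e by (intro lower) auto
        then have "\<forall>\<^sub>F j in sequentially. A (s j) \<inter> ball z (min (e / 2) (r - norm z)) \<noteq> {}"
          by (rule eventually_subseq[OF s])
        then show ?thesis
        proof eventually_elim
          case (elim j)
          then obtain u where u: "u \<in> A (s j)" "dist z u < e / 2" "dist z u < r - norm z" by auto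
          have "norm u \<le> norm z + norm (u - z)" using norm_triangle_ineq[of z "u - z"] by simp
          with u(3) have "norm u < r" by (simp add: dist_norm norm_minus_commute)
          with u show ?case by (auto simp: truncate_disk_def dist_commute)
        qed
      qed
      ultimately have "\<forall>\<^sub>F j in sequentially. False"
      proof eventually_elim
        case (elim j)
        then obtain u where "u \<in> truncate_disk (A (s j)) r" "dist u z < e / 2" by blast
        moreover from this(2) elim(1) have "dist u (w j) < e"
          by (metis dist_commute dist_triangle_half_r)
        ultimately show ?case using w[of j] by (auto simp: nbhd_iff)
      qed
      then show False by simp
    qed (auto simp: truncate_disk_def)
    then obtain k1 where k1: "\<And>k. k \<ge> k1 \<Longrightarrow> truncate_disk B r \<subseteq> nbhd e (truncate_disk (A k) r)"
      by blast
    have "\<exists>k0. \<forall>k\<ge>k0. \<forall>w. \<not> (w \<in> truncate_disk (A k) r \<and> w \<notin> nbhd e (truncate_disk B r))"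
    proof (rule subseq)
      fix s :: "nat \<Rightarrow> nat" and w z
      assume s: "strict_mono s" and wz: "w \<longlonglongrightarrow> z"
        and w: "\<And>j. w j \<in> truncate_disk (A (s j)) r \<and> w j \<notin> nbhd e (truncate_disk B r)"
      have wn: "w j \<notin> truncate_disk B r" for j using w[of j] e by (auto simp: nbhd_iff)
      then have wA: "w j \<in> A (s j)" "norm (w j) < r" for j
        using w[of j] by (auto simp: truncate_disk_def)
      have zB: "z \<in> B" using upper[OF s wA(1) wz] .
      have "norm z \<le> r" by (rule LIMSEQ_le_const2[OF tendsto_norm[OF wz]]) (use wA(2) in \<open>auto intro: less_imp_le\<close>)
      then have "z \<in> truncate_disk B r" using zB by (auto simp: truncate_disk_def)
      moreover have "\<forall>\<^sub>F j in sequentially. dist (w j) z < e" using tendstoD[OF wz] e by simp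
      then obtain j where "dist (w j) z < e" by (auto simp: eventually_sequentially)
      ultimately show False using w[of j] by (auto simp: nbhd_iff dist_commute)
    qed (auto simp: truncate_disk_def)
    then obtain k2 where k2: "\<And>k. k \<ge> k2 \<Longrightarrow> truncate_disk (A k) r \<subseteq> nbhd e (truncate_disk B r)"
      by blast
    show ?thesis by (rule exI[of _ "max k1 k2"]) (use k1 k2 in auto)
  qed
  then show ?thesis
    unfolding hausdorff_tendsto_def using ne compact_truncate_disk Acl by blast
qed

section \<open>Two-adic transversality\<close>

text \<open>The localisation of the integers at the prime 2, as a subset of the complex numbers. Over this local
ring Nakayama's lemma has an elementary proof by elimination.\<close>
definition odd_fractions :: "complex set" where
  "odd_fractions = {of_int m / of_int n | m n. odd n}"

inductive_set odd_span :: "complex set \<Rightarrow> complex set" for S where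
  zero: "0 \<in> odd_span S"
| step: "r \<in> odd_fractions \<Longrightarrow> s \<in> S \<Longrightarrow> x \<in> odd_span S \<Longrightarrow> r * s + x \<in> odd_span S"

lemma odd_fractions_of_int: "of_int m \<in> odd_fractions"
  unfolding odd_fractions_def by (rule CollectI, rule exI[of _ m], rule exI[of _ 1]) simp

lemma odd_fractions_mult: 
  assumes "r \<in> odd_fractions" "s \<in> odd_fractions" shows "r * s \<in> odd_fractions"
proof -
  obtain m n m' n' where "r = of_int m / of_int n" "odd n" "s = of_int m' / of_int n'" "odd n'"
    using assms by (auto simp: odd_fractions_def)
  then have "r * s = of_int (m * m') / of_int (n * n')" "odd (n * n')" by auto
  then show ?thesis unfolding odd_fractions_def by blast
qed

lemma odd_fractions_unit:
  assumes "r \<in> odd_fractions" shows "1 - 2 * r \<noteq> 0" "1 / (1 - 2 * r) \<in> odd_fractions"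
proof -
  obtain m n where mn: "r = of_int m / of_int n" "odd n"
    using assms by (auto simp: odd_fractions_def)
  then have n0: "n \<noteq> 0" by auto
  have o: "odd (n - 2 * m)" using mn by simp
  then have o0: "n - 2 * m \<noteq> 0" by auto
  have e: "1 - 2 * r = of_int (n - 2 * m) / of_int n"
    using n0 mn by (simp add: field_simps)
  show "1 - 2 * r \<noteq> 0" unfolding e using n0 o0 by (metis divide_eq_0_iff of_int_eq_0_iff)
  have "1 / (1 - 2 * r) = of_int n / of_int (n - 2 * m)" unfolding e by simp
  then show "1 / (1 - 2 * r) \<in> odd_fractions" unfolding odd_fractions_def using o by blast
qed

lemma odd_span_base: "s \<in> S \<Longrightarrow> s \<in> odd_span S"
  using odd_span.step[of 1 s S 0] odd_fractions_of_int[of 1] odd_span.zero by simp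

lemma odd_span_add: "x \<in> odd_span S \<Longrightarrow> y \<in> odd_span S \<Longrightarrow> x + y \<in> odd_span S"
  by (induction rule: odd_span.induct) (auto simp: add.assoc intro: odd_span.intros)

lemma odd_span_scale: "x \<in> odd_span S \<Longrightarrow> r \<in> odd_fractions \<Longrightarrow> r * x \<in> odd_span S"
proof (induction rule: odd_span.induct)
  case (step q s x)
  then have "(r * q) * s + r * x \<in> odd_span S" by (auto intro: odd_span.intros odd_fractions_mult)
  then show ?case by (simp add: algebra_simps)
qed (auto intro: odd_span.intros)

lemma odd_span_minus: "x \<in> odd_span S \<Longrightarrow> - x \<in> odd_span S"
  using odd_span_scale[of x S "of_int (-1)"] odd_fractions_of_int[of "-1"] by simp

lemma odd_span_diff: "x \<in> odd_span S \<Longrightarrow> y \<in> odd_span S \<Longrightarrow> x - y \<in> odd_span S"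
  using odd_span_add[of x S "- y"] odd_span_minus by simp

lemma odd_span_mult_right:
  "x \<in> odd_span S \<Longrightarrow> (\<And>s. s \<in> S \<Longrightarrow> s * y \<in> odd_span T) \<Longrightarrow> x * y \<in> odd_span T"
proof (induction rule: odd_span.induct)
  case (step q s x)
  then have "q * (s * y) + x * y \<in> odd_span T" 
    by (intro odd_span_add odd_span_scale[of "s * y"]) auto
  then show ?case by (simp add: algebra_simps)
qed (auto intro: odd_span.intros)

lemma odd_span_trans: "x \<in> odd_span S \<Longrightarrow> (\<And>s. s \<in> S \<Longrightarrow> s \<in> odd_span T) \<Longrightarrow> x \<in> odd_span T"
  using odd_span_mult_right[of x S 1 T] by simp

lemma odd_span_mult:
  assumes "x \<in> odd_span S" "y \<in> odd_span T" "\<And>s t. s \<in> S \<Longrightarrow> t \<in> T \<Longrightarrow> s * t \<in> odd_span U"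
  shows "x * y \<in> odd_span U"
proof (rule odd_span_mult_right[OF assms(1)])
  fix s assume "s \<in> S"
  then have "y * s \<in> odd_span U"
    by (intro odd_span_mult_right[OF assms(2)]) (use assms(3) in \<open>metis mult.commute\<close>)
  then show "s * y \<in> odd_span U" by (simp add: mult.commute)
qed

lemma odd_span_insert:
  "x \<in> odd_span (insert e S) \<Longrightarrow> \<exists>a\<in>odd_fractions. \<exists>y\<in>odd_span S. x = a * e + y"
proof (induction rule: odd_span.induct)
  case zero
  then show ?case using odd_fractions_of_int[of 0] odd_span.zero[of S] by force
next
  case (step r s x)
  then obtain a y where ay: "a \<in> odd_fractions" "y \<in> odd_span S" "x = a * e + y" by blast
  show ?case
  proof (cases "s = e")
    case True
    have "r + a \<in> odd_fractions"
    proof -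
      obtain m n m' n' where *: "r = of_int m / of_int n" "odd n" "a = of_int m' / of_int n'" "odd n'"
        using ay(1) step(1) by (auto simp: odd_fractions_def)
      then have "n \<noteq> 0" "n' \<noteq> 0" by auto
      with * have "r + a = of_int (m * n' + m' * n) / of_int (n * n')" "odd (n * n')"
        by (auto simp: add_frac_eq)
      then show ?thesis unfolding odd_fractions_def by blast
    qed
    moreover have "r * s + x = (r + a) * e + y" using ay(3) True by (simp add: algebra_simps)
    ultimately show ?thesis using ay(2) by blast
  next
    case False
    then have "r * s + y \<in> odd_span S" using step ay by (auto intro: odd_span.intros)
    moreover have "r * s + x = a * e + (r * s + y)" using ay(3) by (simp add: algebra_simps)
    ultimately show ?thesis using ay(1) by blast
  qed
qed

text \<open>Nakayama's lemma: a finitely generated submodule of the complex numbers that is divisible by 2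
vanishes. Each generator can be eliminated, because its equation has the unit \<open>1 - 2 * a\<close> as leading
coefficient.\<close>
lemma odd_span_nakayama:
  "finite S \<Longrightarrow> (\<And>s. s \<in> S \<Longrightarrow> s / 2 \<in> odd_span S) \<Longrightarrow> S \<subseteq> {0}"
proof (induction S rule: finite_induct)
  case (insert e S)
  obtain a y where ay: "a \<in> odd_fractions" "y \<in> odd_span S" "e / 2 = a * e + y"
    using odd_span_insert insert.prems by (metis insertI1)
  have "(1 - 2 * a) * e = 2 * y" using ay(3) by (simp add: field_simps)
  then have e: "e = (1 / (1 - 2 * a)) * (of_int 2 * y)"
    using odd_fractions_unit(1)[OF ay(1)] by (simp add: field_simps)
  have eS: "e \<in> odd_span S"
    by (subst e, intro odd_span_scale ay odd_fractions_unit odd_fractions_of_int)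
  have "S \<subseteq> {0}"
  proof (rule insert.IH)
    fix s assume "s \<in> S"
    then have "s / 2 \<in> odd_span (insert e S)" using insert.prems by blast
    then show "s / 2 \<in> odd_span S"
      by (rule odd_span_trans) (use eS odd_span_base in auto)
  qed
  moreover have "x = 0" if "x \<in> odd_span S" "S \<subseteq> {0}" for x
    using that by (induction rule: odd_span.induct) auto
  ultimately show ?case using eS by blast
qed auto

text \<open>The conjugate \<open>cnj c\<close> is treated as a second variable. Filtering by total degree is what makes the
orbit relations monic.\<close>
definition monomials :: "complex \<Rightarrow> nat \<Rightarrow> complex set" where
  "monomials c d = {c ^ i * cnj c ^ j | i j. i + j \<le> d}"

definition conj_ring :: "complex \<Rightarrow> complex set" where
  "conj_ring c = odd_span (\<Union>d. monomials c d)"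

lemma monomials_mult: "s \<in> monomials c d \<Longrightarrow> t \<in> monomials c e \<Longrightarrow> s * t \<in> monomials c (d + e)"
proof -
  assume "s \<in> monomials c d" "t \<in> monomials c e"
  then obtain i j k l where "s = c ^ i * cnj c ^ j" "i + j \<le> d" "t = c ^ k * cnj c ^ l" "k + l \<le> e"
    by (auto simp: monomials_def)
  then have "s * t = c ^ (i + k) * cnj c ^ (j + l)" "i + k + (j + l) \<le> d + e"
    by (auto simp: power_add)
  then show ?thesis unfolding monomials_def by blast
qed

lemma monomials_mono: "d \<le> e \<Longrightarrow> s \<in> monomials c d \<Longrightarrow> s \<in> monomials c e"
  unfolding monomials_def by fastforce

lemma monomials_cnj: "s \<in> monomials c d \<Longrightarrow> cnj s \<in> monomials c d"
proof -
  assume "s \<in> monomials c d"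
  then obtain i j where "s = c ^ i * cnj c ^ j" "i + j \<le> d"
    by (auto simp: monomials_def)
  then have "cnj s = c ^ j * cnj c ^ i" "j + i \<le> d" by auto
  then show ?thesis unfolding monomials_def by blast
qed

lemma odd_span_cnj:
  assumes "x \<in> odd_span S" "\<And>s. s \<in> S \<Longrightarrow> cnj s \<in> S" shows "cnj x \<in> odd_span S"
  using assms(1)
proof (induction rule: odd_span.induct)
  case (step r s x)
  have "cnj r = r" using step(1) by (auto simp: odd_fractions_def)
  then have "cnj r \<in> odd_fractions" using step(1) by simp
  then show ?case using step assms(2) by (auto intro: odd_span.intros)
qed (auto intro: odd_span.intros)

lemma deg_span_mono: "x \<in> odd_span (monomials c d) \<Longrightarrow> d \<le> e \<Longrightarrow> x \<in> odd_span (monomials c e)"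
  by (erule odd_span_trans) (auto intro: odd_span_base monomials_mono)

lemma deg_span_mult:
  "x \<in> odd_span (monomials c d) \<Longrightarrow> y \<in> odd_span (monomials c e) \<Longrightarrow> x * y \<in> odd_span (monomials c (d + e))"
  by (erule (1) odd_span_mult) (auto intro: odd_span_base monomials_mult)

lemma deg_span_cnj: "x \<in> odd_span (monomials c d) \<Longrightarrow> cnj x \<in> odd_span (monomials c d)"
  by (erule odd_span_cnj) (rule monomials_cnj)

lemma deg_span_power: "c ^ d \<in> odd_span (monomials c d)" 
  by (rule odd_span_base, unfold monomials_def, rule CollectI, rule exI[of _ d], rule exI[of _ 0]) simp

lemma conj_ring_mult: "x \<in> conj_ring c \<Longrightarrow> y \<in> conj_ring c \<Longrightarrow> x * y \<in> conj_ring c"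
  unfolding conj_ring_def by (erule (1) odd_span_mult) (auto intro!: odd_span_base intro: monomials_mult)
lemma conj_ring_add: "x \<in> conj_ring c \<Longrightarrow> y \<in> conj_ring c \<Longrightarrow> x + y \<in> conj_ring c"
  unfolding conj_ring_def by (rule odd_span_add)
lemma conj_ring_diff: "x \<in> conj_ring c \<Longrightarrow> y \<in> conj_ring c \<Longrightarrow> x - y \<in> conj_ring c"
  unfolding conj_ring_def by (rule odd_span_diff)
lemma conj_ring_cnj: "x \<in> conj_ring c \<Longrightarrow> cnj x \<in> conj_ring c"
  unfolding conj_ring_def by (erule odd_span_cnj) (auto intro: monomials_cnj)
lemma conj_ring_1: "1 \<in> conj_ring c"
  unfolding conj_ring_def using deg_span_power[of c 0]
  by (auto elim!: odd_span_trans intro: odd_span_base)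
lemma conj_ring_0: "0 \<in> conj_ring c"
  unfolding conj_ring_def by (rule odd_span.zero)
lemma conj_ring_2: "2 \<in> conj_ring c"
  using conj_ring_add[OF conj_ring_1 conj_ring_1] by simp
lemma conj_ring_self: "c \<in> conj_ring c"
  unfolding conj_ring_def using deg_span_power[of c 1]
  by (auto elim!: odd_span_trans intro: odd_span_base)
lemmas conj_ring_closed = conj_ring_mult conj_ring_add conj_ring_diff conj_ring_cnj
  conj_ring_0 conj_ring_1 conj_ring_2 conj_ring_self

text \<open>A relation that expresses \<open>c ^ N\<close> by lower terms, together with its conjugate, bounds the degree of
the monomials needed to generate \<open>conj_ring c\<close> as a module. If \<open>1 / 2\<close> belonged to this ring, the
module would be divisible by 2, against Nakayama's lemma.\<close>
lemma half_notin_conj_ring: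
  assumes N: "0 < N" and rel: "c ^ N \<in> odd_span (monomials c (N - 1))"
  shows "1 / 2 \<notin> conj_ring c"
proof
  assume half: "1 / 2 \<in> conj_ring c"
  have rel': "cnj c ^ N \<in> odd_span (monomials c (N - 1))"
    using deg_span_cnj[OF rel] by simp
  let ?S = "monomials c (2 * N - 2)"
  have mon: "c ^ i * cnj c ^ j \<in> odd_span ?S" for i j
  proof (induction "i + j" arbitrary: i j rule: less_induct)
    case less
    have IH: "s \<in> odd_span ?S" if sd: "s \<in> monomials c d" "d < i + j" for s d
    proof -
      obtain i' j' where "s = c ^ i' * cnj c ^ j'" "i' + j' \<le> d"
        using sd(1) unfolding monomials_def by blast
      with less.hyps[of i' j'] sd(2) show ?thesis by auto
    qed
    have m: "c ^ k * cnj c ^ l \<in> odd_span (monomials c (k + l))" for k l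
      by (rule odd_span_base) (auto simp: monomials_def)
    \<comment> \<open>In the first two cases the relation for \<open>c ^ N\<close> or its conjugate lowers the degree.\<close>
    consider "i \<ge> N" | "j \<ge> N" | "i + j \<le> 2 * N - 2" using N by linarith
    then show ?case
    proof cases
      case 1
      have "c ^ N * (c ^ (i - N) * cnj c ^ j) \<in> odd_span (monomials c (N - 1 + (i - N + j)))"
        by (rule deg_span_mult[OF rel m])
      moreover have "c ^ N * (c ^ (i - N) * cnj c ^ j) = c ^ i * cnj c ^ j"
        using 1 by (simp add: mult.assoc[symmetric] flip: power_add)
      ultimately have "c ^ i * cnj c ^ j \<in> odd_span (monomials c (N - 1 + (i - N + j)))" by simp
      then show ?thesis by (rule odd_span_trans) (use 1 N in \<open>auto intro: IH\<close>)
    next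
      case 2
      have "cnj c ^ N * (c ^ i * cnj c ^ (j - N)) \<in> odd_span (monomials c (N - 1 + (i + (j - N))))"
        by (rule deg_span_mult[OF rel' m])
      moreover have "cnj c ^ N * (c ^ i * cnj c ^ (j - N)) = c ^ i * (cnj c ^ N * cnj c ^ (j - N))"
        by simp
      then have "cnj c ^ N * (c ^ i * cnj c ^ (j - N)) = c ^ i * cnj c ^ j"
        using 2 by (simp flip: power_add)
      ultimately have "c ^ i * cnj c ^ j \<in> odd_span (monomials c (N - 1 + (i + (j - N))))" by simp
      then show ?thesis by (rule odd_span_trans) (use 2 N in \<open>auto intro: IH\<close>)
    next
      case 3
      then show ?thesis using m deg_span_mono by blast
    qed
  qed
  have ring: "x \<in> odd_span ?S" if "x \<in> conj_ring c" for x
    using that unfolding conj_ring_def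
    by (rule odd_span_trans) (use mon in \<open>auto simp: monomials_def\<close>)
  have "finite ?S"
  proof (rule finite_subset)
    show "?S \<subseteq> (\<lambda>(i, j). c ^ i * cnj c ^ j) ` ({..2 * N - 2} \<times> {..2 * N - 2})"
      by (force simp: monomials_def)
  qed auto
  moreover have "s / 2 \<in> odd_span ?S" if "s \<in> ?S" for s
  proof -
    have "s \<in> conj_ring c" unfolding conj_ring_def using that by (auto intro: odd_span_base)
    then have "s * (1 / 2) \<in> conj_ring c" using half by (rule conj_ring_mult)
    then show ?thesis using ring by simp
  qed
  ultimately have "?S \<subseteq> {0}" by (rule odd_span_nakayama)
  moreover have "1 \<in> ?S"
    unfolding monomials_def by (rule CollectI, rule exI[of _ 0], rule exI[of _ 0]) simp
  ultimately show False by auto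
qed

text \<open>As a polynomial in \<open>c\<close> and \<open>cnj c\<close> the \<open>n\<close>-th iterate is monic of degree \<open>2 ^ n\<close>, with the leading
variable alternating between the two.\<close>
lemma antiquad_iterate_leading:
  "(antiquad c ^^ n) c - (if even n then c else cnj c) ^ (2 ^ n) \<in> odd_span (monomials c (2 ^ n - 1))"
proof (induction n)
  case (Suc n)
  define x where "x = (antiquad c ^^ n) c"
  define \<gamma> where "\<gamma> = (if even n then cnj c else c)"
  define e where "e = cnj x - \<gamma> ^ (2 ^ n)"
  let ?N = "2 ^ n :: nat"
  have N: "?N \<ge> 1" by simp
  have e: "e \<in> odd_span (monomials c (?N - 1))"
    using deg_span_cnj[OF Suc] by (simp add: e_def x_def \<gamma>_def split: if_splits)
  have \<gamma>: "\<gamma> ^ ?N \<in> odd_span (monomials c ?N)"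
    using deg_span_power[of c ?N] deg_span_cnj[OF deg_span_power[of c ?N]] by (auto simp: \<gamma>_def)
  have 1: "of_int 2 * (\<gamma> ^ ?N * e) \<in> odd_span (monomials c (2 ^ Suc n - 1))"
    by (rule odd_span_scale[OF deg_span_mono[OF deg_span_mult[OF \<gamma> e]] odd_fractions_of_int])
       (use N in simp)
  have 2: "e * e \<in> odd_span (monomials c (2 ^ Suc n - 1))"
    by (rule deg_span_mono[OF deg_span_mult[OF e e]]) (use N in simp)
  have 3: "c \<in> odd_span (monomials c (2 ^ Suc n - 1))"
  proof (rule deg_span_mono)
    show "c \<in> odd_span (monomials c 1)" using deg_span_power[of c 1] by simp
    show "1 \<le> 2 ^ Suc n - (1 :: nat)" using N unfolding power_Suc by linarith
  qed
  have "(antiquad c ^^ Suc n) c - (if even (Suc n) then c else cnj c) ^ (2 ^ Suc n)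
      = (\<gamma> ^ ?N + e)\<^sup>2 + c - (\<gamma> ^ ?N)\<^sup>2"
    unfolding e_def by (simp add: antiquad_def x_def[symmetric] \<gamma>_def power_mult[symmetric] mult.commute)
  also have "\<dots> = of_int 2 * (\<gamma> ^ ?N * e) + e * e + c" by (simp add: power2_eq_square algebra_simps)
  finally show ?case using odd_span_add[OF odd_span_add[OF 1 2] 3] by simp
qed (simp add: odd_span.zero)

lemma half_notin_conj_ring_preperiodic:
  assumes q: "0 < q" and rel: "(antiquad c ^^ (n + q)) c = (antiquad c ^^ n) c"
  shows "1 / 2 \<notin> conj_ring c"
proof -
  let ?N = "2 ^ (n + q) :: nat"
  define \<gamma> where "\<gamma> k = (if even k then c else cnj c)" for k :: nat
  have \<gamma>: "\<gamma> n ^ 2 ^ n \<in> odd_span (monomials c (2 ^ n))"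
    using deg_span_power[of c "2 ^ n"] deg_span_cnj[OF deg_span_power[of c "2 ^ n"]]
    by (auto simp: \<gamma>_def)
  have "(2::nat) ^ n < ?N" using q by simp
  then have le: "(2::nat) ^ n \<le> ?N - 1" by linarith
  have "((antiquad c ^^ n) c - \<gamma> n ^ 2 ^ n) + \<gamma> n ^ 2 ^ n \<in> odd_span (monomials c (2 ^ n))"
    by (intro odd_span_add \<gamma>) (use deg_span_mono[OF antiquad_iterate_leading[of n c]] in \<open>auto simp: \<gamma>_def\<close>)
  then have x: "(antiquad c ^^ n) c \<in> odd_span (monomials c (?N - 1))"
    using deg_span_mono[OF _ le] by simp
  have "(antiquad c ^^ n) c - ((antiquad c ^^ (n + q)) c - \<gamma> (n + q) ^ ?N) \<in> odd_span (monomials c (?N - 1))"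
    unfolding \<gamma>_def by (intro odd_span_diff x antiquad_iterate_leading)
  then have "\<gamma> (n + q) ^ ?N \<in> odd_span (monomials c (?N - 1))" using rel by simp
  then have "c ^ ?N \<in> odd_span (monomials c (?N - 1))"
    using deg_span_cnj[of "cnj c ^ ?N" c] by (auto simp: \<gamma>_def split: if_splits)
  then show ?thesis by (intro half_notin_conj_ring[of ?N]) auto
qed

text \<open>The real derivative of \<open>(z, c) \<mapsto> (antiquad c ^^ n) z\<close> in the direction \<open>(v, \<delta>)\<close>. With \<open>v = \<delta>\<close> at
\<open>z = c\<close> it is the derivative of the critical value orbit with respect to the parameter.\<close>
fun tangent :: "complex \<Rightarrow> complex \<Rightarrow> complex \<Rightarrow> complex \<Rightarrow> nat \<Rightarrow> complex" where
  "tangent c z v \<delta> 0 = v"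
| "tangent c z v \<delta> (Suc n) = 2 * cnj ((antiquad c ^^ n) z) * cnj (tangent c z v \<delta> n) + \<delta>"

text \<open>Along the critical orbit the derivative with respect to the parameter is congruent to \<open>\<delta>\<close> modulo 2.
The factor in front takes care of \<open>n = 0\<close>, where the derivative and the orbit point both vanish.\<close>
lemma tangent_critical_form:
  "\<exists>\<alpha>\<in>conj_ring c. \<exists>\<beta>\<in>conj_ring c. \<forall>\<delta>. (antiquad c ^^ n) 0 * tangent c 0 0 \<delta> n
     = (antiquad c ^^ n) 0 * \<delta> + 2 * (\<alpha> * \<delta> + \<beta> * cnj \<delta>)"
proof (induction n)
  case 0
  then show ?case using conj_ring_0 by force
next
  case (Suc n)
  define X where "X k = (antiquad c ^^ k) 0" for k
  have X: "X k \<in> conj_ring c" for k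
    by (induction k) (auto simp: X_def antiquad_def power2_eq_square intro: conj_ring_closed)
  obtain \<alpha> \<beta> where ab: "\<alpha> \<in> conj_ring c" "\<beta> \<in> conj_ring c"
    "\<And>\<delta>. X n * tangent c 0 0 \<delta> n = X n * \<delta> + 2 * (\<alpha> * \<delta> + \<beta> * cnj \<delta>)"
    using Suc by (auto simp: X_def)
  define a where "a = X (Suc n) * (2 * cnj \<beta>)"
  define b where "b = X (Suc n) * (cnj (X n) + 2 * cnj \<alpha>)"
  have "X (Suc n) * tangent c 0 0 \<delta> (Suc n) = X (Suc n) * \<delta> + 2 * (a * \<delta> + b * cnj \<delta>)" for \<delta>
  proof -
    have "tangent c 0 0 \<delta> (Suc n) = 2 * cnj (X n * tangent c 0 0 \<delta> n) + \<delta>"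
      by (simp add: X_def)
    also have "\<dots> = \<delta> + 2 * ((2 * cnj \<beta>) * \<delta> + (cnj (X n) + 2 * cnj \<alpha>) * cnj \<delta>)"
      unfolding ab(3) by (simp add: algebra_simps)
    finally show ?thesis by (simp add: a_def b_def algebra_simps)
  qed
  moreover have "a \<in> conj_ring c" "b \<in> conj_ring c"
    unfolding a_def b_def by (intro conj_ring_closed X ab)+
  ultimately show ?case unfolding X_def by blast
qed

text \<open>At a strictly preperiodic parameter the critical orbit satisfies a sum relation, obtained by taking
a square root of the coincidence one step later. Half of the derivative of this sum is
\<open>(1 + 2 a) \<delta> + (cnj y + 2 b) cnj \<delta>\<close> with the square of \<open>y\<close> divisible by 2. A nonzero \<open>\<delta>\<close> in its kernel
forces both coefficients to have the same modulus, so that \<open>y * cnj y\<close> is congruent to 1 modulo 2,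
while its square is divisible by 4.\<close>
lemma transversality_critical:
  assumes q: "0 < q"
    and neg: "(antiquad c ^^ (Suc m + q)) 0 = - (antiquad c ^^ Suc m) 0"
    and z: "tangent c 0 0 \<delta> (Suc m + q) + tangent c 0 0 \<delta> (Suc m) = 0"
  shows "\<delta> = 0"
proof (rule ccontr)
  assume \<delta>: "\<delta> \<noteq> 0"
  define X where "X k = (antiquad c ^^ k) 0" for k
  have X: "X k \<in> conj_ring c" for k
    by (induction k) (auto simp: X_def antiquad_def power2_eq_square intro: conj_ring_closed)
  have XS: "X (Suc k) = (cnj (X k))\<^sup>2 + c" for k by (simp add: X_def antiquad_def)
  define y where "y = X m + X (m + q)"
  define w where "w = X m * X (m + q) - cnj c"
  have yw: "y\<^sup>2 = 2 * w"
  proof -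
    have "X (Suc (m + q)) + X (Suc m) = 0" using neg by (simp add: X_def)
    then have "cnj ((cnj (X (m + q)))\<^sup>2 + c + ((cnj (X m))\<^sup>2 + c)) = 0" unfolding XS by simp
    then have "(X (m + q))\<^sup>2 + (X m)\<^sup>2 = - 2 * cnj c" by (simp add: algebra_simps add_eq_0_iff)
    moreover have "y\<^sup>2 - 2 * w = ((X (m + q))\<^sup>2 + (X m)\<^sup>2) - (- 2 * cnj c)"
      by (simp add: y_def w_def power2_eq_square algebra_simps)
    ultimately show ?thesis by simp
  qed
  obtain \<alpha> \<beta> where ab: "\<alpha> \<in> conj_ring c" "\<beta> \<in> conj_ring c"
    "X m * tangent c 0 0 \<delta> m = X m * \<delta> + 2 * (\<alpha> * \<delta> + \<beta> * cnj \<delta>)"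
    using tangent_critical_form[where n = m and c = c] unfolding X_def by blast
  obtain \<alpha>' \<beta>' where ab': "\<alpha>' \<in> conj_ring c" "\<beta>' \<in> conj_ring c"
    "X (m + q) * tangent c 0 0 \<delta> (m + q) = X (m + q) * \<delta> + 2 * (\<alpha>' * \<delta> + \<beta>' * cnj \<delta>)"
    using tangent_critical_form[where n = "m + q" and c = c] unfolding X_def by blast
  define a where "a = cnj (\<beta> + \<beta>')"
  define b where "b = cnj (\<alpha> + \<alpha>')"
  have "0 = 2 * cnj (X (m + q) * tangent c 0 0 \<delta> (m + q)) + 2 * cnj (X m * tangent c 0 0 \<delta> m) + 2 * \<delta>"
    using z by (simp add: X_def algebra_simps)
  also have "\<dots> = 2 * ((1 + 2 * a) * \<delta> + (cnj y + 2 * b) * cnj \<delta>)"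
    unfolding ab(3) ab'(3) by (simp add: y_def a_def b_def algebra_simps)
  finally have "(1 + 2 * a) * \<delta> + (cnj y + 2 * b) * cnj \<delta> = 0"
    by (metis mult_eq_0_iff zero_neq_numeral)
  then have "(1 + 2 * a) * \<delta> = - ((cnj y + 2 * b) * cnj \<delta>)" by (simp only: eq_neg_iff_add_eq_0)
  then have "cmod ((1 + 2 * a) * \<delta>) = cmod ((cnj y + 2 * b) * cnj \<delta>)" by (simp only: norm_minus_cancel)
  then have "cmod (1 + 2 * a) * cmod \<delta> = cmod (cnj y + 2 * b) * cmod \<delta>"
    by (simp only: norm_mult complex_mod_cnj)
  then have "cmod (1 + 2 * a) = cmod (cnj y + 2 * b)" using \<delta> by simp
  then have sq: "(1 + 2 * a) * cnj (1 + 2 * a) = (cnj y + 2 * b) * cnj (cnj y + 2 * b)"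
    by (simp only: complex_norm_square[symmetric])
  \<comment> \<open>Expanding the equality of the squared moduli, everything except \<open>y * cnj y\<close> and 1 is even.\<close>
  define t where "t = a + cnj a + 2 * (a * cnj a) - (cnj y * cnj b + b * y + 2 * (b * cnj b))"
  have "y * cnj y - (1 + 2 * t) = (cnj y + 2 * b) * cnj (cnj y + 2 * b) - (1 + 2 * a) * cnj (1 + 2 * a)"
    by (simp add: t_def algebra_simps)
  then have "y * cnj y = 1 + 2 * t" unfolding sq by simp
  then have "(1 + 2 * t)\<^sup>2 = (y * cnj y)\<^sup>2" by simp
  also have "\<dots> = y\<^sup>2 * cnj (y\<^sup>2)" by (simp only: power_mult_distrib complex_cnj_power)
  also have "\<dots> = 4 * (w * cnj w)" unfolding yw by simp
  finally have "2 * (2 * (w * cnj w) - 2 * (t + t * t)) = 1"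
    by (simp add: power2_eq_square algebra_simps)
  then have "1 / 2 = 2 * (w * cnj w) - 2 * (t + t * t)" 
    by (metis nonzero_mult_div_cancel_left zero_neq_numeral)
  moreover have "t \<in> conj_ring c" "w \<in> conj_ring c"
    unfolding t_def w_def a_def b_def y_def by (intro conj_ring_closed X ab ab')+
  then have "2 * (w * cnj w) - 2 * (t + t * t) \<in> conj_ring c" by (intro conj_ring_closed)
  ultimately have "1 / 2 \<in> conj_ring c" by (simp only:)
  moreover have "1 / 2 \<notin> conj_ring c"
  proof (rule half_notin_conj_ring_preperiodic[OF q])
    have shift: "(antiquad c ^^ k) c = X (Suc k)" for k
      by (simp add: X_def funpow_swap1 antiquad_def)
    show "(antiquad c ^^ (Suc m + q)) c = (antiquad c ^^ Suc m) c"
    proof -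
      have 1: "X (Suc k) = antiquad c (X k)" for k by (simp add: X_def)
      have 2: "X (Suc m + q) = - X (Suc m)" using neg by (simp only: X_def)
      show ?thesis unfolding shift 1[of "Suc m + q"] 1[of "Suc m"] 2 by (simp add: antiquad_def)
    qed
  qed
  ultimately show False by simp
qed

section \<open>Dynamics of the antiholomorphic quadratic family\<close>

lemma antiquad_escape_step: "2 + cmod c < cmod z \<Longrightarrow> 2 * cmod z \<le> cmod (antiquad c z)"
proof -
  assume z: "2 + cmod c < cmod z"
  have "(2 + cmod c) * cmod z \<le> cmod z * cmod z" using z by (intro mult_right_mono) auto
  moreover have "cmod c * 1 \<le> cmod c * cmod z"
    using z norm_ge_zero[of c] by (intro mult_left_mono) linarith+
  moreover have "cmod z * cmod z - cmod c \<le> cmod (antiquad c z)"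
    using norm_diff_ineq[of "(cnj z)\<^sup>2" c] by (simp add: antiquad_def norm_power power2_eq_square norm_mult)
  ultimately show ?thesis by (simp add: distrib_right)
qed

lemma antiquad_escape:
  assumes "2 + cmod c < cmod z" shows "2 ^ n * cmod z \<le> cmod ((antiquad c ^^ n) z)"
proof (induction n)
  case (Suc n)
  have "1 * cmod z \<le> 2 ^ n * cmod z" by (intro mult_right_mono) auto
  with Suc assms have "2 + cmod c < cmod ((antiquad c ^^ n) z)" by simp
  from antiquad_escape_step[OF this] Suc show ?case by simp
qed simp

text \<open>The uniform bound replaces boundedness by closed conditions, which is what the closedness and
semicontinuity arguments use.\<close>
lemma filled_julia_iff: "z \<in> filled_julia c \<longleftrightarrow> (\<forall>n. cmod ((antiquad c ^^ n) z) \<le> 2 + cmod c)"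
proof
  assume "\<forall>n. cmod ((antiquad c ^^ n) z) \<le> 2 + cmod c"
  then show "z \<in> filled_julia c" unfolding filled_julia_def bounded_iff by blast
next
  assume "z \<in> filled_julia c"
  then obtain B where B: "\<And>n. cmod ((antiquad c ^^ n) z) \<le> B"
    unfolding filled_julia_def bounded_iff by blast
  show "\<forall>n. cmod ((antiquad c ^^ n) z) \<le> 2 + cmod c"
  proof (rule ccontr)
    assume "\<not> ?thesis"
    then obtain n where n: "2 + cmod c < cmod ((antiquad c ^^ n) z)" by (auto simp: not_le)
    have g1: "1 < cmod ((antiquad c ^^ n) z)" using n norm_ge_zero[of c] by linarith
    obtain k where "B < 2 ^ k" using real_arch_pow[of 2 B] by auto
    also have "2 ^ k * 1 \<le> 2 ^ k * cmod ((antiquad c ^^ n) z)" using g1 by (intro mult_left_mono) auto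
    also have "\<dots> \<le> cmod ((antiquad c ^^ (k + n)) z)"
      using antiquad_escape[OF n] by (simp add: funpow_add)
    finally show False using B[of "k + n"] by simp
  qed
qed

lemma tricorn_iff_filled_julia: "c \<in> tricorn \<longleftrightarrow> c \<in> filled_julia c"
  by (simp add: tricorn_def filled_julia_def)

lemma continuous_on_antiquad_iterate [continuous_intros]:
  assumes "continuous_on S f" "continuous_on S h"
  shows "continuous_on S (\<lambda>x. (antiquad (f x) ^^ n) (h x))"
  by (induction n) (auto simp: antiquad_def intro!: continuous_intros assms)

lemma closed_filled_julia: "closed (filled_julia c)"
proof -
  have "filled_julia c = (\<Inter>n. {z. cmod ((antiquad c ^^ n) z) \<le> 2 + cmod c})"
    by (auto simp: filled_julia_iff)
  also have "closed \<dots>"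
    by (intro closed_INT ballI closed_Collect_le continuous_intros)
  finally show ?thesis .
qed

lemma closed_tricorn: "closed tricorn"
proof -
  have "tricorn = (\<Inter>n. {c. cmod ((antiquad c ^^ n) c) \<le> 2 + cmod c})"
    by (auto simp: tricorn_iff_filled_julia filled_julia_iff)
  also have "closed \<dots>"
    by (intro closed_INT ballI closed_Collect_le continuous_intros)
  finally show ?thesis .
qed

lemma antiquad_iterate_in_filled_julia_iff:
  "(antiquad c ^^ n) z \<in> filled_julia c \<longleftrightarrow> z \<in> filled_julia c"
proof (induction n)
  case (Suc n)
  have "antiquad c y \<in> filled_julia c \<longleftrightarrow> y \<in> filled_julia c" for y
  proof
    assume "antiquad c y \<in> filled_julia c"
    then obtain B where B: "\<And>n. cmod ((antiquad c ^^ n) (antiquad c y)) \<le> B"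
      unfolding filled_julia_def bounded_iff by blast
    have "cmod ((antiquad c ^^ n) y) \<le> max B (cmod y)" for n
      using B[of "n - 1"] by (cases n) (auto simp: funpow_swap1)
    then show "y \<in> filled_julia c" unfolding filled_julia_def bounded_iff by blast
  next
    assume "y \<in> filled_julia c"
    then have "\<forall>n. cmod ((antiquad c ^^ Suc n) y) \<le> 2 + cmod c" unfolding filled_julia_iff by blast
    then show "antiquad c y \<in> filled_julia c" by (simp add: filled_julia_iff funpow_swap1)
  qed
  with Suc show ?case by simp
qed simp

lemma open_antiquad_iterate_image: "open U \<Longrightarrow> open ((antiquad c ^^ n) ` U)"
proof (induction n)
  case (Suc n)
  have "open (antiquad c ` V)" if "open V" for V
  proof -
    have oc: "open (cnj ` V)"
    proof -
      have "cnj ` V = cnj -` V" by (auto simp: image_iff) (metis complex_cnj_cnj)+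
      also have "open \<dots>" using that by (intro open_vimage continuous_intros)
      finally show ?thesis .
    qed
    have "\<not> (\<lambda>z. z\<^sup>2 + c) constant_on (UNIV :: complex set)"
    proof
      assume "(\<lambda>z. z\<^sup>2 + c) constant_on (UNIV :: complex set)"
      then obtain y where "\<And>z :: complex. z\<^sup>2 + c = y" by (auto simp: constant_on_def)
      from this[of 0] this[of 1] show False by simp
    qed
    then have "open ((\<lambda>z. z\<^sup>2 + c) ` (cnj ` V))"
      by (intro open_mapping_thm[of _ UNIV] oc holomorphic_intros) auto
    then show ?thesis by (simp add: image_image antiquad_def)
  qed
  from this[OF Suc.IH[OF Suc.prems]] show ?case by (simp add: image_image)
qed simp

lemma interior_filled_julia_iterate:
  assumes "z \<in> interior (filled_julia c)" shows "(antiquad c ^^ n) z \<in> interior (filled_julia c)"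
proof -
  let ?U = "(antiquad c ^^ n) ` interior (filled_julia c)"
  have "open ?U" by (intro open_antiquad_iterate_image open_interior)
  moreover have "?U \<subseteq> filled_julia c"
    using interior_subset antiquad_iterate_in_filled_julia_iff by blast
  ultimately show ?thesis using assms interior_maximal by blast
qed

lemma holomorphic_antiquad_iterate:
  "even n \<Longrightarrow> (antiquad c ^^ n) holomorphic_on UNIV"
  "odd n \<Longrightarrow> (\<lambda>z. cnj ((antiquad c ^^ n) z)) holomorphic_on UNIV"
proof (induction n)
  case (Suc n)
  have step1: "(antiquad c ^^ Suc n) = (\<lambda>z. (cnj ((antiquad c ^^ n) z))\<^sup>2 + c)"
    by (rule ext) (simp add: antiquad_def)
  have step2: "(\<lambda>z. cnj ((antiquad c ^^ Suc n) z)) = (\<lambda>z. ((antiquad c ^^ n) z)\<^sup>2 + cnj c)"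
    by (rule ext) (simp add: antiquad_def)
  { case 1
    then have "(\<lambda>z. (cnj ((antiquad c ^^ n) z))\<^sup>2 + c) holomorphic_on UNIV"
      using Suc.IH by (intro holomorphic_intros) auto
    then show ?case unfolding step1 . }
  { case 2
    then have "(\<lambda>z. ((antiquad c ^^ n) z)\<^sup>2 + cnj c) holomorphic_on UNIV"
      using Suc.IH by (intro holomorphic_intros) auto
    then show ?case unfolding step2 . }
qed (auto simp: id_def)

lemma tangent_add:
  "tangent c z (v + v') (\<delta> + \<delta>') n = tangent c z v \<delta> n + tangent c z v' \<delta>' n"
  by (induction n) (auto simp: algebra_simps)

lemma tangent_split: "tangent c z v \<delta> n = tangent c z v 0 n + tangent c z 0 \<delta> n"
  using tangent_add[of c z v 0 0 \<delta> n] by simp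

lemma tangent_scaleR: "tangent c z (a *\<^sub>R v) (a *\<^sub>R \<delta>) n = a *\<^sub>R tangent c z v \<delta> n"
  by (induction n) (auto simp: algebra_simps scaleR_conv_of_real)

lemma tangent_parity: "even n \<Longrightarrow> tangent c z v 0 n = v * tangent c z 1 0 n"
  "odd n \<Longrightarrow> tangent c z v 0 n = cnj v * tangent c z 1 0 n"
  by (induction n) auto

text \<open>The chain rule.\<close>
lemma tangent_cocycle:
  "tangent c z v \<delta> (n + m) = tangent c ((antiquad c ^^ n) z) (tangent c z v \<delta> n) \<delta> m"
proof (induction m)
  case (Suc m)
  have "(antiquad c ^^ (n + m)) z = (antiquad c ^^ m) ((antiquad c ^^ n) z)"
    by (simp add: add.commute[of n m] funpow_add)
  with Suc show ?case by simp
qed simp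

lemma norm_tangent: "cmod (tangent c z v 0 n) = (\<Prod>i<n. 2 * cmod ((antiquad c ^^ i) z)) * cmod v"
  by (induction n) (auto simp: norm_mult)

lemma tangent_bound: "\<exists>B\<ge>0. \<forall>v \<delta>. cmod (tangent c z v \<delta> n) \<le> B * (cmod v + cmod \<delta>)"
proof (induction n)
  case 0
  then show ?case by (intro exI[of _ 1]) auto
next
  case (Suc n)
  then obtain B where B: "0 \<le> B" "\<And>v \<delta>. cmod (tangent c z v \<delta> n) \<le> B * (cmod v + cmod \<delta>)" by blast
  define x where "x = (antiquad c ^^ n) z"
  have "cmod (tangent c z v \<delta> (Suc n)) \<le> (2 * cmod x * B + 1) * (cmod v + cmod \<delta>)" for v \<delta>
  proof -
    have "cmod (tangent c z v \<delta> (Suc n)) \<le> cmod (2 * cnj x * cnj (tangent c z v \<delta> n)) + cmod \<delta>"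
      by (simp add: x_def norm_triangle_ineq)
    also have "\<dots> = 2 * cmod x * cmod (tangent c z v \<delta> n) + cmod \<delta>" by (simp add: norm_mult)
    also have "\<dots> \<le> 2 * cmod x * (B * (cmod v + cmod \<delta>)) + (cmod v + cmod \<delta>)"
      using B by (intro add_mono mult_left_mono) auto
    finally show ?thesis by (simp add: algebra_simps)
  qed
  then show ?case using B(1) by (intro exI[of _ "2 * cmod x * B + 1"]) auto
qed

text \<open>The remainder is controlled jointly in \<open>v\<close> and \<open>\<delta>\<close> because under magnification both vary on the
same scale.\<close>
lemma antiquad_iterate_expansion:
  "\<exists>C\<ge>0. \<forall>v \<delta>. cmod v \<le> 1 \<longrightarrow> cmod \<delta> \<le> 1 \<longrightarrow>
     cmod ((antiquad (c + \<delta>) ^^ n) (z + v) - (antiquad c ^^ n) z - tangent c z v \<delta> n)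
       \<le> C * (cmod v + cmod \<delta>)\<^sup>2"
proof (induction n)
  case (Suc n)
  then obtain C where C: "0 \<le> C" "\<And>v \<delta>. cmod v \<le> 1 \<Longrightarrow> cmod \<delta> \<le> 1 \<Longrightarrow>
     cmod ((antiquad (c + \<delta>) ^^ n) (z + v) - (antiquad c ^^ n) z - tangent c z v \<delta> n)
       \<le> C * (cmod v + cmod \<delta>)\<^sup>2" by blast
  obtain B where B: "0 \<le> B" "\<And>v \<delta>. cmod (tangent c z v \<delta> n) \<le> B * (cmod v + cmod \<delta>)"
    using tangent_bound by blast
  define x where "x = (antiquad c ^^ n) z"
  show ?case
  proof (intro exI[of _ "2 * cmod x * C + (B + 2 * C)\<^sup>2"] conjI allI impI)
    fix v \<delta> :: complex assume v: "cmod v \<le> 1" "cmod \<delta> \<le> 1"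
    define s where "s = cmod v + cmod \<delta>"
    have s: "0 \<le> s" "s \<le> 2" using v by (auto simp: s_def)
    define T where "T = tangent c z v \<delta> n"
    define E where "E = (antiquad (c + \<delta>) ^^ n) (z + v) - x - T"
    have E: "cmod E \<le> C * s\<^sup>2" using C(2)[OF v] by (simp add: E_def x_def T_def s_def)
    have T: "cmod T \<le> B * s" using B by (simp add: T_def s_def)
    have eq: "(antiquad (c + \<delta>) ^^ n) (z + v) = x + T + E" by (simp add: E_def)
    have "(antiquad (c + \<delta>) ^^ Suc n) (z + v) - (antiquad c ^^ Suc n) z - tangent c z v \<delta> (Suc n)
        = 2 * cnj x * cnj E + (cnj (T + E))\<^sup>2"
      using eq by (simp add: antiquad_def flip: x_def T_def) (simp add: power2_eq_square algebra_simps)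
    also have "cmod \<dots> \<le> 2 * cmod x * cmod E + (cmod (T + E))\<^sup>2"
      by (rule order_trans[OF norm_triangle_ineq]) (simp add: norm_mult norm_power del: complex_cnj_add)
    also have "\<dots> \<le> 2 * cmod x * (C * s\<^sup>2) + ((B + 2 * C) * s)\<^sup>2"
    proof (intro add_mono mult_left_mono E power_mono)
      have "s\<^sup>2 \<le> 2 * s" using s by (simp add: power2_eq_square mult_right_mono)
      then have "C * s\<^sup>2 \<le> C * (2 * s)" using C(1) by (rule mult_left_mono)
      with norm_triangle_ineq[of T E] T E show "cmod (T + E) \<le> (B + 2 * C) * s"
        by (simp add: algebra_simps)
    qed auto
    also have "\<dots> = (2 * cmod x * C + (B + 2 * C)\<^sup>2) * s\<^sup>2"
      by (simp only: power_mult_distrib distrib_right[of "2 * cmod x * C" "(B + 2 * C)\<^sup>2" "s\<^sup>2"] mult.assoc[of "2 * cmod x"])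
    finally show "cmod ((antiquad (c + \<delta>) ^^ Suc n) (z + v) - (antiquad c ^^ Suc n) z - tangent c z v \<delta> (Suc n))
       \<le> (2 * cmod x * C + (B + 2 * C)\<^sup>2) * (cmod v + cmod \<delta>)\<^sup>2" by (simp add: s_def)
  qed (use C(1) in auto)
qed (intro exI[of _ 0], simp)

section \<open>Koenigs linearisation under perturbation\<close>

text \<open>Koenigs linearisation at a repelling fixed point \<open>b\<close> of \<open>F 0\<close>, in a family \<open>F \<delta>\<close> whose dependence on
the parameter is only real differentiable. The fixed point of \<open>F \<delta>\<close> is \<open>b - L \<delta> / (\<mu> - 1)\<close> up to
terms of second order; seen from there, the dynamics is multiplication by \<open>\<mu>\<close> up to terms of second
order.\<close>
locale perturbed_repelling_point =
  fixes F :: "complex \<Rightarrow> complex \<Rightarrow> complex" and b \<mu> :: complex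
    and L :: "complex \<Rightarrow> complex" and C :: real
  assumes repelling: "1 < cmod \<mu>"
    and L_bound: "\<And>\<delta>. cmod (L \<delta>) \<le> C * cmod \<delta>"
    and expansion: "\<And>v \<delta>. cmod v \<le> 1 \<Longrightarrow> cmod \<delta> \<le> 1 \<Longrightarrow>
          cmod (F \<delta> (b + v) - b - \<mu> * v - L \<delta>) \<le> C * (cmod v + cmod \<delta>)\<^sup>2"
    and cont: "\<And>n. continuous_on UNIV (\<lambda>p. (F (fst p) ^^ n) (snd p))"
    and hol: "F 0 holomorphic_on UNIV"
begin

definition \<eta> :: real where "\<eta> = 1 / cmod \<mu>"

definition blowup :: "nat \<Rightarrow> complex \<Rightarrow> complex" where
  "blowup n w = (F 0 ^^ n) (b + w / \<mu> ^ n)"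

text \<open>The start \<open>u\<close> of an orbit of \<open>F \<delta>\<close> is displaced from the fixed point of \<open>F \<delta>\<close> by \<open>w / \<mu> ^ k\<close> up to
a quadratic error, so that after \<open>k\<close> steps the displacement is of the order of \<open>w\<close>.\<close>
definition admissible :: "real \<Rightarrow> nat \<Rightarrow> complex \<Rightarrow> complex \<Rightarrow> complex \<Rightarrow> bool" where
  "admissible B k w \<delta> u \<longleftrightarrow> cmod w \<le> B \<and> cmod \<delta> \<le> B * \<eta> ^ k \<and>
     cmod (u - b + L \<delta> / (\<mu> - 1) - w / \<mu> ^ k) \<le> B * (\<eta> ^ k)\<^sup>2"

lemma eta: "0 < \<eta>" "\<eta> < 1" "cmod \<mu> * \<eta> = 1"
  using repelling by (auto simp: \<eta>_def divide_less_eq_1)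

lemma lambda_nz: "\<mu> \<noteq> 0" "\<mu> - 1 \<noteq> 0" "0 < cmod (\<mu> - 1)"
  using repelling by auto

lemma norm_div_lambda: "cmod (w / \<mu> ^ n) = cmod w * \<eta> ^ n"
  by (simp add: norm_divide norm_power \<eta>_def power_one_over divide_simps)

lemma C_nonneg: "0 \<le> C"
  using order_trans[OF norm_ge_zero L_bound[of 1]] by simp

lemma L_zero: "L 0 = 0"
  using L_bound[of 0] by simp

lemma eta_power_small: "0 < (e::real) \<Longrightarrow> \<exists>N. \<forall>n\<ge>N. A * \<eta> ^ n < e"
proof -
  assume e: "0 < e"
  have "(\<lambda>n. A * \<eta> ^ n) \<longlonglongrightarrow> A * 0"
    by (intro tendsto_intros LIMSEQ_power_zero) (use eta in auto)
  then have "\<forall>\<^sub>F n in sequentially. A * \<eta> ^ n < e" using e by (simp add: order_tendsto_iff)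
  then show ?thesis by (auto simp: eventually_sequentially)
qed

lemma eta_power_le: "m \<le> n \<Longrightarrow> \<eta> ^ n \<le> \<eta> ^ m"
  using eta by (intro power_decreasing) auto

text \<open>As long as \<open>m\<close> steps remain, the displacement is still of order \<open>\<eta> ^ m\<close>, and the quadratic error of
each step is dominated by the expansion that follows: the errors sum to a geometric series with
total of order \<open>(\<eta> ^ m)\<^sup>2\<close>. The second error term is the distance between \<open>b\<close> and the fixed point
of \<open>F \<delta>\<close>.\<close>
lemma linear_tracking:
  assumes B: "0 < B"
  obtains D n0 where "0 < D" and
    "\<And>j m w \<delta> u. n0 \<le> m \<Longrightarrow> admissible B (j + m) w \<delta> u \<Longrightarrow>
       cmod ((F \<delta> ^^ j) u - (b + w / \<mu> ^ m)) \<le> D * ((\<eta> ^ m)\<^sup>2 + \<eta> ^ (j + m))"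
proof -
  define C2 where "C2 = C * B / cmod (\<mu> - 1)"
  define G where "G = B + 1 + C2"
  define l where "l = cmod \<mu>"
  have l: "1 < l" using repelling by (simp add: l_def)
  then have ll: "0 < l\<^sup>2 - l" by (simp add: power2_eq_square)
  \<comment> \<open>\<open>G\<close> will bound the displacement and does not depend on \<open>D\<close>, so \<open>D\<close> can absorb the error of one step: \<open>l * D + C * (G + B)\<^sup>2 \<le> l\<^sup>2 * D\<close>.\<close>
  define D where "D = max B (C * (G + B)\<^sup>2 / (l\<^sup>2 - l))"
  have D: "B \<le> D" "0 < D" "C * (G + B)\<^sup>2 \<le> D * (l\<^sup>2 - l)"
    using B ll by (auto simp: D_def pos_divide_le_eq[symmetric])
  have C2: "0 \<le> C2" using C_nonneg B by (simp add: C2_def)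
  have G: "0 < G" using C2 B by (simp add: G_def)
  obtain n0 where n0: "\<And>n. n0 \<le> n \<Longrightarrow> (D + G + B) * \<eta> ^ n < 1"
    using eta_power_small[of 1 "D + G + B"] by auto
  have small: "D * \<eta> ^ n \<le> 1" "G * \<eta> ^ n \<le> 1" "B * \<eta> ^ n \<le> 1" if "n0 \<le> n" for n
  proof -
    have "0 \<le> D * \<eta> ^ n" "0 \<le> G * \<eta> ^ n" "0 \<le> B * \<eta> ^ n" using D G B eta by auto
    with n0[OF that] show "D * \<eta> ^ n \<le> 1" "G * \<eta> ^ n \<le> 1" "B * \<eta> ^ n \<le> 1"
      by (simp_all add: distrib_right)
  qed
  have \<beta>: "cmod (L \<delta> / (\<mu> - 1)) \<le> C2 * \<eta> ^ k" if "cmod \<delta> \<le> B * \<eta> ^ k" for \<delta> k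
  proof -
    have "cmod (L \<delta>) \<le> C * (B * \<eta> ^ k)"
      using L_bound[of \<delta>] mult_left_mono[OF that C_nonneg] by linarith
    then show ?thesis using lambda_nz(3) by (simp add: norm_divide C2_def divide_right_mono)
  qed
  have main: "cmod ((F \<delta> ^^ j) u - b + L \<delta> / (\<mu> - 1) - w / \<mu> ^ m) \<le> D * (\<eta> ^ m)\<^sup>2"
    if "n0 \<le> m" "admissible B (j + m) w \<delta> u" for j m w \<delta> u
    using that
  proof (induction j arbitrary: m)
    case 0
    then have "cmod (u - b + L \<delta> / (\<mu> - 1) - w / \<mu> ^ m) \<le> B * (\<eta> ^ m)\<^sup>2" by (simp add: admissible_def)
    also have "\<dots> \<le> D * (\<eta> ^ m)\<^sup>2" using D by (intro mult_right_mono) auto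
    finally show ?case by simp
  next
    case (Suc j)
    define k where "k = j + Suc m"
    define e where "e = \<eta> ^ Suc m"
    define \<beta> where "\<beta> = L \<delta> / (\<mu> - 1)"
    define t where "t = (F \<delta> ^^ j) u - b + \<beta>"
    define v where "v = t - \<beta>"
    have e: "0 \<le> e" "\<eta> ^ k \<le> e" "n0 \<le> Suc m" using eta eta_power_le Suc.prems by (auto simp: e_def k_def)
    have adm: "admissible B k w \<delta> u" using Suc.prems by (simp add: k_def)
    have IH: "cmod (t - w / \<mu> ^ Suc m) \<le> D * e\<^sup>2"
      using Suc.IH[of "Suc m"] adm e(3) by (simp add: t_def \<beta>_def e_def k_def)
    have \<delta>: "cmod \<delta> \<le> B * e"
    proof -
      have "B * \<eta> ^ k \<le> B * e" using e(2) B by (intro mult_left_mono) auto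
      with adm show ?thesis unfolding admissible_def by linarith
    qed
    have bb: "cmod \<beta> \<le> C2 * e"
    proof -
      have "C2 * \<eta> ^ k \<le> C2 * e" using e(2) C2 by (intro mult_left_mono) auto
      with \<beta>[of \<delta> k] adm show ?thesis unfolding admissible_def \<beta>_def by linarith
    qed
    have "D * e\<^sup>2 \<le> 1 * e"
      using mult_right_mono[OF small(1)[OF e(3)] e(1)] by (simp add: e_def power2_eq_square mult.assoc)
    moreover have "cmod (w / \<mu> ^ Suc m) \<le> B * e"
      using adm e(1) unfolding norm_div_lambda e_def by (simp add: admissible_def mult_right_mono)
    moreover have "cmod v \<le> cmod (t - w / \<mu> ^ Suc m) + cmod (w / \<mu> ^ Suc m) + cmod \<beta>"
      unfolding v_def using norm_triangle_ineq4[of t \<beta>]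
        norm_triangle_ineq[of "t - w / \<mu> ^ Suc m" "w / \<mu> ^ Suc m"] by simp
    ultimately have v: "cmod v \<le> G * e" using IH bb by (simp add: G_def algebra_simps)
    have v1: "cmod v \<le> 1" using v small(2)[OF e(3)] by (simp add: e_def)
    have \<delta>1: "cmod \<delta> \<le> 1" using \<delta> small(3)[OF e(3)] by (simp add: e_def)
    define E where "E = F \<delta> (b + v) - b - \<mu> * v - L \<delta>"
    have "cmod E \<le> C * (cmod v + cmod \<delta>)\<^sup>2" unfolding E_def by (rule expansion[OF v1 \<delta>1])
    also have "\<dots> \<le> C * ((G + B) * e)\<^sup>2"
      using v \<delta> C_nonneg by (intro mult_left_mono power_mono) (auto simp: distrib_right)
    also have "\<dots> \<le> D * (l\<^sup>2 - l) * e\<^sup>2"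
      using D(3) by (simp add: power_mult_distrib mult_right_mono flip: mult.assoc)
    finally have E: "cmod E \<le> D * (l\<^sup>2 - l) * e\<^sup>2" .
    have L\<beta>: "L \<delta> = (\<mu> - 1) * \<beta>" using lambda_nz by (simp add: \<beta>_def)
    have "(F \<delta> ^^ Suc j) u = F \<delta> (b + v)" by (simp add: v_def t_def)
    also have "\<dots> = b + \<mu> * v + L \<delta> + E" by (simp add: E_def)
    finally have "(F \<delta> ^^ Suc j) u - b + \<beta> - w / \<mu> ^ m = \<mu> * (t - w / \<mu> ^ Suc m) + E"
      unfolding L\<beta> v_def using lambda_nz by (simp add: field_simps)
    also have "cmod \<dots> \<le> l * (D * e\<^sup>2) + D * (l\<^sup>2 - l) * e\<^sup>2"
      by (rule order_trans[OF norm_triangle_ineq])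
         (use E IH l in \<open>auto simp: norm_mult l_def intro!: add_mono mult_left_mono\<close>)
    also have "\<dots> = D * (l * e)\<^sup>2" by (simp add: power2_eq_square algebra_simps)
    also have "l * e = \<eta> ^ m" using eta(3) by (simp add: e_def l_def flip: mult.assoc)
    finally show ?case by (simp add: \<beta>_def)
  qed
  show ?thesis
  proof (rule that[of "D + C2" n0])
    fix j m w \<delta> u assume m: "n0 \<le> m" and adm: "admissible B (j + m) w \<delta> u"
    define \<beta>' where "\<beta>' = L \<delta> / (\<mu> - 1)"
    have "cmod ((F \<delta> ^^ j) u - (b + w / \<mu> ^ m))
        = cmod (((F \<delta> ^^ j) u - b + \<beta>' - w / \<mu> ^ m) - \<beta>')" by (simp add: algebra_simps)
    also have "\<dots> \<le> cmod ((F \<delta> ^^ j) u - b + \<beta>' - w / \<mu> ^ m) + cmod \<beta>'" by (rule norm_triangle_ineq4)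
    also have "\<dots> \<le> D * (\<eta> ^ m)\<^sup>2 + C2 * \<eta> ^ (j + m)"
      using main[OF m adm] \<beta>[of \<delta> "j + m"] adm by (intro add_mono) (auto simp: admissible_def \<beta>'_def)
    also have "\<dots> \<le> (D + C2) * ((\<eta> ^ m)\<^sup>2 + \<eta> ^ (j + m))"
      using D C2 eta by (simp add: algebra_simps)
    finally show "cmod ((F \<delta> ^^ j) u - (b + w / \<mu> ^ m)) \<le> (D + C2) * ((\<eta> ^ m)\<^sup>2 + \<eta> ^ (j + m))" .
  qed (use D C2 in auto)
qed

lemma admissible_unperturbed: "0 < B \<Longrightarrow> cmod w \<le> B \<Longrightarrow> admissible B k w 0 (b + w / \<mu> ^ k)"
  using eta by (simp add: admissible_def L_zero)

lemma iterate_holomorphic: "(F 0 ^^ n) holomorphic_on UNIV"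
proof (induction n)
  case (Suc n)
  have "(F 0 \<circ> (F 0 ^^ n)) holomorphic_on UNIV"
    by (rule holomorphic_on_compose_gen[OF Suc hol]) auto
  then show ?case by (simp add: comp_def)
qed (auto simp: id_def)

lemma blowup_holomorphic: "blowup n holomorphic_on S"
proof -
  have "((F 0 ^^ n) \<circ> (\<lambda>w. b + w / \<mu> ^ n)) holomorphic_on S"
    by (rule holomorphic_on_compose_gen[OF _ iterate_holomorphic])
       (use lambda_nz in \<open>auto intro!: holomorphic_intros\<close>)
  then show ?thesis by (simp add: comp_def blowup_def[abs_def])
qed

lemma blowup_zero: "blowup n 0 = b"
proof -
  have "F 0 b = b" using expansion[of 0 0] by (simp add: L_zero)
  then show ?thesis by (induction n) (auto simp: blowup_def)
qed

lemma blowup_bounded: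
  assumes B: "0 < B"
  obtains M N where "\<And>n w. N \<le> n \<Longrightarrow> cmod w \<le> B \<Longrightarrow> cmod (blowup n w) \<le> M"
proof -
  obtain D n0 where D: "0 < D" and tr: "\<And>j m w \<delta> u. n0 \<le> m \<Longrightarrow> admissible B (j + m) w \<delta> u \<Longrightarrow>
       cmod ((F \<delta> ^^ j) u - (b + w / \<mu> ^ m)) \<le> D * ((\<eta> ^ m)\<^sup>2 + \<eta> ^ (j + m))"
    using linear_tracking[OF B] by metis
  have "compact ((F 0 ^^ n0) ` cball b (D * 2 + B))"
    by (intro compact_continuous_image holomorphic_on_imp_continuous_on
          holomorphic_on_subset[OF iterate_holomorphic]) auto
  then obtain M where "\<forall>x\<in>(F 0 ^^ n0) ` cball b (D * 2 + B). cmod x \<le> M"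
    using compact_imp_bounded bounded_iff by metis
  then have M: "\<And>y. y \<in> cball b (D * 2 + B) \<Longrightarrow> cmod ((F 0 ^^ n0) y) \<le> M" by blast
  show ?thesis
  proof (rule that[of n0 M])
    fix n w assume n: "n0 \<le> n" and w: "cmod w \<le> B"
    define y where "y = (F 0 ^^ (n - n0)) (b + w / \<mu> ^ n)"
    have "cmod (y - (b + w / \<mu> ^ n0)) \<le> D * ((\<eta> ^ n0)\<^sup>2 + \<eta> ^ (n - n0 + n0))"
      unfolding y_def using n admissible_unperturbed[OF B w] by (intro tr) auto
    also have "\<dots> \<le> D * (1 + 1)"
      using D eta by (intro mult_left_mono add_mono) (auto simp: power_le_one)
    finally have 1: "cmod (y - (b + w / \<mu> ^ n0)) \<le> D * 2" by simp
    have "cmod (w / \<mu> ^ n0) \<le> B * 1"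
      unfolding norm_div_lambda using w eta B by (intro mult_mono) (auto simp: power_le_one)
    then have "cmod (y - b) \<le> D * 2 + B"
      using 1 norm_triangle_ineq[of "y - (b + w / \<mu> ^ n0)" "w / \<mu> ^ n0"] by simp
    then have "cmod ((F 0 ^^ n0) y) \<le> M" by (intro M) (simp add: dist_norm norm_minus_commute)
    moreover have "blowup n w = (F 0 ^^ n0) y"
      unfolding blowup_def y_def using n funpow_add[of n0 "n - n0" "F 0"] by simp
    ultimately show "cmod (blowup n w) \<le> M" by simp
  qed
qed

text \<open>Uniform bounds for the holomorphic maps \<open>blowup n\<close> give uniform Lipschitz bounds by Cauchy's
estimate. In the original coordinate this says that \<open>n\<close> steps near \<open>b\<close> expand distances by at most a
constant times the \<open>n\<close>-th power of the modulus of \<open>\<mu>\<close>, without any estimate of products of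
derivatives.\<close>
lemma blowup_lipschitz:
  assumes B: "0 < B"
  obtains M N where "0 < M" "\<And>n w w'. N \<le> n \<Longrightarrow> cmod w \<le> B \<Longrightarrow> cmod w' \<le> B \<Longrightarrow>
     cmod (blowup n w - blowup n w') \<le> M * cmod (w - w')"
proof -
  obtain M N where MN: "\<And>n w. N \<le> n \<Longrightarrow> cmod w \<le> B + 1 \<Longrightarrow> cmod (blowup n w) \<le> M"
    using blowup_bounded[of "B + 1"] B by (metis add_pos_pos zero_less_one)
  show ?thesis
  proof (rule that[of "\<bar>M\<bar> + 1" N])
    fix n w w' assume n: "N \<le> n" and w: "cmod w \<le> B" "cmod w' \<le> B"
    have "cmod (deriv (blowup n) z) \<le> \<bar>M\<bar> + 1" if "z \<in> cball 0 B" for z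
    proof -
      have "cmod ((deriv ^^ 1) (blowup n) z) \<le> fact 1 * M / 1 ^ 1"
      proof (rule Cauchy_inequality)
        show "continuous_on (cball z 1) (blowup n)"
          by (intro holomorphic_on_imp_continuous_on blowup_holomorphic)
        show "cmod (blowup n x) \<le> M" if "cmod (z - x) = 1" for x
          using \<open>z \<in> cball 0 B\<close> that norm_triangle_ineq4[of z "z - x"] by (intro MN n) auto
      qed (auto intro: blowup_holomorphic)
      then show ?thesis by simp
    qed
    moreover have "(blowup n has_field_derivative deriv (blowup n) z) (at z within cball 0 B)" for z
      by (rule holomorphic_derivI[OF blowup_holomorphic open_UNIV UNIV_I])
    ultimately show "cmod (blowup n w - blowup n w') \<le> (\<bar>M\<bar> + 1) * cmod (w - w')"
      using w by (intro field_differentiable_bound[of "cball 0 B"]) auto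
  qed auto
qed

text \<open>The orbit is split \<open>n\<close> steps before its end. Up to that moment \<open>linear_tracking\<close> applies. The last
\<open>n\<close> steps are those of \<open>F 0\<close> up to an error that vanishes as \<open>k\<close> grows with \<open>n\<close> fixed, and they
magnify the tracking error of order \<open>(\<eta> ^ n)\<^sup>2\<close> only to order \<open>\<eta> ^ n\<close>.\<close>
lemma perturbed_close_to_blowup:
  assumes B: "0 < B" and \<epsilon>: "0 < \<epsilon>"
  shows "\<exists>N. \<forall>n\<ge>N. \<exists>K. \<forall>k\<ge>K. \<forall>w \<delta> u. admissible B k w \<delta> u \<longrightarrow>
           cmod ((F \<delta> ^^ k) u - blowup n w) < \<epsilon>"
proof -
  obtain D n0 where D: "0 < D" and tr: "\<And>j m w \<delta> u. n0 \<le> m \<Longrightarrow> admissible B (j + m) w \<delta> u \<Longrightarrow>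
       cmod ((F \<delta> ^^ j) u - (b + w / \<mu> ^ m)) \<le> D * ((\<eta> ^ m)\<^sup>2 + \<eta> ^ (j + m))"
    using linear_tracking[OF B] by metis
  obtain M n1 where M: "0 < M" and lip: "\<And>n w w'. n1 \<le> n \<Longrightarrow> cmod w \<le> B + 1 \<Longrightarrow> cmod w' \<le> B + 1 \<Longrightarrow>
     cmod (blowup n w - blowup n w') \<le> M * cmod (w - w')"
    using blowup_lipschitz[of "B + 1"] B by (metis add_pos_pos zero_less_one)
  obtain n2 where n2: "\<And>n. n2 \<le> n \<Longrightarrow> (2 * D) * \<eta> ^ n < 1"
    using eta_power_small[of 1 "2 * D"] by auto
  obtain n3 where n3: "\<And>n. n3 \<le> n \<Longrightarrow> (M * (2 * D)) * \<eta> ^ n < \<epsilon> / 2"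
    using eta_power_small[of "\<epsilon> / 2" "M * (2 * D)"] \<epsilon> by auto
  show ?thesis
  proof (rule exI[of _ "max (max n0 n1) (max n2 n3)"], intro allI impI)
    fix n assume n: "max (max n0 n1) (max n2 n3) \<le> n"
    let ?S = "cball (0::complex) 1 \<times> cball b (B + 1)"
    have "uniformly_continuous_on ?S (\<lambda>p. (F (fst p) ^^ n) (snd p))"
      by (intro compact_uniformly_continuous compact_Times continuous_on_subset[OF cont]) auto
    then obtain d where d: "0 < d" and uc: "\<And>p p'. p \<in> ?S \<Longrightarrow> p' \<in> ?S \<Longrightarrow> dist p' p < d \<Longrightarrow>
        dist ((F (fst p') ^^ n) (snd p')) ((F (fst p) ^^ n) (snd p)) < \<epsilon> / 2"
      unfolding uniformly_continuous_on_def using \<epsilon> by (metis half_gt_zero)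
    obtain K0 where K0: "\<And>k. K0 \<le> k \<Longrightarrow> B * \<eta> ^ k < min d 1"
      using eta_power_small[of "min d 1" B] d by auto
    show "\<exists>K. \<forall>k\<ge>K. \<forall>w \<delta> u. admissible B k w \<delta> u \<longrightarrow> cmod ((F \<delta> ^^ k) u - blowup n w) < \<epsilon>"
    proof (intro exI[of _ "max K0 (2 * n)"] allI impI)
      fix k w \<delta> u assume k: "max K0 (2 * n) \<le> k" and adm: "admissible B k w \<delta> u"
      have w: "cmod w \<le> B" using adm by (simp add: admissible_def)
      have \<delta>: "cmod \<delta> < d" "cmod \<delta> \<le> 1" using adm K0[of k] k by (auto simp: admissible_def)
      define u' where "u' = (F \<delta> ^^ (k - n)) u"
      define w' where "w' = \<mu> ^ n * (u' - b)"
      have "cmod (u' - (b + w / \<mu> ^ n)) \<le> D * ((\<eta> ^ n)\<^sup>2 + \<eta> ^ (k - n + n))"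
        unfolding u'_def using n k adm by (intro tr) auto
      also have "\<eta> ^ (k - n + n) \<le> (\<eta> ^ n)\<^sup>2"
        using k eta_power_le[of "2 * n" k] by (simp add: power_mult[symmetric] mult.commute)
      finally have uu: "cmod (u' - (b + w / \<mu> ^ n)) \<le> 2 * D * (\<eta> ^ n)\<^sup>2" using D by simp
      have "w' - w = \<mu> ^ n * (u' - (b + w / \<mu> ^ n))"
        using lambda_nz by (simp add: w'_def field_simps)
      then have "cmod (w' - w) \<le> cmod \<mu> ^ n * (2 * D * (\<eta> ^ n)\<^sup>2)"
        using uu by (simp add: norm_mult norm_power mult_left_mono)
      also have "\<dots> = (cmod \<mu> * \<eta>) ^ n * (2 * D * \<eta> ^ n)"
        by (simp add: power_mult_distrib power2_eq_square)
      finally have ww: "cmod (w' - w) \<le> 2 * D * \<eta> ^ n" using eta(3) by simp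
      then have w': "cmod w' \<le> B + 1"
        using w n2[of n] n norm_triangle_ineq[of w "w' - w"] by simp
      have u'w': "u' = b + w' / \<mu> ^ n" using lambda_nz by (simp add: w'_def)
      have "cmod (w' / \<mu> ^ n) \<le> (B + 1) * 1"
        unfolding norm_div_lambda using w' eta B by (intro mult_mono) (auto simp: power_le_one)
      then have u'S: "u' \<in> cball b (B + 1)" unfolding u'w' by (simp add: dist_norm)
      have "(F \<delta> ^^ k) u = (F \<delta> ^^ n) u'"
        unfolding u'_def using k funpow_add[of n "k - n" "F \<delta>"] by simp
      moreover have "dist ((F \<delta> ^^ n) u') ((F 0 ^^ n) u') < \<epsilon> / 2"
        using uc[of "(0, u')" "(\<delta>, u')"] u'S \<delta> by (simp add: dist_Pair_Pair)
      moreover have "(F 0 ^^ n) u' = blowup n w'" by (simp add: blowup_def u'w')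
      moreover have "cmod (blowup n w' - blowup n w) < \<epsilon> / 2"
      proof -
        have "cmod (blowup n w' - blowup n w) \<le> M * cmod (w' - w)"
          using n w w' by (intro lip) auto
        also have "\<dots> \<le> M * (2 * D * \<eta> ^ n)" using ww M by (intro mult_left_mono) auto
        also have "\<dots> < \<epsilon> / 2" using n3[of n] n by (simp add: mult.assoc)
        finally show ?thesis .
      qed
      ultimately show "cmod ((F \<delta> ^^ k) u - blowup n w) < \<epsilon>"
        using norm_triangle_ineq[of "(F \<delta> ^^ n) u' - blowup n w'" "blowup n w' - blowup n w"]
        by (simp add: dist_norm)
    qed
  qed
qed

definition linearizer :: "complex \<Rightarrow> complex" where
  "linearizer w = lim (\<lambda>n. blowup n w)"

lemma blowup_uniform_limit:
  assumes B: "0 < B" shows "uniform_limit (cball 0 B) blowup linearizer sequentially"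
proof -
  have "uniformly_Cauchy_on (cball 0 B) blowup"
    unfolding uniformly_Cauchy_on_def
  proof (intro allI impI)
    fix e :: real assume e: "0 < e"
    then obtain N where N: "\<And>n. N \<le> n \<Longrightarrow> \<exists>K. \<forall>k\<ge>K. \<forall>w \<delta> u. admissible B k w \<delta> u \<longrightarrow>
           cmod ((F \<delta> ^^ k) u - blowup n w) < e / 2"
      using perturbed_close_to_blowup[OF B, of "e / 2"] by auto
    show "\<exists>M. \<forall>x\<in>cball 0 B. \<forall>m\<ge>M. \<forall>n\<ge>M. dist (blowup m x) (blowup n x) < e"
    proof (intro exI[of _ N] ballI allI impI)
      fix x :: complex and m n assume x: "x \<in> cball 0 B" and mn: "N \<le> m" "N \<le> n"
      obtain K where K: "\<And>k w \<delta> u. K \<le> k \<Longrightarrow> admissible B k w \<delta> u \<Longrightarrow>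
           cmod ((F \<delta> ^^ k) u - blowup n w) < e / 2" using N[OF mn(2)] by blast
      obtain K' where K': "\<And>k w \<delta> u. K' \<le> k \<Longrightarrow> admissible B k w \<delta> u \<Longrightarrow>
           cmod ((F \<delta> ^^ k) u - blowup m w) < e / 2" using N[OF mn(1)] by blast
      let ?k = "max K K'"
      have adm: "admissible B ?k x 0 (b + x / \<mu> ^ ?k)"
        using admissible_unperturbed[OF B] x by simp
      have "dist (blowup ?k x) (blowup n x) < e / 2" "dist (blowup ?k x) (blowup m x) < e / 2"
        using K[OF _ adm] K'[OF _ adm] by (simp_all add: blowup_def dist_norm)
      then show "dist (blowup m x) (blowup n x) < e"
        by (metis dist_commute dist_triangle_half_r)
    qed
  qed
  then obtain l where l: "uniform_limit (cball 0 B) blowup l sequentially"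
    using Cauchy_uniformly_convergent uniformly_convergent_on_def by blast
  have "linearizer w = l w" if "w \<in> cball 0 B" for w
    unfolding linearizer_def using tendsto_uniform_limitI[OF l that] by (rule limI)
  then have "uniform_limit (cball 0 B) blowup linearizer sequentially
      = uniform_limit (cball 0 B) blowup l sequentially"
    by (intro uniform_limit_cong') auto
  then show ?thesis using l by simp
qed

lemma linearizer_holomorphic: "linearizer holomorphic_on UNIV"
proof (rule holomorphic_uniform_sequence[of UNIV blowup])
  fix x :: complex
  have "cball x 1 \<subseteq> cball 0 (cmod x + 1)"
  proof
    fix y assume "y \<in> cball x 1"
    then show "y \<in> cball 0 (cmod x + 1)"
      using norm_triangle_ineq[of x "y - x"] by (simp add: dist_norm norm_minus_commute)
  qed
  moreover have "uniform_limit (cball 0 (cmod x + 1)) blowup linearizer sequentially"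
    by (intro blowup_uniform_limit) (simp add: add_nonneg_pos)
  ultimately show "\<exists>d>0. cball x d \<subseteq> UNIV \<and> uniform_limit (cball x d) blowup linearizer sequentially"
    using uniform_limit_on_subset by (intro exI[of _ 1]) auto
qed (auto intro: blowup_holomorphic)

text \<open>By \<open>linear_tracking\<close> the value at \<open>1 / \<mu> ^ m\<close> agrees with \<open>b + 1 / \<mu> ^ m\<close> up to a quadratic error.\<close>
lemma linearizer_nonconstant: "\<not> linearizer constant_on UNIV"
proof
  assume "linearizer constant_on UNIV"
  then have const: "linearizer w = linearizer 0" for w unfolding constant_on_def by (metis UNIV_I)
  have lim: "(\<lambda>n. blowup n w) \<longlonglongrightarrow> linearizer w" for w
    using tendsto_uniform_limitI[OF blowup_uniform_limit[of "cmod w + 1"], of w]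
    by (simp add: add_nonneg_pos)
  have "linearizer 0 = b" using lim[of 0] by (simp add: blowup_zero LIMSEQ_const_iff)
  then have lb: "linearizer w = b" for w using const by metis
  obtain D n0 where D: "0 < D" and tr: "\<And>j m w \<delta> u. n0 \<le> m \<Longrightarrow> admissible 1 (j + m) w \<delta> u \<Longrightarrow>
       cmod ((F \<delta> ^^ j) u - (b + w / \<mu> ^ m)) \<le> D * ((\<eta> ^ m)\<^sup>2 + \<eta> ^ (j + m))"
    using linear_tracking[of 1] by auto
  have "\<eta> ^ m \<le> D * (\<eta> ^ m)\<^sup>2" if m: "n0 \<le> m" for m
  proof -
    have "cmod (blowup j (1 / \<mu> ^ m) - (b + 1 / \<mu> ^ m)) \<le> D * ((\<eta> ^ m)\<^sup>2 + \<eta> ^ (j + m))" for j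
      using tr[OF m admissible_unperturbed[of 1 1 "j + m"]]
      by (simp add: blowup_def power_add mult.commute)
    moreover have "(\<lambda>j. cmod (blowup j (1 / \<mu> ^ m) - (b + 1 / \<mu> ^ m))) \<longlonglongrightarrow>
        cmod (linearizer (1 / \<mu> ^ m) - (b + 1 / \<mu> ^ m))"
      by (intro tendsto_intros lim)
    moreover have "(\<lambda>j. D * ((\<eta> ^ m)\<^sup>2 + \<eta> ^ j * \<eta> ^ m)) \<longlonglongrightarrow> D * ((\<eta> ^ m)\<^sup>2 + 0 * \<eta> ^ m)"
      using eta by (intro tendsto_intros LIMSEQ_power_zero) auto
    ultimately have "cmod (linearizer (1 / \<mu> ^ m) - (b + 1 / \<mu> ^ m)) \<le> D * ((\<eta> ^ m)\<^sup>2 + 0 * \<eta> ^ m)"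
      by (intro LIMSEQ_le) (auto simp: power_add)
    then show ?thesis using norm_div_lambda[of 1 m] by (simp add: lb)
  qed
  moreover obtain n1 where "\<And>n. n1 \<le> n \<Longrightarrow> D * \<eta> ^ n < 1" using eta_power_small[of 1 D] by auto
  ultimately have "\<eta> ^ max n0 n1 \<le> (D * \<eta> ^ max n0 n1) * \<eta> ^ max n0 n1" "D * \<eta> ^ max n0 n1 < 1"
    by (auto simp: power2_eq_square mult.assoc)
  moreover have "0 < \<eta> ^ max n0 n1" using eta by simp
  ultimately show False by (simp add: mult_le_cancel_right1)
qed

lemma perturbed_uniform_limit:
  assumes B: "0 < B"
    and adm: "\<And>k w. k0 \<le> k \<Longrightarrow> w \<in> S \<Longrightarrow> admissible B k (s w) (\<delta> k w) (u k w)"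
  shows "uniform_limit S (\<lambda>k w. (F (\<delta> k w) ^^ k) (u k w)) (\<lambda>w. linearizer (s w)) sequentially"
proof (rule uniform_limitI)
  fix e :: real assume e: "0 < e"
  obtain N where N: "\<And>n. N \<le> n \<Longrightarrow> \<exists>K. \<forall>k\<ge>K. \<forall>w \<delta> u. admissible B k w \<delta> u \<longrightarrow>
           cmod ((F \<delta> ^^ k) u - blowup n w) < e / 2"
    using perturbed_close_to_blowup[OF B, of "e / 2"] e by auto
  have "\<forall>\<^sub>F n in sequentially. \<forall>w\<in>cball 0 B. dist (blowup n w) (linearizer w) < e / 2"
    by (rule uniform_limitD[OF blowup_uniform_limit[OF B]]) (use e in simp)
  then obtain N' where N': "\<And>n w. N' \<le> n \<Longrightarrow> w \<in> cball 0 B \<Longrightarrow> dist (blowup n w) (linearizer w) < e / 2"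
    unfolding eventually_sequentially by blast
  let ?n = "max N N'"
  obtain K where K: "\<And>k w \<delta> u. K \<le> k \<Longrightarrow> admissible B k w \<delta> u \<Longrightarrow>
           cmod ((F \<delta> ^^ k) u - blowup ?n w) < e / 2" using N[of ?n, OF max.cobounded1] by blast
  have "\<forall>w\<in>S. dist ((F (\<delta> k w) ^^ k) (u k w)) (linearizer (s w)) < e" if k: "max K k0 \<le> k" for k
  proof
    fix w assume w: "w \<in> S"
    have a: "admissible B k (s w) (\<delta> k w) (u k w)" using adm k w by simp
    then have "s w \<in> cball 0 B" by (simp add: admissible_def)
    then have "dist (blowup ?n (s w)) (linearizer (s w)) < e / 2" by (intro N') auto
    moreover have "dist (blowup ?n (s w)) ((F (\<delta> k w) ^^ k) (u k w)) < e / 2"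
      using K[OF _ a] k by (simp add: dist_norm norm_minus_commute)
    ultimately show "dist ((F (\<delta> k w) ^^ k) (u k w)) (linearizer (s w)) < e"
      by (metis dist_commute dist_triangle_half_r)
  qed
  then show "\<forall>\<^sub>F k in sequentially. \<forall>w\<in>S. dist ((F (\<delta> k w) ^^ k) (u k w)) (linearizer (s w)) < e"
    unfolding eventually_sequentially by blast
qed

end

section \<open>Inverse branches away from the critical orbit\<close>

lemma funpow_diff_apply: "k \<le> n \<Longrightarrow> (f ^^ (n - k)) ((f ^^ k) a) = (f ^^ n) a"
  by (metis comp_apply funpow_add le_add_diff_inverse2)

lemma uniform_limit_moving_point:
  fixes l :: "'a :: metric_space \<Rightarrow> 'b :: metric_space"
  assumes lim: "uniform_limit S f l sequentially" and s: "filterlim s sequentially sequentially"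
    and l: "continuous_on S l" and x: "x \<longlonglongrightarrow> y" "y \<in> S" "\<forall>\<^sub>F j in sequentially. x j \<in> S"
  shows "(\<lambda>j. f (s j) (x j)) \<longlonglongrightarrow> l y"
proof (rule tendstoI)
  fix e :: real assume e: "0 < e"
  have "\<forall>\<^sub>F n in sequentially. \<forall>u\<in>S. dist (f n u) (l u) < e / 2"
    by (rule uniform_limitD[OF lim]) (use e in simp)
  then have "\<forall>\<^sub>F j in sequentially. \<forall>u\<in>S. dist (f (s j) u) (l u) < e / 2"
    by (rule eventually_compose_filterlim[OF _ s])
  moreover have "(\<lambda>j. l (x j)) \<longlonglongrightarrow> l y" by (rule continuous_on_tendsto_compose[OF l x])
  then have "\<forall>\<^sub>F j in sequentially. dist (l (x j)) (l y) < e / 2" by (rule tendstoD) (use e in simp)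
  ultimately show "\<forall>\<^sub>F j in sequentially. dist (f (s j) (x j)) (l y) < e"
    using x(3)
  proof eventually_elim
    case (elim j)
    then show ?case by (metis dist_commute dist_triangle_half_r)
  qed
qed

text \<open>A branch of the inverse of an even iterate is built from square roots, two steps at a time so that
it stays holomorphic. A square root of a nonvanishing function exists on a convex set, and the
radicands vanish only at points of the orbit of \<open>c\<close>.\<close>
lemma antiquad_inverse_branch:
  assumes W: "open W" "convex W" and avoid: "\<And>n. (antiquad c ^^ n) c \<notin> W"
  shows "(antiquad c ^^ (2 * k)) z \<in> W \<Longrightarrow> \<exists>\<psi>. \<psi> holomorphic_on W \<and> \<psi> ((antiquad c ^^ (2 * k)) z) = z
           \<and> (\<forall>t\<in>W. (antiquad c ^^ (2 * k)) (\<psi> t) = t)"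
proof (induction k arbitrary: z)
  case 0
  then show ?case by (intro exI[of _ "\<lambda>t. t"]) auto
next
  case (Suc k)
  have sqrt: "\<exists>s. s holomorphic_on W \<and> (\<forall>t\<in>W. (s t)\<^sup>2 = f t) \<and> s y = v"
    if f: "f holomorphic_on W" "\<And>t. t \<in> W \<Longrightarrow> f t \<noteq> 0" and y: "y \<in> W" "v\<^sup>2 = f y" for f y v
  proof -
    obtain s where s: "s holomorphic_on W" "\<And>t. t \<in> W \<Longrightarrow> f t = (s t)\<^sup>2"
      using contractible_imp_holomorphic_sqrt[OF f(1) convex_imp_contractible[OF W(2)] f(2)] by metis
    have "v = s y \<or> v = - s y" using y s(2)[OF y(1)] by (simp add: power2_eq_iff)
    then show ?thesis
    proof
      assume "v = s y"
      then show ?thesis using s by (intro exI[of _ s]) auto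
    next
      assume "v = - s y"
      then show ?thesis using s by (intro exI[of _ "\<lambda>t. - s t"]) (auto intro: holomorphic_intros)
    qed
  qed
  define y where "y = (antiquad c ^^ (2 * Suc k)) z"
  define z1 where "z1 = antiquad c z"
  define z2 where "z2 = antiquad c z1"
  have y: "y \<in> W" "(antiquad c ^^ (2 * k)) z2 = y"
    using Suc.prems by (simp_all add: y_def z1_def z2_def funpow_swap1)
  obtain \<xi> where \<xi>: "\<xi> holomorphic_on W" "\<xi> y = z2" "\<And>t. t \<in> W \<Longrightarrow> (antiquad c ^^ (2 * k)) (\<xi> t) = t"
    using Suc.IH[of z2] y by auto
  have n1: "\<xi> t - c \<noteq> 0" if "t \<in> W" for t
    using \<xi>(3)[OF that] avoid[of "2 * k"] that by auto
  obtain s where s: "s holomorphic_on W" "\<And>t. t \<in> W \<Longrightarrow> (s t)\<^sup>2 = \<xi> t - c" "s y = cnj z1"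
  proof -
    have "\<exists>s. s holomorphic_on W \<and> (\<forall>t\<in>W. (s t)\<^sup>2 = \<xi> t - c) \<and> s y = cnj z1"
      by (rule sqrt) (use \<xi>(1,2) n1 y(1) in \<open>auto simp: z2_def antiquad_def intro!: holomorphic_intros\<close>)
    then show thesis using that by blast
  qed
  have n2: "s t - cnj c \<noteq> 0" if t: "t \<in> W" for t
  proof
    assume "s t - cnj c = 0"
    then have "\<xi> t = antiquad c c" using s(2)[OF t] by (simp add: antiquad_def algebra_simps)
    then have "(antiquad c ^^ (2 * k + 1)) c = t" using \<xi>(3)[OF t] by (simp add: funpow_swap1)
    then show False using avoid t by blast
  qed
  obtain \<psi> where \<psi>: "\<psi> holomorphic_on W" "\<And>t. t \<in> W \<Longrightarrow> (\<psi> t)\<^sup>2 = s t - cnj c" "\<psi> y = z"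
  proof -
    have "\<exists>\<psi>. \<psi> holomorphic_on W \<and> (\<forall>t\<in>W. (\<psi> t)\<^sup>2 = s t - cnj c) \<and> \<psi> y = z"
      by (rule sqrt) (use s(1,3) n2 y(1) in \<open>auto simp: z1_def antiquad_def intro!: holomorphic_intros\<close>)
    then show thesis using that by blast
  qed
  have "(antiquad c ^^ (2 * Suc k)) (\<psi> t) = t" if t: "t \<in> W" for t
  proof -
    have "antiquad c (\<psi> t) = cnj (s t)"
      using arg_cong[OF \<psi>(2)[OF t], of cnj] by (simp add: antiquad_def)
    then have "antiquad c (antiquad c (\<psi> t)) = \<xi> t" using s(2)[OF t] by (simp add: antiquad_def)
    then show ?thesis using \<xi>(3)[OF t] by (simp add: funpow_swap1)
  qed
  then show ?case unfolding y_def[symmetric] using \<psi>(1,3) by blast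
qed

text \<open>A thin neighbourhood of a segment from \<open>y\<close> to a far point. Each point of \<open>P\<close> excludes at most one
slope of the segment.\<close>
lemma convex_corridor_avoiding_finite:
  fixes y :: complex
  assumes P: "finite P" "y \<notin> P"
  obtains W e where "open W" "convex W" "bounded W" "y \<in> W" "e \<in> W" "W \<inter> P = {}" "R < cmod e"
proof -
  let ?slope = "\<lambda>p. Im (p - y) / Re (p - y)"
  have "infinite ({0<..<1} - ?slope ` P)" using P by (simp add: infinite_Ioo Diff_infinite_finite)
  then have "{0<..<1} - ?slope ` P \<noteq> {}" by (metis finite.emptyI)
  then obtain s where s: "s \<notin> ?slope ` P" by blast
  define T where "T = \<bar>R\<bar> + cmod y + 1"
  have T: "0 < T" unfolding T_def using norm_ge_zero[of y] by linarith
  define e where "e = y + of_real T * Complex 1 s"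
  let ?I = "closed_segment y e"
  have "T \<le> cmod (e - y)"
  proof -
    have "T = \<bar>Re (e - y)\<bar>" using T by (simp add: e_def)
    then show ?thesis using abs_Re_le_cmod[of "e - y"] by simp
  qed
  then have eR: "R < cmod e" using norm_triangle_ineq4[of e y] by (simp add: T_def)
  have disj: "p \<notin> ?I" if p: "p \<in> P" for p
  proof
    assume "p \<in> ?I"
    then obtain u where u: "p = (1 - u) *\<^sub>R y + u *\<^sub>R e" by (auto simp: closed_segment_def)
    have d: "p - y = of_real (u * T) * Complex 1 s"
      unfolding u e_def by (simp add: scaleR_conv_of_real algebra_simps)
    have "u * T \<noteq> 0" using d p P(2) by auto
    then have "?slope p = s" unfolding d by simp
    with s p show False by blast
  qed
  have "\<exists>\<epsilon>>0. \<forall>p\<in>P. \<forall>x\<in>?I. \<epsilon> \<le> dist p x"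
  proof -
    have "compact P" "closed ?I" "P \<inter> ?I = {}" using P disj by (auto simp: finite_imp_compact)
    from separate_compact_closed[OF this] show ?thesis .
  qed
  then obtain \<epsilon> where \<epsilon>: "0 < \<epsilon>" "\<And>p x. p \<in> P \<Longrightarrow> x \<in> ?I \<Longrightarrow> \<epsilon> \<le> dist p x" by blast
  define W where "W = (\<Union>x\<in>?I. \<Union>u\<in>ball 0 \<epsilon>. {x + u})"
  show ?thesis
  proof
    show "open W" unfolding W_def by (intro open_sums) auto
    show "convex W" unfolding W_def by (intro convex_sums) auto
    show "bounded W" unfolding W_def by (intro bounded_sums) (auto intro: bounded_closed_segment)
    have "x \<in> W" if "x \<in> ?I" for x using that \<epsilon>(1) by (force simp: W_def)
    then show "y \<in> W" "e \<in> W" by auto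
    show "W \<inter> P = {}"
    proof (rule ccontr)
      assume "W \<inter> P \<noteq> {}"
      then obtain x u where "x \<in> ?I" "cmod u < \<epsilon>" "x + u \<in> P" by (auto simp: W_def)
      with \<epsilon>(2)[of "x + u" x] show False by (simp add: dist_norm)
    qed
    show "R < cmod e" by (rule eR)
  qed
qed

text \<open>Join \<open>y\<close> by a convex corridor to an escaping point \<open>e\<close>, avoiding the orbit of \<open>c\<close>. The inverse
branches that return the orbit of \<open>z\<close> to \<open>z\<close> form a normal family on the corridor. A limit \<open>\<Psi>\<close> takes
values in the filled Julia set, since its values cannot escape, and \<open>\<Psi> y = z\<close> is interior; hence
\<open>\<Psi> e\<close> is interior, whether \<open>\<Psi>\<close> is constant or open. But \<open>\<Psi> e\<close> is a limit of escaping points.\<close>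
lemma no_interior_limit_off_critical_orbit:
  assumes fin: "finite (range (\<lambda>n. (antiquad c ^^ n) c))"
    and y: "y \<notin> range (\<lambda>n. (antiquad c ^^ n) c)"
    and z: "z \<in> interior (filled_julia c)"
    and t: "\<And>j :: nat. j \<le> t j" and lim: "(\<lambda>j. (antiquad c ^^ (2 * t j)) z) \<longlonglongrightarrow> y"
  shows False
proof -
  define R where "R = 2 + cmod c"
  obtain W e where W: "open W" "convex W" "bounded W" "y \<in> W" "e \<in> W"
      and WP: "W \<inter> range (\<lambda>n. (antiquad c ^^ n) c) = {}" and e: "R < cmod e"
    using convex_corridor_avoiding_finite[OF fin y, of R] by metis
  obtain R' where R': "\<And>u. u \<in> W \<Longrightarrow> cmod u \<le> R'" "R \<le> R'"
  proof -
    obtain a where "\<And>u. u \<in> W \<Longrightarrow> cmod u \<le> a" using W(3) by (auto simp: bounded_iff)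
    then show thesis by (intro that[of "max a R"]) (auto intro: max.coboundedI1)
  qed
  have "\<forall>\<^sub>F j in sequentially. (antiquad c ^^ (2 * t j)) z \<in> W"
    using topological_tendstoD[OF lim W(1,4)] .
  then obtain j0 where j0: "\<And>j. j0 \<le> j \<Longrightarrow> (antiquad c ^^ (2 * t j)) z \<in> W"
    unfolding eventually_sequentially by blast
  define n where "n j = 2 * t (j + j0)" for j
  define Y where "Y j = (antiquad c ^^ n j) z" for j
  have Y: "Y j \<in> W" for j using j0 by (simp add: Y_def n_def)
  have nj: "j \<le> n j" for j using t[of "j + j0"] by (simp add: n_def)
  have Ylim: "Y \<longlonglongrightarrow> y"
    unfolding Y_def n_def using LIMSEQ_ignore_initial_segment[OF lim, of j0] .
  have "\<exists>\<psi>. \<psi> holomorphic_on W \<and> \<psi> (Y j) = z \<and> (\<forall>u\<in>W. (antiquad c ^^ n j) (\<psi> u) = u)" for j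
    unfolding Y_def n_def by (intro antiquad_inverse_branch W(1,2)) (use WP Y in \<open>auto simp: Y_def n_def\<close>)
  then obtain \<psi> where \<psi>: "\<And>j. \<psi> j holomorphic_on W" "\<And>j. \<psi> j (Y j) = z"
      "\<And>j u. u \<in> W \<Longrightarrow> (antiquad c ^^ n j) (\<psi> j u) = u" by metis
  have escape: "cmod u \<le> R'" if "cmod ((antiquad c ^^ k) u) \<le> R'" for u k
  proof (rule ccontr)
    assume "\<not> ?thesis"
    then have u: "R' < cmod u" "2 + cmod c < cmod u" using R'(2) by (auto simp: R_def)
    have "1 * cmod u \<le> 2 ^ k * cmod u" by (intro mult_right_mono) auto
    with antiquad_escape[OF u(2), of k] u(1) that show False by linarith
  qed
  have \<psi>bd: "cmod (\<psi> j u) \<le> R'" if "u \<in> W" for j u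
    using escape[of "n j" "\<psi> j u"] \<psi>(3)[OF that] R'(1)[OF that] by simp
  obtain \<Psi> r where \<Psi>: "\<Psi> holomorphic_on W" and r: "strict_mono (r :: nat \<Rightarrow> nat)"
    and ptw: "\<And>x. x \<in> W \<Longrightarrow> (\<lambda>j. \<psi> (r j) x) \<longlonglongrightarrow> \<Psi> x"
    and unif: "\<And>K. compact K \<Longrightarrow> K \<subseteq> W \<Longrightarrow> uniform_limit K (\<psi> \<circ> r) \<Psi> sequentially"
    using Montel[of W "range \<psi>" \<psi>] W(1) \<psi>(1) \<psi>bd by (smt (verit) imageE subset_iff)
  have \<Psi>K: "\<Psi> u \<in> filled_julia c" if u: "u \<in> W" for u
  proof (rule ccontr)
    assume "\<Psi> u \<notin> filled_julia c"
    then obtain N where N: "R < cmod ((antiquad c ^^ N) (\<Psi> u))"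
      unfolding filled_julia_iff R_def by (auto simp: not_le)
    have N1: "1 \<le> cmod ((antiquad c ^^ N) (\<Psi> u))" using N norm_ge_zero[of c] unfolding R_def by linarith
    obtain k where "R' < 2 ^ k" using real_arch_pow[of 2 R'] by auto
    also have "2 ^ k * 1 \<le> 2 ^ k * cmod ((antiquad c ^^ N) (\<Psi> u))" using N1 by (intro mult_left_mono) auto
    also have "\<dots> \<le> cmod ((antiquad c ^^ (k + N)) (\<Psi> u))"
      using antiquad_escape[of c "(antiquad c ^^ N) (\<Psi> u)" k] N by (simp add: R_def funpow_add)
    finally have big: "R' < cmod ((antiquad c ^^ (k + N)) (\<Psi> u))" by simp
    have "isCont (antiquad c ^^ (k + N)) (\<Psi> u)"
      using continuous_on_antiquad_iterate[of UNIV "\<lambda>_. c" "\<lambda>z. z" "k + N"]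
      by (simp add: continuous_on_eq_continuous_at)
    then have "(\<lambda>j. cmod ((antiquad c ^^ (k + N)) (\<psi> (r j) u))) \<longlonglongrightarrow> cmod ((antiquad c ^^ (k + N)) (\<Psi> u))"
      by (intro tendsto_norm isCont_tendsto_compose[OF _ ptw[OF u]])
    then have "\<forall>\<^sub>F j in sequentially. R' < cmod ((antiquad c ^^ (k + N)) (\<psi> (r j) u))"
      using big by (rule order_tendstoD(1))
    moreover have "\<forall>\<^sub>F j in sequentially. k + N \<le> j" by (rule eventually_ge_at_top)
    ultimately have "\<forall>\<^sub>F j in sequentially. False"
    proof eventually_elim
      case (elim j)
      let ?v = "(antiquad c ^^ (k + N)) (\<psi> (r j) u)"
      have "k + N \<le> n (r j)" using elim(2) nj[of "r j"] seq_suble[OF r, of j] by linarith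
      then have "(antiquad c ^^ (n (r j) - (k + N))) ?v = (antiquad c ^^ n (r j)) (\<psi> (r j) u)"
        by (rule funpow_diff_apply)
      also have "\<dots> = u" by (rule \<psi>(3)[OF u])
      finally have "cmod ?v \<le> R'" using escape R'(1)[OF u] by metis
      then show ?case using elim(1) by simp
    qed
    then show False by simp
  qed
  have \<Psi>y: "\<Psi> y = z"
  proof -
    obtain d where d: "0 < d" "cball y d \<subseteq> W" using W(1,4) open_contains_cball by blast
    have ul: "uniform_limit (cball y d) (\<psi> \<circ> r) \<Psi> sequentially" by (rule unif) (use d in auto)
    have Yr: "(\<lambda>j. Y (r j)) \<longlonglongrightarrow> y" using LIMSEQ_subseq_LIMSEQ[OF Ylim r] by (simp add: comp_def)
    have ct: "continuous_on (cball y d) \<Psi>"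
      using \<Psi> d(2) holomorphic_on_imp_continuous_on holomorphic_on_subset by blast
    have ev: "\<forall>\<^sub>F j in sequentially. Y (r j) \<in> cball y d"
      using tendstoD[OF Yr d(1)] by eventually_elim (simp add: dist_commute)
    have "y \<in> cball y d" using d(1) by simp
    from uniform_limit_moving_point[OF ul filterlim_ident ct Yr this ev]
    have "(\<lambda>j. \<psi> (r j) (Y (r j))) \<longlonglongrightarrow> \<Psi> y" by (simp only: comp_apply)
    then show ?thesis unfolding \<psi>(2) by (simp add: LIMSEQ_const_iff)
  qed
  have "\<Psi> e \<in> interior (filled_julia c)"
  proof (cases "\<Psi> constant_on W")
    case True
    then show ?thesis using W(4,5) \<Psi>y z by (auto simp: constant_on_def)
  next
    case False
    have "open (\<Psi> ` W)"
      using open_mapping_thm[OF \<Psi> W(1) convex_connected[OF W(2)] W(1) _ False] by blast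
    then show ?thesis using \<Psi>K W(5) interior_maximal[of "\<Psi> ` W" "filled_julia c"] by blast
  qed
  then have "\<forall>\<^sub>F j in sequentially. \<psi> (r j) e \<in> interior (filled_julia c)"
    using topological_tendstoD[OF ptw[OF W(5)] open_interior] by blast
  then obtain j where "\<psi> (r j) e \<in> filled_julia c"
    using interior_subset eventually_sequentially by (metis (no_types, lifting) order_refl subsetD)
  then have "(antiquad c ^^ n (r j)) (\<psi> (r j) e) \<in> filled_julia c"
    by (simp add: antiquad_iterate_in_filled_julia_iff)
  then have "e \<in> filled_julia c" using \<psi>(3)[OF W(5)] by simp
  then have "cmod ((antiquad c ^^ 0) e) \<le> R" unfolding filled_julia_iff R_def by blast
  then show False using e by simp
qed

section \<open>Misiurewicz parameters\<close>

text \<open>The form in which the Misiurewicz condition is used. Here \<open>q\<close> is twice the period, so that the return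
map is holomorphic, and the orbit of \<open>c\<close> is periodic from the index \<open>m\<close> on. By \<open>antisym\<close> the
points of the orbit of 0 with indices \<open>m\<close> and \<open>m + q\<close> are the two different preimages of a common
value; this is the relation that is differentiated with respect to the parameter.\<close>
locale misiurewicz_orbit =
  fixes c :: complex and m q :: nat
  assumes m_pos: "0 < m" and q_pos: "0 < q" and q_even: "even q"
    and periodic: "\<And>n. m \<le> n \<Longrightarrow> (antiquad c ^^ (n + q)) c = (antiquad c ^^ n) c"
    and nonzero: "\<And>n. (antiquad c ^^ n) c \<noteq> 0"
    and antisym: "(antiquad c ^^ (m + q)) 0 = - (antiquad c ^^ m) 0"
    and repelling: "\<And>n. m \<le> n \<Longrightarrow> 1 < cmod (tangent c ((antiquad c ^^ n) c) 1 0 q)"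

lemma antiquad_iterate_has_derivative:
  "((antiquad c ^^ n) has_derivative (\<lambda>v. tangent c z v 0 n)) (at z)"
proof (induction n)
  case (Suc n)
  have 1: "((\<lambda>z. cnj ((antiquad c ^^ n) z)) has_derivative (\<lambda>v. cnj (tangent c z v 0 n))) (at z)"
    by (rule bounded_linear.has_derivative[OF bounded_linear_cnj Suc])
  have 2: "(antiquad c ^^ Suc n) = (\<lambda>z. cnj ((antiquad c ^^ n) z) * cnj ((antiquad c ^^ n) z) + c)"
    by (rule ext) (simp add: antiquad_def power2_eq_square)
  show ?case unfolding 2
    by (rule has_derivative_eq_rhs[OF has_derivative_add[OF has_derivative_mult[OF 1 1] has_derivative_const]])
       (auto simp: algebra_simps)
qed (simp add: id_def)

text \<open>Both the derivative of a holomorphic iterate and that of the conjugate of an antiholomorphic one are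
determined by the real derivative.\<close>
lemma deriv_modulus_eq_tangent: "deriv_modulus c n z = cmod (tangent c z 1 0 n)"
proof (cases "(antiquad c ^^ n) holomorphic_on UNIV")
  case True
  then have "((antiquad c ^^ n) has_field_derivative deriv (antiquad c ^^ n) z) (at z)"
    by (rule holomorphic_derivI) auto
  then have "((antiquad c ^^ n) has_derivative (\<lambda>v. deriv (antiquad c ^^ n) z * v)) (at z)"
    by (simp add: has_field_derivative_def)
  from has_derivative_unique[OF this antiquad_iterate_has_derivative]
  have "deriv (antiquad c ^^ n) z * 1 = tangent c z 1 0 n" by metis
  then show ?thesis using True by (simp add: deriv_modulus_def)
next
  case False
  let ?f = "\<lambda>w. cnj ((antiquad c ^^ n) w)"
  have "?f holomorphic_on UNIV" using False holomorphic_antiquad_iterate by blast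
  then have "(?f has_field_derivative deriv ?f z) (at z)"
    by (rule holomorphic_derivI) auto
  then have 1: "(?f has_derivative (\<lambda>v. deriv ?f z * v)) (at z)"
    by (simp add: has_field_derivative_def)
  have 2: "(?f has_derivative (\<lambda>v. cnj (tangent c z v 0 n))) (at z)"
    by (rule bounded_linear.has_derivative[OF bounded_linear_cnj antiquad_iterate_has_derivative])
  have "deriv ?f z * 1 = cnj (tangent c z 1 0 n)" using has_derivative_unique[OF 1 2] by metis
  then show ?thesis using False by (simp add: deriv_modulus_def)
qed

text \<open>The multiplier is the product of \<open>2 * cmod (x i)\<close> over one period, the same from every starting
point of the cycle. Since it is not 0 the critical point is not on the cycle, so \<open>c\<close> is not
periodic; together with the minimality of \<open>l\<close> this leaves only the opposite sign for the two preimages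
of \<open>x l\<close>.\<close>
lemma misiurewicz_imp_orbit:
  assumes "misiurewicz c" shows "\<exists>m q. misiurewicz_orbit c m q"
proof -
  define x where "x n = (antiquad c ^^ n) c" for n
  obtain l p where l: "1 \<le> l" and p: "1 \<le> p" and rel: "x l = x (l + p)"
    and min: "\<And>l' p'. 1 \<le> l' \<Longrightarrow> 1 \<le> p' \<Longrightarrow> x l' = x (l' + p') \<Longrightarrow> l \<le> l' \<and> p \<le> p'"
    and rep: "1 < deriv_modulus c p (x l)"
    using assms unfolding misiurewicz_def x_def by blast
  have xadd: "x (n + k) = (antiquad c ^^ n) (x k)" for n k by (simp add: x_def funpow_add)
  have per: "x (n + p) = x n" if "l \<le> n" for n
    using xadd[of "n - l" l] xadd[of "n - l" "l + p"] rel that by (simp add: add.commute)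
  have per2: "x (n + 2 * p) = x n" if "l \<le> n" for n
    using per[of n] per[of "n + p"] that by (simp add: mult_2 add.assoc)
  define A where "A n = (\<Prod>i<p. 2 * cmod (x (n + i)))" for n
  have tA: "cmod (tangent c (x n) v 0 p) = A n * cmod v" for n v
    unfolding norm_tangent A_def xadd[symmetric] by (simp add: add.commute)
  have Al: "1 < A l" using rep tA[of l 1] by (simp add: deriv_modulus_eq_tangent)
  have AS: "A (Suc n) = A n" if "l \<le> n" for n
  proof -
    have "A n * (2 * cmod (x (n + p))) = (2 * cmod (x n)) * A (Suc n)"
      using prod.lessThan_Suc[of "\<lambda>i. 2 * cmod (x (n + i))" p]
        prod.lessThan_Suc_shift[of "\<lambda>i. 2 * cmod (x (n + i))" p] by (simp add: A_def)
    then have *: "A n * (2 * cmod (x n)) = (2 * cmod (x n)) * A (Suc n)" using per[OF that] by simp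
    show ?thesis
    proof (cases "x n = 0")
      case True
      have "A n = 0" using p True by (auto simp: A_def intro!: bexI[of _ 0])
      moreover have "Suc n + (p - 1) = n + p" using p by simp
      then have "x (Suc n + (p - 1)) = 0" using per[OF that] True by simp
      then have "A (Suc n) = 0" unfolding A_def using p by (intro prod_zero bexI[of _ "p - 1"]) auto
      ultimately show ?thesis by simp
    next
      case False
      then have "2 * cmod (x n) \<noteq> 0" by simp
      moreover have "2 * cmod (x n) * A (Suc n) = 2 * cmod (x n) * A n"
        using * by (simp only: mult.commute)
      ultimately show ?thesis by (metis mult_cancel_left)
    qed
  qed
  have An: "A n = A l" if "l \<le> n" for n
    using that by (induction rule: dec_induct) (auto simp: AS)
  have nz_tail: "x n \<noteq> 0" if "l \<le> n" for n
  proof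
    assume "x n = 0"
    then have "A n = 0" using p by (auto simp: A_def intro!: bexI[of _ 0])
    then show False using An[OF that] Al by simp
  qed
  have nz: "x n \<noteq> 0" for n
  proof
    assume n: "x n = 0"
    have ret: "x (k + (n + 1)) = x k" for k
    proof -
      have "x (n + 1) = c" using xadd[of 1 n] n by (simp add: add.commute antiquad_def)
      then show ?thesis unfolding xadd by (simp add: x_def)
    qed
    have "x (n + j * (n + 1)) = 0" for j
    proof (induction j)
      case (Suc j)
      then show ?case using ret[of "n + j * (n + 1)"] by (simp add: algebra_simps)
    qed (simp add: n)
    moreover have "l \<le> n + l * (n + 1)" by simp
    ultimately show False using nz_tail by blast
  qed
  have crit: "(antiquad c ^^ Suc k) 0 = x k" for k by (simp add: x_def funpow_swap1 antiquad_def)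
  have anti: "x (l - 1 + 2 * p) = - x (l - 1)"
  proof -
    have S: "x (Suc k) = (cnj (x k))\<^sup>2 + c" for k by (simp add: x_def antiquad_def)
    have "x (Suc (l - 1 + 2 * p)) = x (Suc (l - 1))" using per2[of l] l by simp
    then have "(x (l - 1 + 2 * p))\<^sup>2 = (x (l - 1))\<^sup>2"
      unfolding S by (metis add_right_cancel complex_cnj_cnj complex_cnj_power)
    then have "x (l - 1 + 2 * p) = x (l - 1) \<or> x (l - 1 + 2 * p) = - x (l - 1)"
      by (simp add: power2_eq_iff)
    moreover have "x (l - 1 + 2 * p) \<noteq> x (l - 1)"
    proof
      assume eq: "x (l - 1 + 2 * p) = x (l - 1)"
      show False
      proof (cases "l = 1")
        case True
        have "x (Suc (2 * p - 1)) = c" using eq True p by (simp add: x_def)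
        then have "x (2 * p - 1) = 0" unfolding S by simp
        then show False using nz by blast
      next
        case False
        then have "l \<le> l - 1" using min[OF _ _ eq[symmetric]] l p by auto
        then show False using l by simp
      qed
    qed
    ultimately show ?thesis by blast
  qed
  have "misiurewicz_orbit c l (2 * p)"
  proof
    show "(antiquad c ^^ (l + 2 * p)) 0 = - (antiquad c ^^ l) 0"
      using anti crit[of "l - 1"] crit[of "l - 1 + 2 * p"] l by simp
    fix n assume n: "l \<le> n"
    have "tangent c (x n) 1 0 (2 * p) = tangent c (x (p + n)) (tangent c (x n) 1 0 p) 0 p"
      using tangent_cocycle[of c "x n" 1 0 p p] xadd[of p n] by (simp add: mult_2)
    then have "cmod (tangent c (x n) 1 0 (2 * p)) = A l * A l"
      using tA[of "p + n"] tA[of n 1] An[of n] An[of "p + n"] n by simp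
    moreover have "1 * 1 < A l * A l" using Al by (intro mult_strict_mono) auto
    ultimately show "1 < cmod (tangent c ((antiquad c ^^ n) c) 1 0 (2 * p))" by (simp add: x_def)
  qed (use l p per2 nz in \<open>auto simp: x_def\<close>)
  then show ?thesis by blast
qed

context misiurewicz_orbit
begin

definition x :: "nat \<Rightarrow> complex" where "x n = (antiquad c ^^ n) c"

lemma x_add: "x (n + k) = (antiquad c ^^ n) (x k)"
  by (simp add: x_def funpow_add)

lemma x_periodic: "m \<le> n \<Longrightarrow> x (n + j * q) = x n"
proof (induction j)
  case (Suc j)
  then show ?case using periodic[of "n + j * q"] by (simp add: x_def algebra_simps)
qed simp

lemma finite_orbit: "finite (range x)"
proof -
  have "x n \<in> x ` {..<m + q}" for n
  proof (induction n rule: less_induct)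
    case (less n)
    show ?case
    proof (cases "n < m + q")
      case False
      then have "x n = x (n - q)" using x_periodic[of "n - q" 1] by simp
      then show ?thesis using less[of "n - q"] False q_pos by simp
    qed simp
  qed
  then have "range x \<subseteq> x ` {..<m + q}" by blast
  then show ?thesis using finite_surj by blast
qed

lemma parameter_tangent_eq_critical: "tangent c 0 0 \<delta> (Suc n) = tangent c c \<delta> \<delta> n"
  using tangent_cocycle[of c 0 0 \<delta> 1 n] by (simp add: antiquad_def)

text \<open>Past the index \<open>m\<close> a coincidence of derivatives can be pulled back along the orbit, since the points
there are nonzero; at the index \<open>m\<close> it is the statement about the critical orbit.\<close>
lemma transversality:
  assumes "m \<le> n" and "tangent c c \<delta> \<delta> (n + q) = tangent c c \<delta> \<delta> n"
  shows "\<delta> = 0"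
proof -
  have "tangent c c \<delta> \<delta> (m + q) = tangent c c \<delta> \<delta> m"
    using assms
  proof (induction rule: dec_induct)
    case (step k)
    have "2 * cnj (x k) * cnj (tangent c c \<delta> \<delta> (k + q)) = 2 * cnj (x k) * cnj (tangent c c \<delta> \<delta> k)"
      using step.prems periodic[OF step.hyps(1)] by (simp add: x_def)
    then have "tangent c c \<delta> \<delta> (k + q) = tangent c c \<delta> \<delta> k"
      using nonzero[of k] by (simp add: x_def)
    then show ?case by (rule step.IH)
  qed simp
  then have "tangent c 0 0 \<delta> (Suc (m + q)) = tangent c 0 0 \<delta> (Suc m)"
    unfolding parameter_tangent_eq_critical .
  then have "2 * cnj (- (antiquad c ^^ m) 0) * cnj (tangent c 0 0 \<delta> (m + q))
      = 2 * cnj ((antiquad c ^^ m) 0) * cnj (tangent c 0 0 \<delta> m)"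
    by (simp add: antisym)
  moreover have "2 * (cnj ((antiquad c ^^ m) 0) * cnj (tangent c 0 0 \<delta> (m + q) + tangent c 0 0 \<delta> m))
      = 2 * cnj ((antiquad c ^^ m) 0) * cnj (tangent c 0 0 \<delta> m)
        - 2 * cnj (- (antiquad c ^^ m) 0) * cnj (tangent c 0 0 \<delta> (m + q))"
    by (simp add: algebra_simps)
  ultimately have "cnj ((antiquad c ^^ m) 0) * cnj (tangent c 0 0 \<delta> (m + q) + tangent c 0 0 \<delta> m) = 0"
    by (metis cancel_comm_monoid_add_class.diff_cancel mult_eq_0_iff zero_neq_numeral)
  moreover obtain m' where m': "m = Suc m'" using m_pos gr0_implies_Suc by blast
  have "(antiquad c ^^ m) 0 \<noteq> 0"
    using nonzero[of m'] by (simp add: m' funpow_swap1 antiquad_def)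
  ultimately have "tangent c 0 0 \<delta> (m + q) + tangent c 0 0 \<delta> m = 0"
    by (metis complex_cnj_zero_iff mult_eq_0_iff)
  then show ?thesis using transversality_critical[OF q_pos] antisym unfolding m' by blast
qed

text \<open>An even index in the periodic part of the orbit: reaching the cycle by an even number of steps makes
the passage from \<open>c\<close> to \<open>b\<close> holomorphic.\<close>
definition M :: nat where "M = 2 * m"
definition b :: complex where "b = x M"
definition \<mu> :: complex where "\<mu> = tangent c b 1 0 q"
definition L :: "complex \<Rightarrow> complex" where "L \<delta> = tangent c b 0 \<delta> q"

lemma mu: "1 < cmod \<mu>" "\<mu> \<noteq> 0" "\<mu> - 1 \<noteq> 0"
proof -
  show 1: "1 < cmod \<mu>" unfolding \<mu>_def b_def x_def M_def by (rule repelling) simp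
  then show "\<mu> \<noteq> 0" "\<mu> - 1 \<noteq> 0" by auto
qed

lemma b_fixed: "(antiquad c ^^ q) b = b"
  using x_periodic[of M 1] x_add[of q M] by (simp add: b_def M_def add.commute)

lemma tangent_b: "tangent c b v \<delta> q = \<mu> * v + L \<delta>"
  using tangent_split[of c b v \<delta> q] tangent_parity(1)[OF q_even, of c b v]
  by (simp add: \<mu>_def L_def mult.commute)

lemma perturbed_linearization:
  "\<exists>\<phi>. \<phi> holomorphic_on UNIV \<and> \<not> \<phi> constant_on UNIV \<and>
     (\<forall>B k0 (S :: complex set) s \<delta> u. 0 < B \<longrightarrow> (\<forall>k\<ge>k0. \<forall>w\<in>S. cmod (s w) \<le> B \<and> cmod (\<delta> k w) \<le> B * (1 / cmod \<mu>) ^ k \<and>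
         cmod (u k w - b + L (\<delta> k w) / (\<mu> - 1) - s w / \<mu> ^ k) \<le> B * ((1 / cmod \<mu>) ^ k)\<^sup>2) \<longrightarrow>
       uniform_limit S (\<lambda>k w. (antiquad (c + \<delta> k w) ^^ (q * k)) (u k w)) (\<lambda>w. \<phi> (s w)) sequentially)"
proof -
  obtain C1 where C1: "0 \<le> C1" "\<And>v \<delta>. cmod v \<le> 1 \<Longrightarrow> cmod \<delta> \<le> 1 \<Longrightarrow>
     cmod ((antiquad (c + \<delta>) ^^ q) (b + v) - (antiquad c ^^ q) b - tangent c b v \<delta> q)
       \<le> C1 * (cmod v + cmod \<delta>)\<^sup>2"
    using antiquad_iterate_expansion[where c = c and n = q and z = b] by blast
  obtain C2 where C2: "0 \<le> C2" "\<And>v \<delta>. cmod (tangent c b v \<delta> q) \<le> C2 * (cmod v + cmod \<delta>)"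
    using tangent_bound[of c b q] by blast
  let ?F = "\<lambda>\<delta>. antiquad (c + \<delta>) ^^ q"
  interpret P: perturbed_repelling_point ?F b \<mu> L "C1 + C2"
  proof
    show "1 < cmod \<mu>" by (rule mu)
    show "cmod (L \<delta>) \<le> (C1 + C2) * cmod \<delta>" for \<delta>
    proof -
      have "cmod (L \<delta>) \<le> C2 * cmod \<delta>" using C2(2)[of 0 \<delta>] by (simp add: L_def)
      also have "\<dots> \<le> (C1 + C2) * cmod \<delta>" using C1(1) by (intro mult_right_mono) auto
      finally show ?thesis .
    qed
    show "cmod ((antiquad (c + \<delta>) ^^ q) (b + v) - b - \<mu> * v - L \<delta>) \<le> (C1 + C2) * (cmod v + cmod \<delta>)\<^sup>2"
      if "cmod v \<le> 1" "cmod \<delta> \<le> 1" for v \<delta>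
    proof -
      have "cmod ((antiquad (c + \<delta>) ^^ q) (b + v) - b - \<mu> * v - L \<delta>) \<le> C1 * (cmod v + cmod \<delta>)\<^sup>2"
        using C1(2)[OF that] by (simp add: b_fixed tangent_b algebra_simps)
      also have "\<dots> \<le> (C1 + C2) * (cmod v + cmod \<delta>)\<^sup>2" using C2(1) by (intro mult_right_mono) auto
      finally show ?thesis .
    qed
    show "continuous_on UNIV (\<lambda>p. ((antiquad (c + fst p) ^^ q) ^^ n) (snd p))" for n
      unfolding funpow_mult by (intro continuous_intros)
    show "(antiquad (c + 0) ^^ q) holomorphic_on UNIV"
      using holomorphic_antiquad_iterate(1)[OF q_even, of c] by simp
  qed
  show ?thesis
  proof (intro exI[of _ P.linearizer] conjI allI impI)
    fix B k0 and S :: "complex set" and s \<delta> u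
    assume B: "0 < B" and adm: "\<forall>k\<ge>k0. \<forall>w\<in>S. cmod (s w) \<le> B \<and> cmod (\<delta> k w) \<le> B * (1 / cmod \<mu>) ^ k \<and>
         cmod (u k w - b + L (\<delta> k w) / (\<mu> - 1) - s w / \<mu> ^ k) \<le> B * ((1 / cmod \<mu>) ^ k)\<^sup>2"
    have "uniform_limit S (\<lambda>k w. ((antiquad (c + \<delta> k w) ^^ q) ^^ k) (u k w)) (\<lambda>w. P.linearizer (s w)) sequentially"
      by (rule P.perturbed_uniform_limit[OF B, of k0]) (use adm in \<open>auto simp: P.admissible_def P.\<eta>_def\<close>)
    then show "uniform_limit S (\<lambda>k w. (antiquad (c + \<delta> k w) ^^ (q * k)) (u k w)) (\<lambda>w. P.linearizer (s w)) sequentially"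
      by (simp add: funpow_mult)
  qed (rule P.linearizer_holomorphic P.linearizer_nonconstant)+
qed

text \<open>If \<open>b\<close> were interior, every value of the Koenigs function would be a limit of points of the filled
Julia set, so this entire function would be bounded, against Liouville's theorem.\<close>
lemma orbit_notin_interior: "x n \<notin> interior (filled_julia c)"
proof
  assume "x n \<in> interior (filled_julia c)"
  then have "(antiquad c ^^ (M + n * q - n)) (x n) \<in> interior (filled_julia c)"
    by (rule interior_filled_julia_iterate)
  moreover have "n \<le> M + n * q" using q_pos by (cases q) auto
  then have "(antiquad c ^^ (M + n * q - n)) (x n) = b"
    using x_add[of "M + n * q - n" n] x_periodic[of M n] by (simp add: b_def M_def)
  ultimately have b: "b \<in> interior (filled_julia c)" by simp
  obtain \<phi> where hol: "\<phi> holomorphic_on UNIV" and nc: "\<not> \<phi> constant_on UNIV"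
    and lim: "\<And>B k0 (S :: complex set) s \<delta> u. 0 < B \<Longrightarrow> (\<forall>k\<ge>k0. \<forall>w\<in>S. cmod (s w) \<le> B \<and> cmod (\<delta> k w) \<le> B * (1 / cmod \<mu>) ^ k \<and>
         cmod (u k w - b + L (\<delta> k w) / (\<mu> - 1) - s w / \<mu> ^ k) \<le> B * ((1 / cmod \<mu>) ^ k)\<^sup>2) \<Longrightarrow>
       uniform_limit S (\<lambda>k w. (antiquad (c + \<delta> k w) ^^ (q * k)) (u k w)) (\<lambda>w. \<phi> (s w)) sequentially"
    using perturbed_linearization by blast
  have L0: "L 0 = 0"
    using tangent_scaleR[of c b 0 0 0 q] by (simp add: L_def)
  have "cmod (\<phi> w) \<le> 2 + cmod c" for w
  proof -
    have "uniform_limit {w} (\<lambda>k w. (antiquad (c + 0) ^^ (q * k)) (b + w / \<mu> ^ k)) (\<lambda>w. \<phi> w) sequentially"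
      by (rule lim[of "cmod w + 1" 0 _ "\<lambda>w. w" "\<lambda>_ _. 0"]) (use L0 in \<open>auto simp: add_nonneg_pos\<close>)
    then have 1: "(\<lambda>k. (antiquad c ^^ (q * k)) (b + w / \<mu> ^ k)) \<longlonglongrightarrow> \<phi> w"
      by (simp add: tendsto_uniform_limitI)
    have "(\<lambda>k. b + w * (1 / \<mu>) ^ k) \<longlonglongrightarrow> b + w * 0"
      using mu(1) by (intro tendsto_intros LIMSEQ_power_zero) (auto simp: norm_divide divide_less_eq_1)
    then have "(\<lambda>k. b + w / \<mu> ^ k) \<longlonglongrightarrow> b" by (simp add: power_one_over)
    then have "\<forall>\<^sub>F k in sequentially. b + w / \<mu> ^ k \<in> interior (filled_julia c)"
      using b by (intro topological_tendstoD) auto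
    then have "\<forall>\<^sub>F k in sequentially. (antiquad c ^^ (q * k)) (b + w / \<mu> ^ k) \<in> filled_julia c"
      by eventually_elim (use interior_subset antiquad_iterate_in_filled_julia_iff in blast)
    then have "\<phi> w \<in> filled_julia c"
      using Lim_in_closed_set[OF closed_filled_julia _ _ 1] by simp
    then have "cmod ((antiquad c ^^ 0) (\<phi> w)) \<le> 2 + cmod c" unfolding filled_julia_iff by blast
    then show ?thesis by simp
  qed
  then have "bounded (range \<phi>)" unfolding bounded_iff by blast
  then show False using Liouville_theorem[OF hol] nc by blast
qed

text \<open>Near a point of the cycle the return map expands distances at least by the factor
\<open>(cmod \<nu> + 1) / 2\<close>, so an orbit that starts close to this point, but not at it, leaves every small disk,
and the step that leaves lands in an annulus.\<close>
lemma exit_near_orbit: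
  assumes n: "m \<le> n" and z: "z \<in> interior (filled_julia c)"
    and d: "0 < d" "d \<le> 1" "2 * C * d \<le> cmod \<nu> - 1" "0 \<le> C" and \<nu>: "1 < cmod \<nu>"
    and exp: "\<And>v. cmod v \<le> 1 \<Longrightarrow> cmod ((antiquad c ^^ q) (x n + v) - x n - \<nu> * v) \<le> C * (cmod v)\<^sup>2"
    and close: "dist z (x n) < d"
  shows "\<exists>i. d \<le> dist ((antiquad c ^^ (q * i)) z) (x n) \<and>
     dist ((antiquad c ^^ (q * i)) z) (x n) \<le> (cmod \<nu> + C) * d"
proof -
  define y where "y i = (antiquad c ^^ (q * i)) z" for i
  define r where "r i = dist (y i) (x n)" for i
  have r0: "0 < r 0" "r 0 < d" using z close orbit_notin_interior[of n] by (auto simp: r_def y_def)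
  have step: "r (Suc i) \<le> (cmod \<nu> + C) * r i" "(cmod \<nu> + 1) / 2 * r i \<le> r (Suc i)" if i: "r i < d" for i
  proof -
    define v where "v = y i - x n"
    have v: "cmod v = r i" "y i = x n + v" by (auto simp: v_def r_def dist_norm)
    have "y (Suc i) = (antiquad c ^^ q) (y i)" by (simp add: y_def funpow_add)
    then have e: "cmod (y (Suc i) - x n - \<nu> * v) \<le> C * (r i)\<^sup>2"
      using exp[of v] i d(2) v by simp
    have ri: "0 \<le> r i" by (simp add: r_def)
    have "C * (r i)\<^sup>2 \<le> (C * d) * r i"
      using i ri d(4) by (simp add: power2_eq_square mult.assoc mult_left_mono mult_right_mono)
    also have "\<dots> \<le> (cmod \<nu> - 1) / 2 * r i" using d(3) ri by (intro mult_right_mono) auto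
    finally have e1: "C * (r i)\<^sup>2 \<le> (cmod \<nu> - 1) / 2 * r i" .
    have "C * (r i)\<^sup>2 \<le> C * r i"
      using i ri d(2,4) by (simp add: power2_eq_square mult_left_le mult_left_mono)
    moreover have "r (Suc i) \<le> cmod (\<nu> * v) + cmod (y (Suc i) - x n - \<nu> * v)"
      unfolding r_def dist_norm using norm_triangle_ineq[of "\<nu> * v" "y (Suc i) - x n - \<nu> * v"] by simp
    ultimately show "r (Suc i) \<le> (cmod \<nu> + C) * r i" using e v(1) by (simp add: norm_mult distrib_right)
    have "cmod (\<nu> * v) - cmod (y (Suc i) - x n - \<nu> * v) \<le> r (Suc i)"
      unfolding r_def dist_norm using norm_triangle_ineq2[of "\<nu> * v" "\<nu> * v - (y (Suc i) - x n)"]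
      by (simp add: norm_minus_commute)
    then have "cmod \<nu> * r i - (cmod \<nu> - 1) / 2 * r i \<le> r (Suc i)" using e e1 v(1) by (simp add: norm_mult)
    then show "(cmod \<nu> + 1) / 2 * r i \<le> r (Suc i)" by (simp add: field_simps)
  qed
  have ex: "\<exists>i. d \<le> r i"
  proof (rule ccontr)
    assume "\<not> ?thesis"
    then have lt: "r i < d" for i by (simp add: not_le)
    have grow: "((cmod \<nu> + 1) / 2) ^ i * r 0 \<le> r i" for i
    proof (induction i)
      case (Suc i)
      have "(cmod \<nu> + 1) / 2 * (((cmod \<nu> + 1) / 2) ^ i * r 0) \<le> (cmod \<nu> + 1) / 2 * r i"
        using Suc \<nu> by (intro mult_left_mono) auto
      also have "\<dots> \<le> r (Suc i)" by (rule step(2)[OF lt])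
      finally show ?case by (simp add: mult.assoc)
    qed simp
    obtain i where "d / r 0 < ((cmod \<nu> + 1) / 2) ^ i"
      using real_arch_pow[of "(cmod \<nu> + 1) / 2" "d / r 0"] \<nu> by auto
    then have "d < ((cmod \<nu> + 1) / 2) ^ i * r 0" using r0 by (simp add: divide_less_eq)
    then show False using grow[of i] lt[of i] by linarith
  qed
  define i where "i = (LEAST i. d \<le> r i)"
  have i: "d \<le> r i" unfolding i_def by (rule LeastI_ex[OF ex])
  have i_min: "r j < d" if "j < i" for j
    using not_less_Least[OF that[unfolded i_def]] by (simp only: not_le)
  have "i \<noteq> 0" using i r0(2) by (metis not_le)
  then obtain j where j: "i = Suc j" by (cases i) auto
  have rj: "r j < d" by (rule i_min) (simp add: j)
  have "r i \<le> (cmod \<nu> + C) * r j" unfolding j by (rule step(1)[OF rj])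
  also have "\<dots> \<le> (cmod \<nu> + C) * d" using rj \<nu> d(4) by (intro mult_left_mono) auto
  finally have "d \<le> r i \<and> r i \<le> (cmod \<nu> + C) * d" using i by simp
  then show ?thesis unfolding r_def y_def by (rule exI)
qed

text \<open>If all accumulation points were in the orbit of \<open>c\<close>, one of them would be in the cycle. By
\<open>exit_near_orbit\<close> the orbit of \<open>z\<close> then visits infinitely often an annulus around it, chosen so small
that it contains no point of the orbit of \<open>c\<close>.\<close>
lemma accumulation_off_orbit:
  assumes z: "z \<in> interior (filled_julia c)"
  shows "\<exists>y t. y \<notin> range x \<and> (\<forall>j :: nat. j \<le> t j) \<and> (\<lambda>j. (antiquad c ^^ (2 * t j)) z) \<longlonglongrightarrow> y"
proof (rule ccontr)
  assume no: "\<not> ?thesis"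
  define Y where "Y k = (antiquad c ^^ (2 * k)) z" for k
  have in_orbit: "y \<in> range x" if t: "\<And>j :: nat. j \<le> t j" and lim: "(\<lambda>j. Y (t j)) \<longlonglongrightarrow> y" for y t
  proof (rule ccontr)
    assume y: "y \<notin> range x"
    show False
      by (rule notE[OF no], intro exI[of _ y], intro exI[of _ t] conjI allI y t lim[unfolded Y_def])
  qed
  have Yint: "Y k \<in> interior (filled_julia c)" for k
    unfolding Y_def using z by (rule interior_filled_julia_iterate)
  have sub: "\<exists>y t'. (\<forall>j :: nat. j \<le> t' j) \<and> (\<lambda>j. Y (t' j)) \<longlonglongrightarrow> y \<and> (\<forall>K. closed K \<and> (\<forall>j. Y (t j) \<in> K) \<longrightarrow> y \<in> K)"
    if t: "\<And>j. j \<le> t j" for t :: "nat \<Rightarrow> nat"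
  proof -
    have zK: "\<And>n. cmod ((antiquad c ^^ n) z) \<le> 2 + cmod c"
      using z interior_subset filled_julia_iff by blast
    then have "\<forall>j. Y (t j) \<in> cball 0 (2 + cmod c)" by (simp add: Y_def)
    then obtain y r where r: "strict_mono (r :: nat \<Rightarrow> nat)" "((\<lambda>j. Y (t j)) \<circ> r) \<longlonglongrightarrow> y"
      using compact_cball[of "0::complex" "2 + cmod c"] unfolding compact_def by metis
    have "j \<le> t (r j)" for j using t[of "r j"] seq_suble[OF r(1), of j] by linarith
    moreover have "y \<in> K" if "closed K" "\<forall>j. Y (t j) \<in> K" for K
      by (rule closed_sequentially[OF that(1) _ r(2)]) (use that(2) in auto)
    moreover have "(\<lambda>j. Y (t (r j))) \<longlonglongrightarrow> y" using r(2) by (simp only: comp_def)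
    ultimately show ?thesis
      by (intro exI[of _ y], intro exI[of _ "\<lambda>j. t (r j)"]) blast
  qed
  obtain y0 t0 where t0: "\<And>j :: nat. j \<le> t0 j" "(\<lambda>j. Y (t0 j)) \<longlonglongrightarrow> y0" using sub[of id] by auto
  from in_orbit[OF this] obtain i where i: "y0 = x i" by blast
  define n where "n = 2 * m + i"
  have n: "m \<le> n" by (simp add: n_def)
  have "isCont (antiquad c ^^ (2 * m)) y0"
    using continuous_on_antiquad_iterate[of UNIV "\<lambda>_. c" "\<lambda>z. z" "2 * m"]
    by (simp add: continuous_on_eq_continuous_at)
  then have "(\<lambda>j. (antiquad c ^^ (2 * m)) (Y (t0 j))) \<longlonglongrightarrow> (antiquad c ^^ (2 * m)) y0"
    by (rule isCont_tendsto_compose[OF _ t0(2)])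
  then have lim: "(\<lambda>j. Y (m + t0 j)) \<longlonglongrightarrow> x n"
    by (simp add: Y_def n_def i x_add funpow_add)
  define \<nu> where "\<nu> = tangent c (x n) 1 0 q"
  have \<nu>: "1 < cmod \<nu>" unfolding \<nu>_def x_def by (rule repelling[OF n])
  obtain C where C: "0 \<le> C" "\<And>v \<delta>. cmod v \<le> 1 \<Longrightarrow> cmod \<delta> \<le> 1 \<Longrightarrow>
     cmod ((antiquad (c + \<delta>) ^^ q) (x n + v) - (antiquad c ^^ q) (x n) - tangent c (x n) v \<delta> q)
       \<le> C * (cmod v + cmod \<delta>)\<^sup>2"
    using antiquad_iterate_expansion[where c = c and n = q and z = "x n"] by blast
  have fixn: "(antiquad c ^^ q) (x n) = x n"
    using x_periodic[OF n, of 1] x_add[of q n] by (simp add: add.commute)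
  have exp: "cmod ((antiquad c ^^ q) (x n + v) - x n - \<nu> * v) \<le> C * (cmod v)\<^sup>2" if "cmod v \<le> 1" for v
    using C(2)[OF that, of 0] tangent_parity(1)[OF q_even, of c "x n" v] by (simp add: fixn \<nu>_def mult.commute)
  obtain g where g: "0 < g" "\<And>p. p \<in> range x \<Longrightarrow> p \<noteq> x n \<Longrightarrow> g \<le> dist (x n) p"
    using finite_set_avoid[OF finite_orbit, of "x n"] by auto
  \<comment> \<open>The bounds say: the expansion is valid, the quadratic error takes at most half of the expansion, and the exit annulus stays within the gap \<open>g\<close> around \<open>x n\<close>.\<close>
  define d where "d = min 1 (min ((cmod \<nu> - 1) / (2 * (C + 1))) (g / (2 * (cmod \<nu> + C))))"
  have \<nu>C: "0 < cmod \<nu> + C" using \<nu> C(1) by linarith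
  have d: "0 < d" "d \<le> 1" "d \<le> (cmod \<nu> - 1) / (2 * (C + 1))" "d \<le> g / (2 * (cmod \<nu> + C))"
    using \<nu> C(1) g(1) \<nu>C by (auto simp: d_def)
  have d3: "2 * C * d \<le> cmod \<nu> - 1"
  proof -
    have "2 * C * d \<le> 2 * (C + 1) * d" using d(1) by simp
    also have "\<dots> \<le> cmod \<nu> - 1" using d(3) C(1) by (simp add: pos_le_divide_eq mult.commute)
    finally show ?thesis .
  qed
  have d4: "(cmod \<nu> + C) * d < g"
  proof -
    have "2 * ((cmod \<nu> + C) * d) \<le> g" using d(4) \<nu>C by (simp add: pos_le_divide_eq mult.commute mult.left_commute)
    moreover have "0 < (cmod \<nu> + C) * d" using \<nu>C d(1) by simp
    ultimately show ?thesis by linarith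
  qed
  have "\<forall>\<^sub>F j in sequentially. dist (Y (m + t0 j)) (x n) < d" using lim d(1) by (rule tendstoD)
  then obtain j0 where j0: "\<And>j. j0 \<le> j \<Longrightarrow> dist (Y (m + t0 j)) (x n) < d"
    unfolding eventually_sequentially by blast
  have "\<exists>k\<ge>j. d \<le> dist (Y k) (x n) \<and> dist (Y k) (x n) \<le> (cmod \<nu> + C) * d" for j
  proof -
    let ?k = "m + t0 (j0 + j)"
    obtain i where i: "d \<le> dist ((antiquad c ^^ (q * i)) (Y ?k)) (x n)"
        "dist ((antiquad c ^^ (q * i)) (Y ?k)) (x n) \<le> (cmod \<nu> + C) * d"
      using exit_near_orbit[OF n Yint d(1,2) d3 C(1) \<nu> exp j0[of "j0 + j"]] by auto
    obtain h where h: "q = 2 * h" using q_even by blast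
    have "Y (h * i + ?k) = (antiquad c ^^ (2 * (h * i))) (Y ?k)"
      by (simp add: Y_def distrib_left funpow_add)
    then have "(antiquad c ^^ (q * i)) (Y ?k) = Y (h * i + ?k)" by (simp add: h mult.assoc)
    moreover have "j \<le> h * i + ?k" using t0(1)[of "j0 + j"] by linarith
    ultimately show ?thesis using i by metis
  qed
  then obtain t1 where t1: "\<And>j. j \<le> t1 j" "\<And>j. Y (t1 j) \<in> {u. d \<le> dist u (x n) \<and> dist u (x n) \<le> (cmod \<nu> + C) * d}"
    by (metis (mono_tags, lifting) mem_Collect_eq)
  obtain y t where t: "\<And>j :: nat. j \<le> t j" "(\<lambda>j. Y (t j)) \<longlonglongrightarrow> y"
    and y: "\<And>K. closed K \<Longrightarrow> (\<And>j. Y (t1 j) \<in> K) \<Longrightarrow> y \<in> K"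
    using sub[OF t1(1)] by blast
  have "y \<in> {u. d \<le> dist u (x n) \<and> dist u (x n) \<le> (cmod \<nu> + C) * d}"
    by (rule y[OF _ t1(2)]) (intro closed_Collect_conj closed_Collect_le continuous_intros)
  then have yd: "d \<le> dist y (x n)" "dist y (x n) \<le> (cmod \<nu> + C) * d" by auto
  have "y \<notin> range x"
  proof
    assume "y \<in> range x"
    moreover have "y \<noteq> x n" using yd(1) d(1) by auto
    ultimately have "g \<le> dist (x n) y" by (rule g(2))
    then show False using yd(2) d4 by (simp add: dist_commute)
  qed
  then show False using in_orbit[OF t] by (rule notE)
qed

lemma interior_filled_julia_empty: "interior (filled_julia c) = {}"
proof (rule ccontr)
  assume "interior (filled_julia c) \<noteq> {}"
  then obtain z where z: "z \<in> interior (filled_julia c)" by blast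
  have rx: "x = (\<lambda>n. (antiquad c ^^ n) c)" by (rule ext) (rule x_def)
  from accumulation_off_orbit[OF z] obtain y t where
    yt: "y \<notin> range x \<and> (\<forall>j :: nat. j \<le> t j) \<and> (\<lambda>j. (antiquad c ^^ (2 * t j)) z) \<longlonglongrightarrow> y"
    by (elim exE)
  show False
  proof (rule no_interior_limit_off_critical_orbit)
    show "finite (range (\<lambda>n. (antiquad c ^^ n) c))" using finite_orbit unfolding rx .
    show "y \<notin> range (\<lambda>n. (antiquad c ^^ n) c)" using yt unfolding rx by (rule conjunct1)
    show "j \<le> t j" for j using yt by (elim conjE allE)
    show "(\<lambda>j. (antiquad c ^^ (2 * t j)) z) \<longlonglongrightarrow> y" using yt by (elim conjE)
  qed (rule z)
qed

lemma julia_eq_filled_julia: "julia c = filled_julia c"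
  unfolding julia_def frontier_def interior_filled_julia_empty closure_closed[OF closed_filled_julia]
  by simp

end

section \<open>Similarity of the tricorn and the Julia set\<close>

context misiurewicz_orbit
begin

text \<open>Both limits are instances of \<open>perturbed_linearization\<close> for starting points after \<open>M\<close> steps. In the
dynamical plane the parameter is fixed, and to first order the start is displaced by
\<open>A * \<rho> k * w\<close>, with \<open>A\<close> the
derivative of the first \<open>M\<close> steps at \<open>c\<close>. In the parameter plane the displacement from the moving
fixed point is \<open>H \<delta>\<close>, and \<open>\<delta>\<close> is chosen to make it equal to the same \<open>A * \<rho> k * w\<close>. Up to the factor
\<open>\<mu> - 1\<close> the map \<open>H\<close> is the derivative of the relation between the orbit points \<open>M\<close> and \<open>M + q\<close>, so it
is injective by \<open>transversality\<close>.\<close>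
lemma rescaling_limits:
  "\<exists>\<phi> h g \<rho>. \<phi> holomorphic_on UNIV \<and> \<not> \<phi> constant_on UNIV \<and> linear h \<and> linear g \<and>
     (\<forall>z. g (h z) = z) \<and> (\<forall>w. h (g w) = w) \<and> (\<forall>k. \<rho> k \<noteq> 0) \<and> \<rho> \<longlonglongrightarrow> 0 \<and>
     (\<forall>R>0. uniform_limit (cball 0 R) (\<lambda>k w. (antiquad c ^^ (q * k + M)) (c + \<rho> k * w)) \<phi> sequentially) \<and>
     (\<forall>R>0. uniform_limit (cball 0 R)
        (\<lambda>k w. (antiquad (c + g (\<rho> k * w)) ^^ (q * k + M)) (c + g (\<rho> k * w))) \<phi> sequentially)"
proof -
  obtain \<phi> where hol: "\<phi> holomorphic_on UNIV" and nc: "\<not> \<phi> constant_on UNIV"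
    and lim: "\<And>B k0 (S :: complex set) s \<delta> u. 0 < B \<Longrightarrow> (\<forall>k\<ge>k0. \<forall>w\<in>S. cmod (s w) \<le> B \<and> cmod (\<delta> k w) \<le> B * (1 / cmod \<mu>) ^ k \<and>
         cmod (u k w - b + L (\<delta> k w) / (\<mu> - 1) - s w / \<mu> ^ k) \<le> B * ((1 / cmod \<mu>) ^ k)\<^sup>2) \<Longrightarrow>
       uniform_limit S (\<lambda>k w. (antiquad (c + \<delta> k w) ^^ (q * k)) (u k w)) (\<lambda>w. \<phi> (s w)) sequentially"
    using perturbed_linearization by blast
  define \<eta> where "\<eta> = 1 / cmod \<mu>"
  define A where "A = tangent c c 1 0 M"
  have A: "A \<noteq> 0"
  proof -
    have "cmod A \<noteq> 0" unfolding A_def norm_tangent using nonzero by simp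
    then show ?thesis by auto
  qed
  \<comment> \<open>The same scale for both planes: the inverse of the multiplier of \<open>k\<close> returns to \<open>b\<close>.\<close>
  define \<rho> where "\<rho> k = (1 / \<mu>) ^ k" for k
  have \<eta>: "0 < \<eta>" "\<eta> < 1" using mu(1) mu(2) by (auto simp: \<eta>_def divide_less_eq_1)
  have \<rho>n: "cmod (\<rho> k * w) = \<eta> ^ k * cmod w" for k w
    by (simp add: \<rho>_def \<eta>_def norm_mult norm_power norm_divide)
  have \<rho>s: "A * w / \<mu> ^ k = A * (\<rho> k * w)" for w k
    by (simp add: \<rho>_def power_one_over)
  have small: "\<exists>k0. \<forall>k\<ge>k0. a * \<eta> ^ k \<le> 1" for a :: real
  proof -
    have "(\<lambda>k. a * \<eta> ^ k) \<longlonglongrightarrow> a * 0" by (intro tendsto_intros LIMSEQ_power_zero) (use \<eta> in auto)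
    then have "\<forall>\<^sub>F k in sequentially. a * \<eta> ^ k < 1" by (rule order_tendstoD) simp
    then show ?thesis unfolding eventually_sequentially by (meson less_imp_le)
  qed
  have L0: "L 0 = 0" using tangent_scaleR[of c b 0 0 0 q] by (simp add: L_def)
  obtain C where C: "0 \<le> C" "\<And>v \<delta>. cmod v \<le> 1 \<Longrightarrow> cmod \<delta> \<le> 1 \<Longrightarrow>
     cmod ((antiquad (c + \<delta>) ^^ M) (c + v) - (antiquad c ^^ M) c - tangent c c v \<delta> M)
       \<le> C * (cmod v + cmod \<delta>)\<^sup>2"
    using antiquad_iterate_expansion[where c = c and n = M and z = c] by blast
  have bM: "(antiquad c ^^ M) c = b" by (simp add: b_def x_def)
  have Meven: "even M" by (simp add: M_def)

  define H where "H \<delta> = tangent c c \<delta> \<delta> M + L \<delta> / (\<mu> - 1)" for \<delta>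
  have linH: "linear H"
  proof (rule linearI)
    fix \<delta> \<delta>' :: complex and r :: real
    have "L (\<delta> + \<delta>') = L \<delta> + L \<delta>'" unfolding L_def using tangent_add[of c b 0 0 \<delta> \<delta>' q] by simp
    then show "H (\<delta> + \<delta>') = H \<delta> + H \<delta>'"
      by (simp add: H_def tangent_add add_divide_distrib)
    have "L (r *\<^sub>R \<delta>) = r *\<^sub>R L \<delta>" unfolding L_def using tangent_scaleR[of c b r 0 \<delta> q] by simp
    then show "H (r *\<^sub>R \<delta>) = r *\<^sub>R H \<delta>"
      by (simp add: H_def tangent_scaleR scaleR_add_right) (simp add: scaleR_conv_of_real)
  qed
  have "\<delta> = 0" if "H \<delta> = 0" for \<delta>
  proof (rule transversality)
    show "m \<le> M" by (simp add: M_def)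
    let ?D = "tangent c c \<delta> \<delta> M"
    have "tangent c c \<delta> \<delta> (M + q) = \<mu> * ?D + L \<delta>"
      using tangent_cocycle[of c c \<delta> \<delta> M q] tangent_b by (simp add: bM)
    also have "\<dots> = (\<mu> - 1) * H \<delta> + ?D"
      unfolding H_def using mu(3) by (simp add: distrib_left) (simp add: algebra_simps)
    finally show "tangent c c \<delta> \<delta> (M + q) = ?D" using that by simp
  qed
  then have "inj H" using linH by (simp add: linear_injective_0)
  then obtain G where G: "linear G" "\<And>z. G (H z) = z" "\<And>w. H (G w) = w"
    using linear_injective_isomorphism[OF linH] by blast
  define h where "h z = H z / A" for z
  define g where "g w = G (A * w)" for w
  have linh: "linear h"
    unfolding h_def
  proof (rule linearI)
    show "H (y + z) / A = H y / A + H z / A" for y z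
      by (simp add: linear_add[OF linH] add_divide_distrib)
    show "H (r *\<^sub>R z) / A = r *\<^sub>R (H z / A)" for r z
      unfolding linear_scale[OF linH] by (simp add: scaleR_conv_of_real)
  qed
  have ling: "linear g"
    unfolding g_def by (rule linearI) (simp_all add: distrib_left linear_add[OF G(1)] flip: linear_scale[OF G(1)])
  have gh: "g (h z) = z" for z using A by (simp add: g_def h_def G)
  have hg: "h (g w) = w" for w using A by (simp add: g_def h_def G)
  obtain N where N: "0 < N" "\<And>w. cmod (g w) \<le> N * cmod w"
    using linear_bounded_pos[OF ling] by blast

  show ?thesis
  proof (rule exI[of _ "\<lambda>w. \<phi> (A * w)"], rule exI[of _ h], rule exI[of _ g], rule exI[of _ \<rho>], intro conjI allI impI)
    have "(\<phi> \<circ> (\<lambda>w. A * w)) holomorphic_on UNIV"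
      by (rule holomorphic_on_compose_gen[OF _ hol]) (auto intro: holomorphic_intros)
    then show "(\<lambda>w. \<phi> (A * w)) holomorphic_on UNIV" by (simp add: comp_def)
    show "\<not> (\<lambda>w. \<phi> (A * w)) constant_on UNIV"
    proof
      assume "(\<lambda>w. \<phi> (A * w)) constant_on UNIV"
      then obtain y where y: "\<And>w. \<phi> (A * w) = y" by (auto simp: constant_on_def)
      have "\<phi> w = y" for w using y[of "w / A"] A by simp
      then show False using nc by (auto simp: constant_on_def)
    qed
    show "\<rho> k \<noteq> 0" for k using mu(2) by (simp add: \<rho>_def)
    show "\<rho> \<longlonglongrightarrow> 0"
      unfolding \<rho>_def using mu(1) by (intro LIMSEQ_power_zero) (simp add: norm_divide divide_less_eq_1)
  next
    fix R :: real assume R: "0 < R"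
    obtain k0 where k0: "\<And>k. k0 \<le> k \<Longrightarrow> R * \<eta> ^ k \<le> 1" using small by blast
    have "uniform_limit (cball 0 R) (\<lambda>k w. (antiquad (c + 0) ^^ (q * k)) ((antiquad c ^^ M) (c + \<rho> k * w)))
        (\<lambda>w. \<phi> (A * w)) sequentially"
    proof (rule lim[of "cmod A * R + C * R\<^sup>2 + 1" k0 _ "\<lambda>w. A * w" "\<lambda>_ _. 0"], goal_cases)
      case 1
      then show ?case using C(1) R by (intro add_nonneg_pos) auto
    next
      case 2
      show ?case
      proof (intro allI impI ballI conjI)
        fix k w assume k: "k0 \<le> k" and w: "w \<in> cball (0::complex) R"
        have "cmod (\<rho> k * w) \<le> R * \<eta> ^ k"
          unfolding \<rho>n using w \<eta>(1) by (simp add: mult.commute mult_right_mono)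
        then have v: "cmod (\<rho> k * w) \<le> R * \<eta> ^ k" "cmod (\<rho> k * w) \<le> 1" using k0[OF k] by auto
        have "cmod (A * w) \<le> cmod A * R" using w by (simp add: norm_mult mult_left_mono)
        then show "cmod (A * w) \<le> cmod A * R + C * R\<^sup>2 + 1" using C(1) by (smt (verit) mult_nonneg_nonneg zero_le_power2)
        show "cmod 0 \<le> (cmod A * R + C * R\<^sup>2 + 1) * (1 / cmod \<mu>) ^ k" using C(1) R by simp
        have "cmod ((antiquad c ^^ M) (c + \<rho> k * w) - b - A * (\<rho> k * w)) \<le> C * (cmod (\<rho> k * w))\<^sup>2"
          using C(2)[OF v(2), of 0] tangent_parity(1)[OF Meven, of c c "\<rho> k * w"]
          by (simp add: bM A_def mult.commute)
        also have "\<dots> \<le> C * (R * \<eta> ^ k)\<^sup>2" using v C(1) by (intro mult_left_mono power_mono) auto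
        also have "\<dots> = (C * R\<^sup>2) * (\<eta> ^ k)\<^sup>2" by (simp add: power_mult_distrib)
        also have "\<dots> \<le> (cmod A * R + C * R\<^sup>2 + 1) * (\<eta> ^ k)\<^sup>2"
          using R by (intro mult_right_mono) auto
        finally show "cmod ((antiquad c ^^ M) (c + \<rho> k * w) - b + L 0 / (\<mu> - 1) - A * w / \<mu> ^ k)
            \<le> (cmod A * R + C * R\<^sup>2 + 1) * ((1 / cmod \<mu>) ^ k)\<^sup>2"
          unfolding \<rho>s L0 \<eta>_def by simp
      qed
    qed
    then show "uniform_limit (cball 0 R) (\<lambda>k w. (antiquad c ^^ (q * k + M)) (c + \<rho> k * w))
        (\<lambda>w. \<phi> (A * w)) sequentially"
      by (simp add: funpow_add)
  next
    fix R :: real assume R: "0 < R"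
    obtain k0 where k0: "\<And>k. k0 \<le> k \<Longrightarrow> (N * R) * \<eta> ^ k \<le> 1" using small by blast
    let ?\<delta> = "\<lambda>k w. g (\<rho> k * w)"
    let ?B = "cmod A * R + N * R + C * (2 * N * R)\<^sup>2 + 1"
    have "uniform_limit (cball 0 R) (\<lambda>k w. (antiquad (c + ?\<delta> k w) ^^ (q * k)) ((antiquad (c + ?\<delta> k w) ^^ M) (c + ?\<delta> k w)))
        (\<lambda>w. \<phi> (A * w)) sequentially"
    proof (rule lim[of ?B k0 _ "\<lambda>w. A * w" ?\<delta>], goal_cases)
      case 1
      then show ?case using C(1) R N(1) by (intro add_nonneg_pos add_nonneg_nonneg) auto
    next
      case 2
      have nn: "0 \<le> cmod A * R" "0 \<le> N * R" "0 \<le> C * (2 * N * R)\<^sup>2" using C(1) R N(1) by auto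
      show ?case
      proof (intro allI impI ballI conjI)
        fix k w assume k: "k0 \<le> k" and w: "w \<in> cball (0::complex) R"
        define \<delta> where "\<delta> = g (\<rho> k * w)"
        have "cmod (\<rho> k * w) \<le> R * \<eta> ^ k"
          unfolding \<rho>n using w \<eta>(1) by (simp add: mult.commute mult_right_mono)
        then have "N * cmod (\<rho> k * w) \<le> N * (R * \<eta> ^ k)" using N(1) by (intro mult_left_mono) auto
        then have v: "cmod \<delta> \<le> N * R * \<eta> ^ k" unfolding \<delta>_def using N(2)[of "\<rho> k * w"] by (simp add: mult.assoc)
        have v1: "cmod \<delta> \<le> 1" using v k0[OF k] by simp
        have "cmod (A * w) \<le> cmod A * R" using w by (simp add: norm_mult mult_left_mono)
        then show "cmod (A * w) \<le> ?B" using nn by linarith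
        have "N * R * \<eta> ^ k \<le> ?B * \<eta> ^ k" using nn \<eta> by (intro mult_right_mono) auto
        then show "cmod (g (\<rho> k * w)) \<le> ?B * (1 / cmod \<mu>) ^ k"
          using v unfolding \<eta>_def[symmetric] \<delta>_def[symmetric] by linarith
        have "A * (\<rho> k * w) = H \<delta>"
          using hg[of "\<rho> k * w"] A by (simp add: h_def \<delta>_def nonzero_divide_eq_eq mult.commute)
        then have "(antiquad (c + \<delta>) ^^ M) (c + \<delta>) - b + L \<delta> / (\<mu> - 1) - A * w / \<mu> ^ k
            = (antiquad (c + \<delta>) ^^ M) (c + \<delta>) - b - tangent c c \<delta> \<delta> M"
          unfolding \<rho>s by (simp add: H_def)
        also have "cmod \<dots> \<le> C * (cmod \<delta> + cmod \<delta>)\<^sup>2"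
          using C(2)[OF v1 v1] by (simp add: bM)
        also have "\<dots> \<le> C * (2 * N * R * \<eta> ^ k)\<^sup>2" using v C(1) by (intro mult_left_mono power_mono) auto
        also have "\<dots> = (C * (2 * N * R)\<^sup>2) * (\<eta> ^ k)\<^sup>2" by (simp add: power_mult_distrib)
        also have "\<dots> \<le> ?B * (\<eta> ^ k)\<^sup>2" using nn by (intro mult_right_mono) auto
        finally show "cmod ((antiquad (c + g (\<rho> k * w)) ^^ M) (c + g (\<rho> k * w)) - b
              + L (g (\<rho> k * w)) / (\<mu> - 1) - A * w / \<mu> ^ k) \<le> ?B * ((1 / cmod \<mu>) ^ k)\<^sup>2"
          unfolding \<eta>_def[symmetric] \<delta>_def[symmetric] .
      qed
    qed
    then show "uniform_limit (cball 0 R) (\<lambda>k w. (antiquad (c + g (\<rho> k * w)) ^^ (q * k + M)) (c + g (\<rho> k * w)))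
        (\<lambda>w. \<phi> (A * w)) sequentially"
      by (simp add: funpow_add)
  qed (fact linh ling gh hg)+
qed

end

lemma antiquad_iterate_Suc:
  "(antiquad c ^^ Suc n) z = cnj ((antiquad c ^^ n) z) * cnj ((antiquad c ^^ n) z) + c"
  by (simp add: antiquad_def power2_eq_square)

lemma uniform_limit_antiquad_iterate:
  fixes l :: "complex \<Rightarrow> complex"
  assumes S: "compact S" and \<gamma>: "uniform_limit S \<gamma> (\<lambda>_. c) sequentially"
    and \<zeta>: "uniform_limit S \<zeta> l sequentially" and l: "continuous_on S l"
  shows "uniform_limit S (\<lambda>k z. (antiquad (\<gamma> k z) ^^ n) (\<zeta> k z)) (\<lambda>z. (antiquad c ^^ n) (l z)) sequentially"
proof (induction n)
  case (Suc n)
  have "continuous_on S (\<lambda>z. cnj ((antiquad c ^^ n) (l z)))"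
    by (intro continuous_intros l)
  then have bd: "bounded ((\<lambda>z. cnj ((antiquad c ^^ n) (l z))) ` S)"
    by (intro compact_imp_bounded compact_continuous_image S)
  have "uniform_limit S (\<lambda>k z. cnj ((antiquad (\<gamma> k z) ^^ n) (\<zeta> k z))) (\<lambda>z. cnj ((antiquad c ^^ n) (l z))) sequentially"
    by (rule bounded_linear.uniform_limit[OF bounded_linear_cnj Suc])
  from uniform_limit_add[OF uniform_lim_mult[OF this this bd bd] \<gamma>]
  show ?case unfolding antiquad_iterate_Suc .
qed (simp add: \<zeta>)

lemma periodic_parameter_in_tricorn:
  assumes "(antiquad c ^^ Suc n) c = c" shows "c \<in> tricorn"
proof -
  have "(antiquad c ^^ k) c \<in> (\<lambda>k. (antiquad c ^^ k) c) ` {..n}" for k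
    using funpow_mod_eq[OF assms, of k] by (intro image_eqI[of _ _ "k mod Suc n"]) (auto simp: less_Suc_eq_le[symmetric])
  then have "range (\<lambda>k. (antiquad c ^^ k) c) \<subseteq> (\<lambda>k. (antiquad c ^^ k) c) ` {..n}" by blast
  then have "finite (range (\<lambda>k. (antiquad c ^^ k) c))" by (rule finite_subset) simp
  then show ?thesis unfolding tricorn_def by (simp add: finite_imp_bounded)
qed

lemma filled_julia_if_even_orbit_bounded:
  assumes "\<And>n. cmod ((antiquad c ^^ (2 * n)) z) \<le> B" shows "z \<in> filled_julia c"
proof -
  have "cmod ((antiquad c ^^ n) z) \<le> max B (B\<^sup>2 + cmod c)" for n
  proof (cases "even n")
    case True
    then obtain j where "n = 2 * j" by blast
    then show ?thesis using assms[of j] by simp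
  next
    case False
    then obtain j where n: "n = Suc (2 * j)" using oddE by (metis Suc_eq_plus1)
    let ?y = "(antiquad c ^^ (2 * j)) z"
    have "cmod ((antiquad c ^^ n) z) \<le> (cmod ?y)\<^sup>2 + cmod c"
      unfolding n by (simp add: antiquad_def[of c ?y] norm_triangle_le norm_power)
    also have "\<dots> \<le> B\<^sup>2 + cmod c" using assms[of j] by (intro add_mono power_mono) auto
    finally show ?thesis by simp
  qed
  then show ?thesis unfolding filled_julia_def bounded_iff by blast
qed

text \<open>If both values were omitted near \<open>w\<close>, the functions \<open>h n\<close> would omit 0 and 1 while being bounded at
\<open>w\<close>, hence bounded near \<open>w\<close> uniformly in \<open>n\<close>. Then \<open>\<phi>\<close> would map a neighbourhood of \<open>w\<close> onto an open
subset of the filled Julia set.\<close>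
lemma hits_critical_or_parameter:
  fixes \<phi> :: "complex \<Rightarrow> complex"
  assumes c: "c \<noteq> 0" and int: "interior (filled_julia c) = {}"
    and hol: "\<phi> holomorphic_on UNIV" and nc: "\<not> \<phi> constant_on UNIV"
    and w: "\<phi> w \<in> filled_julia c" and e: "0 < e"
  shows "\<exists>n. \<exists>z\<in>ball w e. (antiquad c ^^ (2 * n)) (\<phi> z) \<in> {0, c}"
proof (rule ccontr)
  assume no: "\<not> ?thesis"
  define h where "h n z = (antiquad c ^^ (2 * n)) (\<phi> z) / c" for n z
  have hh: "h n holomorphic_on ball w e" for n
  proof -
    have "((antiquad c ^^ (2 * n)) \<circ> \<phi>) holomorphic_on UNIV"
      by (rule holomorphic_on_compose_gen[OF hol]) (auto intro: holomorphic_antiquad_iterate)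
    from holomorphic_on_divide[OF this holomorphic_on_const[of c]]
    have "(\<lambda>z. ((antiquad c ^^ (2 * n)) \<circ> \<phi>) z / c) holomorphic_on UNIV" using c by blast
    then show ?thesis unfolding h_def[abs_def] comp_def by (rule holomorphic_on_subset) simp
  qed
  have pos: "0 < (2 + cmod c) / cmod c"
    using c by (intro divide_pos_pos add_pos_nonneg) auto
  obtain B Z where BZ: "0 < B" "open Z" "w \<in> Z" "Z \<subseteq> ball w e"
    "\<And>f z. f \<in> range h \<Longrightarrow> z \<in> Z \<Longrightarrow> cmod (f z) \<le> B"
  proof (rule GPicard1[of "ball w e" w "(2 + cmod c) / cmod c" "range h" "range h"])
    show "f z \<noteq> 0 \<and> f z \<noteq> 1" if "f \<in> range h" "z \<in> ball w e" for f z
      using that no c by (auto simp: h_def)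
    show "cmod (f w) \<le> (2 + cmod c) / cmod c" if "f \<in> range h" for f
      using that w by (auto simp: h_def norm_divide filled_julia_iff intro!: divide_right_mono)
  qed (use e pos hh in auto)
  have "\<phi> z \<in> filled_julia c" if z: "z \<in> Z" for z
  proof (rule filled_julia_if_even_orbit_bounded)
    fix n
    have "cmod (h n z) \<le> B" using BZ(5) z by blast
    then show "cmod ((antiquad c ^^ (2 * n)) (\<phi> z)) \<le> B * cmod c"
      using c by (simp add: h_def norm_divide pos_divide_le_eq)
  qed
  moreover have "open (\<phi> ` Z)"
    by (rule open_mapping_thm[OF hol open_UNIV connected_UNIV BZ(2) _ nc]) simp
  ultimately have "\<phi> w \<in> interior (filled_julia c)"
    using interior_maximal[of "\<phi> ` Z" "filled_julia c"] BZ(3) by blast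
  then show False using int by simp
qed

theorem theorem9:
  fixes c0 :: complex
  assumes "c0 \<in> frontier tricorn" and "misiurewicz c0"
  shows "\<exists>(\<phi> :: complex \<Rightarrow> complex) (h :: complex \<Rightarrow> complex) (\<rho> :: nat \<Rightarrow> complex).
    \<phi> holomorphic_on UNIV \<and> linear h \<and> (\<forall>k. \<rho> k \<noteq> 0) \<and> \<rho> \<longlonglongrightarrow> 0 \<and>
    (\<exists>r0>0. \<forall>r\<ge>r0.
       hausdorff_tendsto
         (\<lambda>k. truncate_disk ((\<lambda>z. inverse (\<rho> k) * (z - c0)) ` julia c0) r)
         (truncate_disk (\<phi> -` julia c0) r) \<and>
       hausdorff_tendsto
         (\<lambda>k. truncate_disk ((\<lambda>z. inverse (\<rho> k) * h (z - c0)) ` tricorn) r)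
         (truncate_disk (\<phi> -` julia c0) r))"
proof -
  obtain m q where "misiurewicz_orbit c0 m q" using misiurewicz_imp_orbit[OF assms(2)] by blast
  then interpret misiurewicz_orbit c0 m q .
  obtain \<phi> h g \<rho> where hol: "\<phi> holomorphic_on UNIV" and nc: "\<not> \<phi> constant_on UNIV"
    and lin: "linear h" "linear g" and gh: "\<And>z. g (h z) = z" and hg: "\<And>w. h (g w) = w"
    and \<rho>: "\<And>k. \<rho> k \<noteq> 0" "\<rho> \<longlonglongrightarrow> 0"
    and dyn: "\<And>R. 0 < R \<Longrightarrow> uniform_limit (cball 0 R)
        (\<lambda>k w. (antiquad c0 ^^ (q * k + M)) (c0 + \<rho> k * w)) \<phi> sequentially"
    and par: "\<And>R. 0 < R \<Longrightarrow> uniform_limit (cball 0 R)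
        (\<lambda>k w. (antiquad (c0 + g (\<rho> k * w)) ^^ (q * k + M)) (c0 + g (\<rho> k * w))) \<phi> sequentially"
    using rescaling_limits by blast
  define K where "K = filled_julia c0"
  have c0: "c0 \<noteq> 0" using nonzero[of 0] by simp
  have \<phi>c: "continuous_on S \<phi>" for S
    using hol by (meson continuous_on_subset holomorphic_on_imp_continuous_on subset_UNIV)
  have gb: "bounded_linear g" using lin(2) by (simp add: linear_conv_bounded_linear)
  have gc: "continuous_on S (\<lambda>w. g (f w))" if "continuous_on S f" for f :: "complex \<Rightarrow> complex" and S
    by (rule bounded_linear.continuous_on[OF gb that])
  define AK where "AK k = {w. c0 + \<rho> k * w \<in> K}" for k
  define AT where "AT k = {w. c0 + g (\<rho> k * w) \<in> tricorn}" for k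
  have cancel: "\<rho> k * (inverse (\<rho> k) * y) = y" for k y
    using \<rho>(1)[of k] by (simp flip: mult.assoc)
  have AK: "(\<lambda>z. inverse (\<rho> k) * (z - c0)) ` julia c0 = AK k" for k
  proof (intro equalityI subsetI)
    fix w assume "w \<in> AK k"
    then show "w \<in> (\<lambda>z. inverse (\<rho> k) * (z - c0)) ` julia c0"
      using \<rho>(1)[of k] by (intro image_eqI[of _ _ "c0 + \<rho> k * w"]) (auto simp: AK_def K_def julia_eq_filled_julia)
  qed (auto simp: AK_def K_def julia_eq_filled_julia cancel)
  have AT: "(\<lambda>z. inverse (\<rho> k) * h (z - c0)) ` tricorn = AT k" for k
  proof (intro equalityI subsetI)
    fix w assume "w \<in> AT k"
    then show "w \<in> (\<lambda>z. inverse (\<rho> k) * h (z - c0)) ` tricorn"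
      using \<rho>(1)[of k] by (intro image_eqI[of _ _ "c0 + g (\<rho> k * w)"]) (auto simp: AT_def hg)
  qed (auto simp: AT_def gh cancel)
  have B: "\<phi> -` julia c0 = {w. \<phi> w \<in> K}" by (auto simp: K_def julia_eq_filled_julia)
  have closed: "closed (AK k)" "closed (AT k)" "closed {w. \<phi> w \<in> K}" for k
  proof -
    have "closed ((\<lambda>w. c0 + \<rho> k * w) -` K)"
      by (intro closed_vimage continuous_intros) (simp add: K_def closed_filled_julia)
    then show "closed (AK k)" by (simp add: AK_def vimage_def)
    have "closed ((\<lambda>w. c0 + g (\<rho> k * w)) -` tricorn)"
      by (intro closed_vimage closed_tricorn continuous_intros gc)
    then show "closed (AT k)" by (simp add: AT_def vimage_def)
    have "closed (\<phi> -` K)"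
      by (intro closed_vimage \<phi>c) (simp add: K_def closed_filled_julia)
    then show "closed {w. \<phi> w \<in> K}" by (simp add: vimage_def)
  qed
  have params: "(\<lambda>j. c0 + g (\<rho> (s j) * w j)) \<longlonglongrightarrow> c0"
    if "strict_mono s" "w \<longlonglongrightarrow> z" for s :: "nat \<Rightarrow> nat" and w z
  proof -
    have "(\<lambda>j. \<rho> (s j)) \<longlonglongrightarrow> 0" using LIMSEQ_subseq_LIMSEQ[OF \<rho>(2) that(1)] by (simp add: comp_def)
    then have "(\<lambda>j. \<rho> (s j) * w j) \<longlonglongrightarrow> 0 * z" using that(2) by (rule tendsto_mult)
    then have "(\<lambda>j. g (\<rho> (s j) * w j)) \<longlonglongrightarrow> g (0 * z)" by (rule bounded_linear.tendsto[OF gb])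
    then have "(\<lambda>j. g (\<rho> (s j) * w j)) \<longlonglongrightarrow> 0" using linear_0[OF lin(2)] by simp
    then show ?thesis using tendsto_add[OF tendsto_const[of c0]] by fastforce
  qed
  have moving: "(\<lambda>j. f (s j) (w j)) \<longlonglongrightarrow> \<phi> z"
    if f: "\<And>R. 0 < R \<Longrightarrow> uniform_limit (cball 0 R) f \<phi> sequentially" and s: "strict_mono s" and w: "w \<longlonglongrightarrow> z"
    for f :: "nat \<Rightarrow> complex \<Rightarrow> complex" and s w z
  proof (rule uniform_limit_moving_point[OF f])
    show "0 < cmod z + 1" by (simp add: add_nonneg_pos)
    show "filterlim s sequentially sequentially" using s by (rule filterlim_subseq)
    show "\<forall>\<^sub>F j in sequentially. w j \<in> cball 0 (cmod z + 1)"
      using tendstoD[OF w zero_less_one]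
    proof eventually_elim
      case (elim j)
      then show ?case using norm_triangle_ineq[of z "w j - z"] by (simp add: dist_norm)
    qed
  qed (use w \<phi>c in auto)
  have upperK: "z \<in> {w. \<phi> w \<in> K}"
    if s: "strict_mono s" and w: "\<And>j. w j \<in> AK (s j)" and lim: "w \<longlonglongrightarrow> z" for s w z
  proof -
    have lim\<phi>: "(\<lambda>j. (antiquad c0 ^^ (q * s j + M)) (c0 + \<rho> (s j) * w j)) \<longlonglongrightarrow> \<phi> z"
      by (rule moving[OF dyn s lim])
    have inK: "(antiquad c0 ^^ (q * s j + M)) (c0 + \<rho> (s j) * w j) \<in> K" for j
      using w[of j] by (simp only: AK_def K_def antiquad_iterate_in_filled_julia_iff mem_Collect_eq)
    have "\<phi> z \<in> K"
      by (rule closed_sequentially[OF closed_filled_julia[of c0, folded K_def] inK lim\<phi>])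
    then show ?thesis by simp
  qed
  have upperT: "z \<in> {w. \<phi> w \<in> K}"
    if s: "strict_mono s" and w: "\<And>j. w j \<in> AT (s j)" and lim: "w \<longlonglongrightarrow> z" for s w z
  proof -
    define \<gamma> where "\<gamma> j = c0 + g (\<rho> (s j) * w j)" for j
    define \<zeta> where "\<zeta> j = (antiquad (\<gamma> j) ^^ (q * s j + M)) (\<gamma> j)" for j
    have \<gamma>: "\<gamma> \<longlonglongrightarrow> c0" unfolding \<gamma>_def by (rule params[OF s lim])
    have \<zeta>: "\<zeta> \<longlonglongrightarrow> \<phi> z" unfolding \<zeta>_def \<gamma>_def by (rule moving[OF par s lim])
    have bd: "cmod ((antiquad (\<gamma> j) ^^ n) (\<zeta> j)) \<le> 2 + cmod (\<gamma> j)" for n j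
    proof -
      have "\<gamma> j \<in> filled_julia (\<gamma> j)"
        using w[of j] by (simp add: AT_def \<gamma>_def flip: tricorn_iff_filled_julia)
      then have "\<zeta> j \<in> filled_julia (\<gamma> j)" unfolding \<zeta>_def by (simp only: antiquad_iterate_in_filled_julia_iff)
      then show ?thesis unfolding filled_julia_iff by blast
    qed
    have "cmod ((antiquad c0 ^^ n) (\<phi> z)) \<le> 2 + cmod c0" for n
    proof -
      have "continuous_on UNIV (\<lambda>p. (antiquad (fst p) ^^ n) (snd p))"
        by (intro continuous_intros)
      then have "isCont (\<lambda>p. (antiquad (fst p) ^^ n) (snd p)) (c0, \<phi> z)"
        by (simp add: continuous_on_eq_continuous_at)
      from isCont_tendsto_compose[OF this tendsto_Pair[OF \<gamma> \<zeta>]]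
      have "(\<lambda>j. (antiquad (\<gamma> j) ^^ n) (\<zeta> j)) \<longlonglongrightarrow> (antiquad c0 ^^ n) (\<phi> z)" by simp
      then show ?thesis
        by (rule LIMSEQ_le[OF tendsto_norm tendsto_add[OF tendsto_const tendsto_norm[OF \<gamma>]]]) (use bd in blast)
    qed
    then show ?thesis by (simp add: K_def filled_julia_iff)
  qed
  have sub: "cball w e \<subseteq> cball 0 (cmod w + e)" for w :: complex and e
  proof
    fix y assume "y \<in> cball w e"
    then show "y \<in> cball 0 (cmod w + e)"
      using norm_triangle_ineq[of w "y - w"] by (simp add: dist_norm norm_minus_commute)
  qed
  have lowerK: "\<forall>\<^sub>F k in sequentially. AK k \<inter> ball w e \<noteq> {}"
    if w: "w \<in> {w. \<phi> w \<in> K}" and e: "0 < e" for w e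
  proof -
    have "\<forall>\<^sub>F k in sequentially. \<exists>z\<in>ball w e. (antiquad c0 ^^ (q * k + M)) (c0 + \<rho> k * z) - \<phi> w = 0"
    proof (rule zeros_persist[where f = "\<lambda>z. \<phi> z - \<phi> w"])
      show "(\<lambda>z. \<phi> z - \<phi> w) holomorphic_on UNIV" by (intro holomorphic_intros hol)
      show "\<not> (\<lambda>z. \<phi> z - \<phi> w) constant_on UNIV"
        using nc by (auto simp: constant_on_def) (metis diff_add_cancel)
      show "uniform_limit (cball w e) (\<lambda>k z. (antiquad c0 ^^ (q * k + M)) (c0 + \<rho> k * z) - \<phi> w)
          (\<lambda>z. \<phi> z - \<phi> w) sequentially"
        by (intro uniform_limit_minus uniform_limit_const uniform_limit_on_subset[OF dyn sub])
           (use e in \<open>simp add: add_nonneg_pos\<close>)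
    qed (auto intro!: continuous_intros e)
    then show ?thesis
    proof eventually_elim
      case (elim k)
      then obtain z where z: "z \<in> ball w e" "(antiquad c0 ^^ (q * k + M)) (c0 + \<rho> k * z) = \<phi> w" by auto
      then have "(antiquad c0 ^^ (q * k + M)) (c0 + \<rho> k * z) \<in> K" using w by simp
      then have "z \<in> AK k" unfolding AK_def K_def antiquad_iterate_in_filled_julia_iff by simp
      then show ?case using z by blast
    qed
  qed
  have lowerT: "\<forall>\<^sub>F k in sequentially. AT k \<inter> ball w e \<noteq> {}"
    if w: "w \<in> {w. \<phi> w \<in> K}" and e: "0 < e" for w e
  proof -
    have "\<exists>n. \<exists>z\<in>ball w (e / 2). (antiquad c0 ^^ (2 * n)) (\<phi> z) \<in> {0, c0}"
      by (rule hits_critical_or_parameter[OF c0 interior_filled_julia_empty hol nc]) (use w e in \<open>auto simp: K_def\<close>)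
    then obtain n \<xi> a where \<xi>: "\<xi> \<in> ball w (e / 2)" and a: "a \<in> {0, 1}"
      and hit: "(antiquad c0 ^^ (2 * n)) (\<phi> \<xi>) = a * c0"
      by (metis insert_iff mult_1 mult_zero_left empty_iff)
    let ?S = "cball \<xi> (e / 2)"
    let ?\<gamma> = "\<lambda>k z. c0 + g (\<rho> k * z)"
    let ?f = "\<lambda>z. (antiquad c0 ^^ (2 * n)) (\<phi> z) - a * c0"
    let ?F = "\<lambda>k z. (antiquad (?\<gamma> k z) ^^ (2 * n)) ((antiquad (?\<gamma> k z) ^^ (q * k + M)) (?\<gamma> k z)) - a * ?\<gamma> k z"
    have \<gamma>: "uniform_limit ?S ?\<gamma> (\<lambda>_. c0) sequentially"
    proof -
      have "uniform_limit ?S (\<lambda>k z. \<rho> k * z) (\<lambda>z. 0 * z) sequentially"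
      proof (rule uniform_lim_mult)
        show "uniform_limit ?S (\<lambda>k z. \<rho> k) (\<lambda>z. 0) sequentially"
          by (rule uniform_limitI) (use tendstoD[OF \<rho>(2)] in simp)
        show "uniform_limit ?S (\<lambda>k z. z) (\<lambda>z. z) sequentially" by (rule uniform_limit_const)
      qed (auto simp: image_constant_conv)
      then have "uniform_limit ?S (\<lambda>k z. c0 + g (\<rho> k * z)) (\<lambda>z. c0 + g (0 * z)) sequentially"
        by (intro uniform_limit_add uniform_limit_const bounded_linear.uniform_limit[OF gb])
      then show ?thesis using linear_0[OF lin(2)] by simp
    qed
    have "\<forall>\<^sub>F k in sequentially. \<exists>z\<in>ball \<xi> (e / 2). ?F k z = 0"
    proof (rule zeros_persist[where f = ?f])
      have "((antiquad c0 ^^ (2 * n)) \<circ> \<phi>) holomorphic_on UNIV"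
        by (rule holomorphic_on_compose_gen[OF hol]) (auto intro: holomorphic_antiquad_iterate)
      then show "?f holomorphic_on UNIV" by (intro holomorphic_intros) (simp add: comp_def)
      show "\<not> ?f constant_on UNIV"
      proof
        assume "?f constant_on UNIV"
        then obtain y where y: "\<And>z. (antiquad c0 ^^ (2 * n)) (\<phi> z) - a * c0 = y"
          by (auto simp: constant_on_def)
        have "open (\<phi> ` UNIV)"
          by (rule open_mapping_thm[OF hol open_UNIV connected_UNIV open_UNIV _ nc]) simp
        then have "open ((antiquad c0 ^^ (2 * n)) ` (\<phi> ` UNIV))" by (rule open_antiquad_iterate_image)
        moreover have eq: "(antiquad c0 ^^ (2 * n)) (\<phi> z) = y + a * c0" for z using y[of z] by (simp add: algebra_simps)
        have "(antiquad c0 ^^ (2 * n)) ` (\<phi> ` UNIV) = {y + a * c0}" unfolding image_image eq by auto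
        ultimately show False using not_open_singleton[of "y + a * c0"] by simp
      qed
      show "?f \<xi> = 0" using hit by simp
      show "continuous_on ?S (?F k)" for k
        by (intro continuous_intros gc)
      show "uniform_limit ?S ?F ?f sequentially"
      proof (intro uniform_limit_minus uniform_limit_antiquad_iterate \<gamma> \<phi>c)
        show "uniform_limit ?S (\<lambda>k z. (antiquad (?\<gamma> k z) ^^ (q * k + M)) (?\<gamma> k z)) \<phi> sequentially"
          by (rule uniform_limit_on_subset[OF par sub]) (use e in \<open>simp add: add_nonneg_pos\<close>)
        show "uniform_limit ?S (\<lambda>k z. a * ?\<gamma> k z) (\<lambda>z. a * c0) sequentially"
          by (rule bounded_linear.uniform_limit[OF bounded_linear_mult_right \<gamma>])
      qed simp
    qed (use e in auto)
    then show ?thesis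
    proof eventually_elim
      case (elim k)
      then obtain z where z: "z \<in> ball \<xi> (e / 2)" "?F k z = 0" by blast
      define \<gamma> where "\<gamma> = ?\<gamma> k z"
      have hit\<gamma>: "(antiquad \<gamma> ^^ (2 * n + (q * k + M))) \<gamma> = a * \<gamma>"
        using z(2) by (simp add: funpow_add \<gamma>_def)
      have "\<gamma> \<in> tricorn"
      proof (cases "a = 0")
        case True
        then have "(antiquad \<gamma> ^^ Suc (2 * n + (q * k + M))) \<gamma> = \<gamma>"
          using hit\<gamma> by (simp add: antiquad_def)
        then show ?thesis by (rule periodic_parameter_in_tricorn)
      next
        case False
        moreover obtain j where "2 * n + (q * k + M) = Suc j" using m_pos by (cases "2 * n + (q * k + M)") (auto simp: M_def)
        ultimately have "(antiquad \<gamma> ^^ Suc j) \<gamma> = \<gamma>" using hit\<gamma> a by simp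
        then show ?thesis by (rule periodic_parameter_in_tricorn)
      qed
      then have "z \<in> AT k" by (simp add: AT_def \<gamma>_def)
      moreover have "dist w z < e" using z(1) \<xi> by (metis dist_commute dist_triangle_half_l mem_ball)
      ultimately show ?case by auto
    qed
  qed
  show ?thesis
  proof (rule exI[of _ \<phi>], rule exI[of _ h], rule exI[of _ \<rho>], intro conjI exI[of _ 1] allI impI)
    fix r :: real assume "1 \<le> r"
    then have r: "0 < r" by simp
    show "hausdorff_tendsto
         (\<lambda>k. truncate_disk ((\<lambda>z. inverse (\<rho> k) * (z - c0)) ` julia c0) r)
         (truncate_disk (\<phi> -` julia c0) r)"
      unfolding AK B by (rule hausdorff_tendsto_truncate_disk[OF r closed(1,3) upperK lowerK])
    show "hausdorff_tendsto
         (\<lambda>k. truncate_disk ((\<lambda>z. inverse (\<rho> k) * h (z - c0)) ` tricorn) r)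
         (truncate_disk (\<phi> -` julia c0) r)"
      unfolding AT B by (rule hausdorff_tendsto_truncate_disk[OF r closed(2,3) upperT lowerT])
  qed (use hol lin(1) \<rho> in auto)
qed

end
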